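(* Let $\mathtt v\in V^*$ satisfy: (i) $G_{\mathtt v}$ is the maximum element, with respect to inclusion, of the set $\{G_{\mathtt w}:\mathtt w\in\gimel\cdot\mathtt v\}$; (ii) every orbit of $G_{\mathtt v}$ in each $I^{(i)}$ has the form $\{(i,p),(i,p+1),\dots,(i,p+q)\}$ for some $p,q$. Let $M_{\mathtt v}\subset\mathbf R^*$ be the linear span of $$\underline{\mathbf B}=\bigcup_{j\in J}\bigcup_{w\in G_{\mathtt v}}\{\mathrm{ev}_{\mathtt v}\circ\partial_w\circ\xi_j\}.$$ Then $M_{\mathtt v}$ is closed under the (right) action of $U_\lambda$ on $\mathbf R^*$; moreover, the set $$\mathbf B=\bigcup_{j\in J}\bigcup_{w\in X_j}\{\mathrm{ev}_{\mathtt v}\circ\partial_w\circ\xi_j\}$$ is a basis of $M_{\mathtt v}$.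
   Context: Let $k\ge 1$ and let $\lambda=(\lambda_1,\dots,\lambda_k)$ be positive integers. Let $I$ be the set of pairs $(i,j)$ with $1\le i\le k$, $1\le j\le \lambda_i$; $I^{(i)}=\{(i,j):1\le j\le\lambda_i\}$, and $I^{(0)}=\emptyset$ (a product over the empty set is $1$). Let $\Omega=\mathbb{C}(x_{\mathbf a}:\mathbf a\in I)$ and $R=\mathbb{C}[x_{\mathbf a}:\mathbf a\in I]\subset\Omega$. For $\mathbf a\in I$, $\varphi_{\mathbf a}$ is the $\mathbb{C}$-automorphism of the field $\Omega$ with $\varphi_{\mathbf a}(x_{\mathbf b})=x_{\mathbf b}+\delta_{\mathbf a,\mathbf b}$; $\gimel$ is the abelian group generated by the $\varphi_{(i,j)}$ with $i<k$. For $i=1,\dots,k-1$ define operators on $\Omega$ $$E_i=\sum_{j=1}^{\lambda_i}\frac{\prod_{\mathbf a\in I^{(i+1)}}(x_{(i,j)}-x_{\mathbf a})}{\prod_{\mathbf b\in I^{(i)}\setminus\{(i,j)\}}(x_{(i,j)}-x_{\mathbf b})}\varphi_{(i,j)},\qquad F_i=\sum_{j=1}^{\lambda_i}\frac{\prod_{\mathbf a\in I^{(i-1)}}(x_{(i,j)}-x_{\mathbf a})}{\prod_{\mathbf b\in I^{(i)}\setminus\{(i,j)\}}(x_{(i,j)}-x_{\mathbf b})}\varphi_{(i,j)}^{-1}.$$ For $\mathbf a=(i,j)\in I$, $\gamma_{\mathbf a}$ is multiplication by the $j$-th elementary symmetric polynomial in $\{x_{\mathbf b}:\mathbf b\in I^{(i)}\}$.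 The orthogonal Gelfand-Zeitlin algebra $U_\lambda$ is the algebra of $\mathbb{C}$-linear transformations of $\Omega$ generated by all $E_i,F_i$ ($1\le i\le k-1$) and $\gamma_{\mathbf a}$ ($\mathbf a\in I$). The group $G=S_{\lambda_1}\times\dots\times S_{\lambda_k}$ acts on $\Omega$ and $R$, with $S_{\lambda_i}$ permuting $x_{(i,1)},\dots,x_{(i,\lambda_i)}$; $\underline G=S_{\lambda_1}\times\dots\times S_{\lambda_{k-1}}\subset G$; $\mathbf{R}:=R^G$. The subspace $\mathbf R\subset\Omega$ is stable under $U_\lambda$, so $\mathbf{R}^*=\mathrm{Hom}_{\mathbb C}(\mathbf R,\mathbb C)$ is a right $U_\lambda$-module via $(\ell\cdot u)(f)=\ell(u\cdot f)$. $V$ is the $\mathbb{C}$-span of all $x_{\mathbf a}$, with dual $V^*$, on which $G$ acts by the dual action. For $\mathtt v\in V^*$, $\mathrm{ev}_{\mathtt v}:R\to\mathbb C$ is the $\mathbb{C}$-algebra homomorphism $x_{\mathbf a}\mapsto\mathtt v(x_{\mathbf a})$, and $G_{\mathtt v}$ is the stabilizer of $\mathtt v$ in $\underline G$. $\gimel$ acts on $V^*$ by integer shifts: $\mathrm{ev}_{\xi^{-1}(\mathtt v)}=\mathrm{ev}_{\mathtt v}\circ\xi$ for $\xi\in\gimel$; so $\gimel\cdot\mathtt v$ consists of all $\mathtt w$ with $(\mathtt w-\mathtt v)(x_{(i,j)})\in\mathbb Z$ for $i<k$ and $(\mathtt w-\mathtt v)(x_{(k,j)})=0$. Divided differences: $G$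 is a Coxeter group with simple reflections $s=((i,p),(i,p+1))$ (transpositions of neighbours); $\partial_s=\frac{\mathrm{id}-s}{x_{(i,p)}-x_{(i,p+1)}}$, and $\partial_w=\partial_{s_1}\cdots\partial_{s_l}$ for a reduced expression $w=s_1\cdots s_l$ (independent of the reduced expression). For $\mathtt v$ as in the claim, $\gimel\cdot\mathtt v$ is $G_{\mathtt v}$-invariant and decomposes into $G_{\mathtt v}$-orbits $\gimel\cdot\mathtt v=\coprod_{j\in J}\mathcal O_j$. For $j\in J$, $\mathtt u_j$ is the unique representative of $\mathcal O_j$ such that, whenever $(i,p)$ and $(i,p+1)$ lie in the same $G_{\mathtt v}$-orbit, $(\mathtt u_j-\mathtt v)(x_{(i,p)})\ge(\mathtt u_j-\mathtt v)(x_{(i,p+1)})$ (both integers). $\xi_j\in\gimel$ is defined by $\mathtt u_j=\xi_j^{-1}(\mathtt v)$, i.e. $\mathrm{ev}_{\mathtt v}\circ\xi_j=\mathrm{ev}_{\mathtt u_j}$ on $R$. $X_j$ is the set of shortest representatives of the cosets in $G_{\mathtt v}/G_{\mathtt u_j}$. The maps $\mathrm{ev}_{\mathtt v}\circ\partial_w\circ\xi_j$ are regarded as elements of $\mathbf R^*$ by restriction to $\mathbf R$. *)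

theory Defs
  imports
    Complex_Main
    "HOL-Library.Poly_Mapping"
    "HOL-Library.Product_Lexorder"
    "HOL-Library.Function_Algebras"
    "HOL-Library.FuncSet"
    "HOL-Computational_Algebra.Fraction_Field"
    "HOL-Combinatorics.Permutations"
begin

section \<open>Polynomials and rational functions\<close>

text \<open>
  The ambient types have a variable for every pair of natural numbers; the sets \<open>R\<close> and
  \<open>Omega\<close> below single out the polynomials and rational functions in the variables indexed
  by \<open>I\<close>. The lexicographic order on pairs is only there to make \<open>mpol\<close> an integral domain.
\<close>

type_synonym idx = "nat \<times> nat"
type_synonym mpol = "(idx \<Rightarrow>\<^sub>0 nat) \<Rightarrow>\<^sub>0 complex"
type_synonym ratfun = "mpol fract"

definition Const :: "complex \<Rightarrow> mpol" where
  "Const c = Poly_Mapping.single 0 c"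

definition Var :: "idx \<Rightarrow> mpol" where
  "Var a = Poly_Mapping.single (Poly_Mapping.single a 1) 1"

definition vars :: "mpol \<Rightarrow> idx set" where
  "vars p = (\<Union>m\<in>Poly_Mapping.keys p. Poly_Mapping.keys m)"

definition insertion :: "(complex \<Rightarrow> 'b::comm_semiring_1) \<Rightarrow> (idx \<Rightarrow> 'b) \<Rightarrow> mpol \<Rightarrow> 'b" where
  "insertion h s p = (\<Sum>m\<in>Poly_Mapping.keys p. h (Poly_Mapping.lookup p m) * (\<Prod>a\<in>Poly_Mapping.keys m. s a ^ Poly_Mapping.lookup m a))"

definition subst :: "(idx \<Rightarrow> mpol) \<Rightarrow> mpol \<Rightarrow> mpol" where
  "subst s = insertion Const s"

definition incl :: "mpol \<Rightarrow> ratfun" where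
  "incl p = Fract p 1"

definition X :: "idx \<Rightarrow> ratfun" where
  "X a = incl (Var a)"

text \<open>The extension of an injective ring endomorphism of polynomials to the fraction field.\<close>

definition fract_map :: "(mpol \<Rightarrow> mpol) \<Rightarrow> ratfun \<Rightarrow> ratfun" where
  "fract_map h f = (THE g. \<forall>p q. q \<noteq> 0 \<longrightarrow> f = Fract p q \<longrightarrow> g = Fract (h p) (h q))"

definition row :: "(nat \<Rightarrow> nat) \<Rightarrow> nat \<Rightarrow> idx set" where
  "row lam i = (if i = 0 then {} else {(i, j) | j. 1 \<le> j \<and> j \<le> lam i})"

definition I :: "nat \<Rightarrow> (nat \<Rightarrow> nat) \<Rightarrow> idx set" where
  "I k lam = {(i, j). 1 \<le> i \<and> i \<le> k \<and> 1 \<le> j \<and> j \<le> lam i}"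

definition Omega :: "nat \<Rightarrow> (nat \<Rightarrow> nat) \<Rightarrow> ratfun set" where
  "Omega k lam = {Fract p q | p q. vars p \<subseteq> I k lam \<and> vars q \<subseteq> I k lam \<and> q \<noteq> 0}"

definition R :: "nat \<Rightarrow> (nat \<Rightarrow> nat) \<Rightarrow> ratfun set" where
  "R k lam = {incl p | p. vars p \<subseteq> I k lam}"

section \<open>The orthogonal Gelfand--Zeitlin algebra\<close>

definition phi :: "idx \<Rightarrow> ratfun \<Rightarrow> ratfun" where
  "phi a = fract_map (subst (\<lambda>b. Var b + (if a = b then 1 else 0)))"

inductive_set gimel :: "nat \<Rightarrow> (nat \<Rightarrow> nat) \<Rightarrow> (ratfun \<Rightarrow> ratfun) set"
  for k :: nat and lam :: "nat \<Rightarrow> nat" where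
  gimel_id: "id \<in> gimel k lam"
| gimel_phi: "\<lbrakk>\<xi> \<in> gimel k lam; (i, j) \<in> I k lam; i < k\<rbrakk> \<Longrightarrow> phi (i, j) \<circ> \<xi> \<in> gimel k lam"
| gimel_inv: "\<lbrakk>\<xi> \<in> gimel k lam; (i, j) \<in> I k lam; i < k\<rbrakk> \<Longrightarrow> inv (phi (i, j)) \<circ> \<xi> \<in> gimel k lam"

definition opE :: "(nat \<Rightarrow> nat) \<Rightarrow> nat \<Rightarrow> ratfun \<Rightarrow> ratfun" where
  "opE lam i f =
     (\<Sum>j = 1..lam i.
        (\<Prod>a\<in>row lam (i + 1). X (i, j) - X a) / (\<Prod>b\<in>row lam i - {(i, j)}. X (i, j) - X b)
        * phi (i, j) f)"

definition opF :: "(nat \<Rightarrow> nat) \<Rightarrow> nat \<Rightarrow> ratfun \<Rightarrow> ratfun" where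
  "opF lam i f =
     (\<Sum>j = 1..lam i.
        (\<Prod>a\<in>row lam (i - 1). X (i, j) - X a) / (\<Prod>b\<in>row lam i - {(i, j)}. X (i, j) - X b)
        * inv (phi (i, j)) f)"

definition elem_sym :: "idx set \<Rightarrow> nat \<Rightarrow> ratfun" where
  "elem_sym A j = (\<Sum>T | T \<subseteq> A \<and> card T = j. \<Prod>b\<in>T. X b)"

definition op_gamma :: "(nat \<Rightarrow> nat) \<Rightarrow> idx \<Rightarrow> ratfun \<Rightarrow> ratfun" where
  "op_gamma lam a f = elem_sym (row lam (fst a)) (snd a) * f"

text \<open>Operators on \<open>Omega\<close> are represented by functions that are undefined outside \<open>Omega\<close>.\<close>

inductive_set U :: "nat \<Rightarrow> (nat \<Rightarrow> nat) \<Rightarrow> (ratfun \<Rightarrow> ratfun) set"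
  for k :: nat and lam :: "nat \<Rightarrow> nat" where
  U_E: "\<lbrakk>1 \<le> i; i < k\<rbrakk> \<Longrightarrow> restrict (opE lam i) (Omega k lam) \<in> U k lam"
| U_F: "\<lbrakk>1 \<le> i; i < k\<rbrakk> \<Longrightarrow> restrict (opF lam i) (Omega k lam) \<in> U k lam"
| U_gamma: "a \<in> I k lam \<Longrightarrow> restrict (op_gamma lam a) (Omega k lam) \<in> U k lam"
| U_one: "restrict id (Omega k lam) \<in> U k lam"
| U_add: "\<lbrakk>u \<in> U k lam; u' \<in> U k lam\<rbrakk> \<Longrightarrow> (\<lambda>f\<in>Omega k lam. u f + u' f) \<in> U k lam"
| U_scale: "u \<in> U k lam \<Longrightarrow> (\<lambda>f\<in>Omega k lam. incl (Const c) * u f) \<in> U k lam"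
| U_mult: "\<lbrakk>u \<in> U k lam; u' \<in> U k lam\<rbrakk> \<Longrightarrow> compose (Omega k lam) u u' \<in> U k lam"

section \<open>The groups and the ring of invariants\<close>

definition G :: "nat \<Rightarrow> (nat \<Rightarrow> nat) \<Rightarrow> (idx \<Rightarrow> idx) set" where
  "G k lam = {g. g permutes I k lam \<and> (\<forall>a\<in>I k lam. fst (g a) = fst a)}"

definition G_under :: "nat \<Rightarrow> (nat \<Rightarrow> nat) \<Rightarrow> (idx \<Rightarrow> idx) set" where
  "G_under k lam = {g \<in> G k lam. \<forall>a\<in>row lam k. g a = a}"

definition act :: "(idx \<Rightarrow> idx) \<Rightarrow> ratfun \<Rightarrow> ratfun" where
  "act g = fract_map (subst (\<lambda>a. Var (g a)))"

definition bR :: "nat \<Rightarrow> (nat \<Rightarrow> nat) \<Rightarrow> ratfun set" where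
  "bR k lam = {f \<in> R k lam. \<forall>g\<in>G k lam. act g f = f}"

section \<open>The dual of the span of the variables\<close>

text \<open>A linear form on \<open>V\<close> is given by its values on the basis \<open>x\<^sub>a\<close>, \<open>a \<in> I\<close>.\<close>

definition Vdual :: "nat \<Rightarrow> (nat \<Rightarrow> nat) \<Rightarrow> (idx \<Rightarrow> complex) set" where
  "Vdual k lam = {v. \<forall>a. a \<notin> I k lam \<longrightarrow> v a = 0}"

definition act_dual :: "(idx \<Rightarrow> idx) \<Rightarrow> (idx \<Rightarrow> complex) \<Rightarrow> idx \<Rightarrow> complex" where
  "act_dual g v = (\<lambda>a. v (inv g a))"

definition stab :: "nat \<Rightarrow> (nat \<Rightarrow> nat) \<Rightarrow> (idx \<Rightarrow> complex) \<Rightarrow> (idx \<Rightarrow> idx) set" where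
  "stab k lam v = {g \<in> G_under k lam. act_dual g v = v}"

text \<open>Only meaningful on the image of \<open>incl\<close>.\<close>

definition ev :: "(idx \<Rightarrow> complex) \<Rightarrow> ratfun \<Rightarrow> complex" where
  "ev v f = insertion id v (THE p. f = incl p)"

text \<open>\<open>is_shift k lam v \<xi> w\<close> states that \<open>w\<close> is the linear form \<open>\<xi>\<^sup>-\<^sup>1(v)\<close>.\<close>

definition is_shift ::
  "nat \<Rightarrow> (nat \<Rightarrow> nat) \<Rightarrow> (idx \<Rightarrow> complex) \<Rightarrow> (ratfun \<Rightarrow> ratfun) \<Rightarrow> (idx \<Rightarrow> complex) \<Rightarrow> bool" where
  "is_shift k lam v \<xi> w \<longleftrightarrow> w \<in> Vdual k lam \<and> (\<forall>f\<in>R k lam. ev w f = ev v (\<xi> f))"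

definition gimel_orbit :: "nat \<Rightarrow> (nat \<Rightarrow> nat) \<Rightarrow> (idx \<Rightarrow> complex) \<Rightarrow> (idx \<Rightarrow> complex) set" where
  "gimel_orbit k lam v = {w. \<exists>\<xi>\<in>gimel k lam. is_shift k lam v \<xi> w}"

definition stab_orbit :: "nat \<Rightarrow> (nat \<Rightarrow> nat) \<Rightarrow> (idx \<Rightarrow> complex) \<Rightarrow> idx \<Rightarrow> idx set" where
  "stab_orbit k lam v a = (\<lambda>g. g a) ` stab k lam v"

text \<open>The set of orbits of \<open>stab k lam v\<close> on \<open>gimel_orbit k lam v\<close>; it serves as the index set \<open>J\<close>.\<close>

definition J :: "nat \<Rightarrow> (nat \<Rightarrow> nat) \<Rightarrow> (idx \<Rightarrow> complex) \<Rightarrow> (idx \<Rightarrow> complex) set set" where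
  "J k lam v = (\<lambda>w. (\<lambda>g. act_dual g w) ` stab k lam v) ` gimel_orbit k lam v"

text \<open>For \<open>u\<close> in the orbit of \<open>v\<close> all values of \<open>u - v\<close> are integers, so comparing real parts
  compares these integers.\<close>

definition rep :: "nat \<Rightarrow> (nat \<Rightarrow> nat) \<Rightarrow> (idx \<Rightarrow> complex) \<Rightarrow> (idx \<Rightarrow> complex) set \<Rightarrow> idx \<Rightarrow> complex" where
  "rep k lam v Ob =
     (THE u. u \<in> Ob \<and>
        (\<forall>i p. (i, p) \<in> I k lam \<longrightarrow> (i, p + 1) \<in> I k lam
           \<longrightarrow> stab_orbit k lam v (i, p) = stab_orbit k lam v (i, p + 1)
           \<longrightarrow> Re (u (i, p) - v (i, p)) \<ge> Re (u (i, p + 1) - v (i, p + 1))))"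

definition shift_of ::
  "nat \<Rightarrow> (nat \<Rightarrow> nat) \<Rightarrow> (idx \<Rightarrow> complex) \<Rightarrow> (idx \<Rightarrow> complex) set \<Rightarrow> ratfun \<Rightarrow> ratfun" where
  "shift_of k lam v Ob = (THE \<xi>. \<xi> \<in> gimel k lam \<and> is_shift k lam v \<xi> (rep k lam v Ob))"

section \<open>Divided differences\<close>

text \<open>The pair \<open>(i, p)\<close> stands for the simple reflection exchanging \<open>(i, p)\<close> and \<open>(i, p + 1)\<close>.\<close>

definition simple :: "nat \<Rightarrow> (nat \<Rightarrow> nat) \<Rightarrow> idx set" where
  "simple k lam = {(i, p). (i, p) \<in> I k lam \<and> (i, p + 1) \<in> I k lam}"

definition simple_refl :: "idx \<Rightarrow> idx \<Rightarrow> idx" where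
  "simple_refl s = transpose s (fst s, snd s + 1)"

definition word_prod :: "idx list \<Rightarrow> idx \<Rightarrow> idx" where
  "word_prod ws = foldr (\<circ>) (map simple_refl ws) id"

definition len :: "nat \<Rightarrow> (nat \<Rightarrow> nat) \<Rightarrow> (idx \<Rightarrow> idx) \<Rightarrow> nat" where
  "len k lam w = (LEAST n. \<exists>ws\<in>lists (simple k lam). word_prod ws = w \<and> length ws = n)"

definition reduced_expr :: "nat \<Rightarrow> (nat \<Rightarrow> nat) \<Rightarrow> (idx \<Rightarrow> idx) \<Rightarrow> idx list \<Rightarrow> bool" where
  "reduced_expr k lam w ws \<longleftrightarrow>
     ws \<in> lists (simple k lam) \<and> word_prod ws = w \<and> length ws = len k lam w"

definition dd_simple :: "idx \<Rightarrow> ratfun \<Rightarrow> ratfun" where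
  "dd_simple s f = (f - act (simple_refl s) f) / (X s - X (fst s, snd s + 1))"

definition dd :: "nat \<Rightarrow> (nat \<Rightarrow> nat) \<Rightarrow> (idx \<Rightarrow> idx) \<Rightarrow> ratfun \<Rightarrow> ratfun" where
  "dd k lam w = foldr (\<circ>) (map dd_simple (SOME ws. reduced_expr k lam w ws)) id"

definition shortest_reps ::
  "nat \<Rightarrow> (nat \<Rightarrow> nat) \<Rightarrow> (idx \<Rightarrow> idx) set \<Rightarrow> (idx \<Rightarrow> idx) set \<Rightarrow> (idx \<Rightarrow> idx) set" where
  "shortest_reps k lam H K = {w \<in> H. \<forall>h\<in>K. len k lam w \<le> len k lam (w \<circ> h)}"

section \<open>Functionals on the ring of invariants\<close>

text \<open>
  Elements of the dual of \<open>bR\<close> are represented by functions vanishing outside \<open>bR\<close>, so that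
  pointwise addition and scaling are the vector space operations of the dual.
\<close>

definition fscale :: "complex \<Rightarrow> (ratfun \<Rightarrow> complex) \<Rightarrow> ratfun \<Rightarrow> complex" where
  "fscale c l = (\<lambda>f. c * l f)"

interpretation functional: vector_space fscale
  by unfold_locales (auto simp: fscale_def fun_eq_iff algebra_simps)

definition restr :: "nat \<Rightarrow> (nat \<Rightarrow> nat) \<Rightarrow> (ratfun \<Rightarrow> complex) \<Rightarrow> ratfun \<Rightarrow> complex" where
  "restr k lam l = (\<lambda>f. if f \<in> bR k lam then l f else 0)"

definition right_act ::
  "nat \<Rightarrow> (nat \<Rightarrow> nat) \<Rightarrow> (ratfun \<Rightarrow> complex) \<Rightarrow> (ratfun \<Rightarrow> ratfun) \<Rightarrow> ratfun \<Rightarrow> complex" where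
  "right_act k lam l u = restr k lam (l \<circ> u)"

definition functional_at ::
  "nat \<Rightarrow> (nat \<Rightarrow> nat) \<Rightarrow> (idx \<Rightarrow> complex) \<Rightarrow> (idx \<Rightarrow> complex) set \<Rightarrow> (idx \<Rightarrow> idx)
     \<Rightarrow> ratfun \<Rightarrow> complex" where
  "functional_at k lam v Ob w = restr k lam (ev v \<circ> dd k lam w \<circ> shift_of k lam v Ob)"

definition B_under :: "nat \<Rightarrow> (nat \<Rightarrow> nat) \<Rightarrow> (idx \<Rightarrow> complex) \<Rightarrow> (ratfun \<Rightarrow> complex) set" where
  "B_under k lam v = (\<Union>Ob\<in>J k lam v. \<Union>w\<in>stab k lam v. {functional_at k lam v Ob w})"

definition M :: "nat \<Rightarrow> (nat \<Rightarrow> nat) \<Rightarrow> (idx \<Rightarrow> complex) \<Rightarrow> (ratfun \<Rightarrow> complex) set" where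
  "M k lam v = functional.span (B_under k lam v)"

definition B :: "nat \<Rightarrow> (nat \<Rightarrow> nat) \<Rightarrow> (idx \<Rightarrow> complex) \<Rightarrow> (ratfun \<Rightarrow> complex) set" where
  "B k lam v =
     (\<Union>Ob\<in>J k lam v. \<Union>w\<in>shortest_reps k lam (stab k lam v) (stab k lam (rep k lam v Ob)).
        {functional_at k lam v Ob w})"

end

theory Submission
  imports Defs
begin

text \<open>
  Write \<open>W\<close> for the stabilizer \<open>stab k lam v\<close>. Evaluating \<open>f\<close> after a shift \<open>\<xi>\<close> is evaluating \<open>f(x + m)\<close>
  for an integral vector \<open>m\<close> that vanishes on the last row, and the representative \<open>u\<^sub>j\<close> of an orbit
  is \<open>v + m\<close> with \<open>m\<close> weakly decreasing along the blocks of \<open>v\<close>; such \<open>m\<close> are called dominant.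
  Maximality of \<open>W\<close> says that two values of \<open>v\<close> in one row \<open>i < k\<close> that differ by an integer are equal.
  So the level sets of \<open>v + m\<close> refine those of \<open>v\<close>, and for dominant \<open>m\<close> they are intervals too.

  Closure. In \<open>(E\<^sub>i f)(x + m)\<close> group the summands by the value of \<open>v + m\<close> on the index. The summands of
  one group have poles along \<open>x\<^sub>a = x\<^sub>b\<close> with \<open>a, b\<close> in one block of \<open>v + m\<close>, and these poles cancel, because
  \<open>\<Sum>\<^sub>j g(x\<^sub>j) / \<Prod>\<^sub>b (x\<^sub>j - x\<^sub>b)\<close> is an iterated divided difference (\<open>dd_word_interval\<close>, \<open>block_sum\<close>). The
  other denominators do not vanish at \<open>v\<close>; multiplying by a \<open>W\<close>-invariant polynomial that is divisible
  by them and nonzero at \<open>v\<close> removes them (\<open>exists_denominator\<close>). What remains are functionals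
  \<open>f \<mapsto> \<partial>(g(x) f(x + m'))(v)\<close> with \<open>\<partial>\<close> a product of simple divided differences from \<open>W\<close> and \<open>g\<close> a
  polynomial. The Leibniz rule, the relation \<open>s = 1 - \<alpha>\<^sub>s \<partial>\<^sub>s\<close> and the symmetry of \<open>f\<close> reduce them to \<open>g = 1\<close>
  and \<open>m'\<close> dominant (\<open>word_functional_mem\<close>). Such a product is \<open>\<partial>\<^sub>w\<close> or zero, by the theorem of Matsumoto
  (\<open>dd_word_unique\<close>, \<open>dd_word_nonreduced\<close>).

  Spanning. If \<open>w\<close> is not shortest in its coset, then \<open>\<partial>\<^sub>w = \<partial>\<^sub>w\<^sub>s \<partial>\<^sub>s\<close> for some \<open>s\<close> in the stabilizer of \<open>v + m\<close>,
  and \<open>\<partial>\<^sub>s\<close> kills \<open>f(x + m)\<close>, which is \<open>s\<close>-invariant (\<open>B_under_cases\<close>).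

  Independence. The points \<open>u\<^sub>j\<close> lie in different \<open>G\<close>-orbits, so averaging over the group gives symmetric
  polynomials with any jet at one \<open>u\<^sub>j\<close> that is invariant under its stabilizer, and zero jets at finitely
  many others (\<open>separate\<close>). Hence it suffices to treat one \<open>m\<close>, and polynomials \<open>p = \<partial>\<^sub>r q\<close> with \<open>r\<close> the
  longest element of the stabilizer of \<open>v + m\<close>. For shortest \<open>x\<close> one has \<open>\<partial>\<^sub>x \<partial>\<^sub>r = \<partial>\<^sub>x\<^sub>r\<close>, so the functionals become
  \<open>q \<mapsto> (\<partial>\<^sub>x\<^sub>r q)(v)\<close> for different elements \<open>xr\<close> of \<open>W\<close>. They are told apart by \<open>q = \<partial>\<^sub>e h\<^sup>n\<close>, where \<open>xre\<close>, for an
  \<open>x\<close> of least length in the relation, is the longest element of \<open>W\<close>, of length \<open>n\<close>, and \<open>h\<close> is a linear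
  form that is positive on the positive coroots: a reduced word of length \<open>n\<close> maps \<open>h\<^sup>n\<close> to a positive
  constant, nonreduced and longer words map it to zero (\<open>dd_word_weight_power\<close>,
  \<open>dd_word_weight_power_zero\<close>), and every reduced word of length \<open>n\<close> in \<open>W\<close> represents the longest element.
\<close>

section \<open>Rational functions and affine substitutions\<close>

lemma insertion_superset:
  fixes s :: "idx \<Rightarrow> 'b::comm_semiring_1"
  assumes "finite A" "Poly_Mapping.keys p \<subseteq> A" "h 0 = 0"
  shows "insertion h s p = (\<Sum>m\<in>A. h (Poly_Mapping.lookup p m) * (\<Prod>a\<in>Poly_Mapping.keys m. s a ^ Poly_Mapping.lookup m a))"
  unfolding insertion_def
  by (rule sum.mono_neutral_left) (use assms in \<open>auto simp: in_keys_iff\<close>)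

lemma insertion_add:
  fixes s :: "idx \<Rightarrow> 'b::comm_semiring_1"
  assumes "h 0 = 0" "\<And>a b. h (a + b) = h a + h b"
  shows "insertion h s (p + q) = insertion h s p + insertion h s q"
proof -
  let ?A = "Poly_Mapping.keys p \<union> Poly_Mapping.keys q"
  have "insertion h s r = (\<Sum>m\<in>?A. h (Poly_Mapping.lookup r m) * (\<Prod>a\<in>Poly_Mapping.keys m. s a ^ Poly_Mapping.lookup m a))"
    if "Poly_Mapping.keys r \<subseteq> ?A" for r
    using that assms by (intro insertion_superset) auto
  moreover have "Poly_Mapping.keys (p + q) \<subseteq> ?A" by (rule keys_add)
  ultimately show ?thesis
    by (simp add: lookup_add assms algebra_simps sum.distrib)
qed

lemma insertion_single:
  assumes "h 0 = 0"
  shows "insertion h s (Poly_Mapping.single m c) = h c * (\<Prod>a\<in>Poly_Mapping.keys m. s a ^ Poly_Mapping.lookup m a)"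
  by (cases "c = 0") (auto simp: insertion_def assms)

lemma monomial_value_add:
  fixes s :: "idx \<Rightarrow> 'b::comm_semiring_1"
  shows "(\<Prod>a\<in>Poly_Mapping.keys (m + n). s a ^ Poly_Mapping.lookup (m + n) a)
    = (\<Prod>a\<in>Poly_Mapping.keys m. s a ^ Poly_Mapping.lookup m a) * (\<Prod>a\<in>Poly_Mapping.keys n. s a ^ Poly_Mapping.lookup n a)"
proof -
  let ?A = "Poly_Mapping.keys m \<union> Poly_Mapping.keys n"
  have "(\<Prod>a\<in>Poly_Mapping.keys r. s a ^ Poly_Mapping.lookup r a) = (\<Prod>a\<in>?A. s a ^ Poly_Mapping.lookup r a)"
    if "Poly_Mapping.keys r \<subseteq> ?A" for r :: "idx \<Rightarrow>\<^sub>0 nat"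
    by (rule prod.mono_neutral_left) (use that in \<open>auto simp: in_keys_iff\<close>)
  moreover have "Poly_Mapping.keys (m + n) \<subseteq> ?A" by (rule keys_add)
  ultimately have "(\<Prod>a\<in>Poly_Mapping.keys (m + n). s a ^ Poly_Mapping.lookup (m + n) a) = (\<Prod>a\<in>?A. s a ^ Poly_Mapping.lookup (m + n) a)"
    and "(\<Prod>a\<in>Poly_Mapping.keys m. s a ^ Poly_Mapping.lookup m a) = (\<Prod>a\<in>?A. s a ^ Poly_Mapping.lookup m a)"
    and "(\<Prod>a\<in>Poly_Mapping.keys n. s a ^ Poly_Mapping.lookup n a) = (\<Prod>a\<in>?A. s a ^ Poly_Mapping.lookup n a)"
    by blast+
  then show ?thesis
    by (simp add: lookup_add power_add prod.distrib)
qed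

lemma poly_mapping_single_induct:
  fixes p :: "'a \<Rightarrow>\<^sub>0 'b::monoid_add"
  assumes "P 0" "\<And>p a b. P p \<Longrightarrow> P (p + Poly_Mapping.single a b)"
  shows "P p"
proof (induction p rule: update_induct)
  case const
  then show ?case by (rule assms(1))
next
  case (update f a b)
  have "Poly_Mapping.update a b f = f + Poly_Mapping.single a b"
    by (rule poly_mapping_eqI)
      (use update in \<open>auto simp: lookup_update lookup_add lookup_single in_keys_iff when_def\<close>)
  then show ?case using assms(2) update by simp
qed

lemma insertion_mult:
  fixes s :: "idx \<Rightarrow> 'b::comm_semiring_1"
  assumes h0: "h 0 = 0" and ha: "\<And>a b. h (a + b) = h a + h b" and hm: "\<And>a b. h (a * b) = h a * h b"
  shows "insertion h s (p * q) = insertion h s p * insertion h s q"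
proof -
  note add = insertion_add[where h = h and s = s, OF h0 ha]
  have z: "insertion h s 0 = 0" by (simp add: insertion_def)
  show ?thesis
  proof (induction p rule: poly_mapping_single_induct)
    case 1
    then show ?case by (simp add: z)
  next
    case (2 p a b)
    have "insertion h s (Poly_Mapping.single a b * q) = insertion h s (Poly_Mapping.single a b) * insertion h s q"
      by (induction q rule: poly_mapping_single_induct)
        (simp_all add: z add distrib_left mult_single insertion_single h0 hm monomial_value_add algebra_simps)
    with 2 show ?case by (simp add: distrib_right add)
  qed
qed

lemma Const_hom: "Const 0 = 0" "Const 1 = 1" "Const (a + b) = Const a + Const b" "Const (a * b) = Const a * Const b"
  by (auto simp: Const_def single_add mult_single)

lemma insertion_Var: 
  fixes s :: "idx \<Rightarrow> 'b::comm_semiring_1"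
  shows "h 0 = 0 \<Longrightarrow> h 1 = 1 \<Longrightarrow> insertion h s (Var a) = s a"
  by (simp add: Var_def insertion_single)

lemma insertion_Const: 
  fixes s :: "idx \<Rightarrow> 'b::comm_semiring_1"
  shows "h 0 = 0 \<Longrightarrow> insertion h s (Const c) = h c"
  by (simp add: Const_def insertion_single)

lemma subst_hom:
  "subst s (p + q) = subst s p + subst s q" "subst s (p * q) = subst s p * subst s q"
  "subst s (Const c) = Const c" "subst s (Var a) = s a"
  by (simp_all add: subst_def insertion_add insertion_mult insertion_Const insertion_Var Const_hom)

lemma subst_one [simp]: "subst s 1 = 1"
  using subst_hom(3)[of s 1] by (simp add: Const_hom)

lemma subst_zero [simp]: "subst s 0 = 0"
  using subst_hom(3)[of s 0] by (simp add: Const_hom)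

text \<open>Polynomials are generated by constants and variables; the induction rules below rest on this
  expansion.\<close>
lemma mpol_as_sum:
  "p = (\<Sum>m\<in>Poly_Mapping.keys p. Const (Poly_Mapping.lookup p m) * (\<Prod>a\<in>Poly_Mapping.keys m. Var a ^ Poly_Mapping.lookup m a))"
proof -
  have single_one_pow: "Var a ^ n = Poly_Mapping.single (Poly_Mapping.single a n) 1" for a n
    by (induction n) (simp_all add: Var_def mult_single single_add[symmetric] one_poly_mapping.abs_eq[symmetric])
  have prod: "(\<Prod>a\<in>A. Var a ^ Poly_Mapping.lookup m a) = Poly_Mapping.single (\<Sum>a\<in>A. Poly_Mapping.single a (Poly_Mapping.lookup m a)) 1"
    if "finite A" for A and m :: "idx \<Rightarrow>\<^sub>0 nat"
    using that by induction (simp_all add: single_one_pow mult_single)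
  have m: "(\<Sum>a\<in>Poly_Mapping.keys m. Poly_Mapping.single a (Poly_Mapping.lookup m a)) = m" for m :: "idx \<Rightarrow>\<^sub>0 nat"
    by (rule poly_mapping_eqI) (auto simp: lookup_sum lookup_single when_def in_keys_iff)
  have "(\<Sum>m\<in>Poly_Mapping.keys p. Poly_Mapping.single m (Poly_Mapping.lookup p m)) = p"
    by (rule poly_mapping_eqI) (auto simp: lookup_sum lookup_single when_def in_keys_iff)
  then show ?thesis by (simp add: prod m Const_def mult_single)
qed

lemma mpol_induct [case_names Const Var add mult]:
  assumes "vars p \<subseteq> A"
    and "\<And>c. P (Const c)" "\<And>a. a \<in> A \<Longrightarrow> P (Var a)"
    and "\<And>p q. P p \<Longrightarrow> P q \<Longrightarrow> P (p + q)" "\<And>p q. P p \<Longrightarrow> P q \<Longrightarrow> P (p * q)"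
  shows "P p"
proof -
  have one: "P 1" and zero: "P 0" using assms(2)[of 1] assms(2)[of 0] by (simp_all add: Const_hom)
  have pow: "P (Var a ^ n)" if "a \<in> A" for a n
    by (induction n) (use that one assms in auto)
  have prod: "P (\<Prod>a\<in>S. Var a ^ f a)" if "finite S" "S \<subseteq> A" for S f
    using that by induction (use one pow assms in auto)
  have sum: "P (\<Sum>m\<in>S. g m)" if "finite S" "\<And>m. m \<in> S \<Longrightarrow> P (g m)" for S and g :: "(idx \<Rightarrow>\<^sub>0 nat) \<Rightarrow> mpol"
    using that by induction (use zero assms in auto)
  show ?thesis
    by (subst mpol_as_sum, rule sum)
      (use assms(1) in \<open>auto intro!: assms(2,5) prod simp: vars_def\<close>)
qed

lemma incl_hom: "incl (p + q) = incl p + incl q" "incl (p * q) = incl p * incl q"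
  "incl 1 = 1" "incl 0 = 0" "incl p = incl q \<longleftrightarrow> p = q"
  by (simp_all add: incl_def Zero_fract_def One_fract_def eq_fract)

definition cst :: "complex \<Rightarrow> ratfun" where "cst c = incl (Const c)"

lemma cst_hom: "cst 0 = 0" "cst 1 = 1" "cst (a + b) = cst a + cst b" "cst (a * b) = cst a * cst b"
  by (simp_all add: cst_def Const_hom incl_hom)

lemma cst_minus: "cst (- a) = - cst a"
  by (metis add_eq_0_iff cst_hom(1) cst_hom(3) left_minus neg_eq_iff_add_eq_0)

text \<open>The definite description in \<open>fract_map\<close> is satisfied because an injective ring endomorphism
  respects cross-multiplication and keeps denominators nonzero.\<close>
lemma fract_map_Fract:
  assumes add: "\<And>p q. h (p + q) = h p + h q" and mult: "\<And>p q. h (p * q) = h p * h q"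
    and inj: "\<And>p. h p = 0 \<Longrightarrow> p = 0" and q: "q \<noteq> 0"
  shows "fract_map h (Fract p q) = Fract (h p) (h q)"
  unfolding fract_map_def
proof (rule the_equality)
  have "h p * h q' = h p' * h q" if "p * q' = p' * q" for p' q'
    using that by (metis mult)
  then show "\<forall>p' q'. q' \<noteq> 0 \<longrightarrow> Fract p q = Fract p' q' \<longrightarrow> Fract (h p) (h q) = Fract (h p') (h q')"
    using q inj by (metis eq_fract(1))
qed (use q in blast)

text \<open>The field endomorphisms over the complex numbers. Substitutions and shifts are used through
  this property and their values on the variables only, which determine them by \<open>endo_eqI\<close>.\<close>
definition endo :: "(ratfun \<Rightarrow> ratfun) \<Rightarrow> bool" where
  "endo F \<longleftrightarrow> (\<forall>f g. F (f + g) = F f + F g) \<and> (\<forall>f g. F (f * g) = F f * F g) \<and> (\<forall>c. F (cst c) = cst c)"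

lemma endoD:
  assumes "endo F"
  shows "F (f + g) = F f + F g" "F (f * g) = F f * F g" "F (cst c) = cst c"
    "F 0 = 0" "F 1 = 1" "F (f - g) = F f - F g" "F (- f) = - F f" "F (inverse f) = inverse (F f)" "F (f / g) = F f / F g"
    "F f = 0 \<longleftrightarrow> f = 0" "F (f ^ n) = F f ^ n"
proof -
  show 1: "F (f + g) = F f + F g" "F (f * g) = F f * F g" "F (cst c) = cst c" for f g c
    using assms by (auto simp: endo_def)
  show 0: "F 0 = 0" "F 1 = 1" using 1(3)[of 0] 1(3)[of 1] by (simp_all add: cst_hom)
  show 2: "F (- f) = - F f" for f using 1(1)[of f "-f"] 0 by (simp add: eq_neg_iff_add_eq_0 add.commute)
  show "F (f - g) = F f - F g" using 1(1)[of f "-g"] 2 by simp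
  have ne: "F f \<noteq> 0" if "f \<noteq> 0" for f using 1(2)[of f "inverse f"] that 0 by auto
  show 3: "F (inverse f) = inverse (F f)" for f
  proof (cases "f = 0")
    case False
    then have "F f * F (inverse f) = 1" using 1(2)[of f "inverse f"] 0 by simp
    then show ?thesis by (metis inverse_unique)
  qed (simp add: 0)
  show "F (f / g) = F f / F g" by (simp add: divide_inverse 1 3)
  show "F f = 0 \<longleftrightarrow> f = 0" using ne 0 by auto
  show "F (f ^ n) = F f ^ n" by (induction n) (simp_all add: 0 1)
qed

lemma endo_sum: "endo F \<Longrightarrow> F (\<Sum>a\<in>A. f a) = (\<Sum>a\<in>A. F (f a))"
  by (induction A rule: infinite_finite_induct) (simp_all add: endoD)

lemma endo_prod: "endo F \<Longrightarrow> F (\<Prod>a\<in>A. f a) = (\<Prod>a\<in>A. F (f a))"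
  by (induction A rule: infinite_finite_induct) (simp_all add: endoD)

lemma endo_comp: "endo F \<Longrightarrow> endo F' \<Longrightarrow> endo (F \<circ> F')"
  by (simp add: endo_def)

lemma endo_id: "endo id"
  by (simp add: endo_def)

text \<open>The polynomial ring in the variables of \<open>A\<close>, inside the field. Leaving \<open>A\<close> free allows
  restricting to the rows that are shifted.\<close>
definition polys :: "idx set \<Rightarrow> ratfun set" where
  "polys A = {incl p | p. vars p \<subseteq> A}"

lemma R_eq: "R k lam = polys (I k lam)" by (simp add: R_def polys_def)

lemma vars_add: "vars (p + q) \<subseteq> vars p \<union> vars q"
  using keys_add[of p q] by (auto simp: vars_def)

lemma vars_mult: "vars (p * q) \<subseteq> vars p \<union> vars q"
proof -
  have "Poly_Mapping.keys m \<subseteq> vars p \<union> vars q" if m: "m \<in> Poly_Mapping.keys (p * q)" for m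
  proof -
    obtain a b where "m = a + b" "a \<in> Poly_Mapping.keys p" "b \<in> Poly_Mapping.keys q"
      using m keys_mult[of p q] by blast
    then show ?thesis using keys_add[of a b] by (auto simp: vars_def)
  qed
  then show ?thesis by (auto simp: vars_def)
qed

lemma vars_Const: "vars (Const c) = {}"
  by (auto simp: vars_def Const_def)

lemma vars_Var: "vars (Var a) = {a}"
  by (auto simp: vars_def Var_def)

lemma polys_closed:
  "cst c \<in> polys A" "a \<in> A \<Longrightarrow> X a \<in> polys A" "f \<in> polys A \<Longrightarrow> g \<in> polys A \<Longrightarrow> f + g \<in> polys A"
  "f \<in> polys A \<Longrightarrow> g \<in> polys A \<Longrightarrow> f * g \<in> polys A"
proof -
  show "cst c \<in> polys A" by (auto simp: polys_def cst_def vars_Const)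
  show "a \<in> A \<Longrightarrow> X a \<in> polys A" using vars_Var[of a] by (auto simp: polys_def X_def)
  assume "f \<in> polys A" "g \<in> polys A"
  then obtain p q where p: "f = incl p" "vars p \<subseteq> A" "g = incl q" "vars q \<subseteq> A" by (auto simp: polys_def)
  have "vars (p + q) \<subseteq> A" "vars (p * q) \<subseteq> A" using p vars_add[of p q] vars_mult[of p q] by auto
  then show "f + g \<in> polys A" "f * g \<in> polys A" using p by (auto simp: polys_def simp flip: incl_hom)
qed

lemma polys_closed_derived:
  "0 \<in> polys A" "1 \<in> polys A" "f \<in> polys A \<Longrightarrow> - f \<in> polys A" "f \<in> polys A \<Longrightarrow> g \<in> polys A \<Longrightarrow> f - g \<in> polys A"
  "f \<in> polys A \<Longrightarrow> f ^ n \<in> polys A"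
proof -
  show 01: "0 \<in> polys A" "1 \<in> polys A" using polys_closed(1)[of 0] polys_closed(1)[of 1] by (simp_all add: cst_hom)
  show m: "f \<in> polys A \<Longrightarrow> - f \<in> polys A" for f
    using polys_closed(4)[OF polys_closed(1)[of "-1"], of f A] by (simp add: cst_minus cst_hom)
  show "f \<in> polys A \<Longrightarrow> g \<in> polys A \<Longrightarrow> f - g \<in> polys A"
    using polys_closed(3)[OF _ m[of g], of f] by simp
  show "f \<in> polys A \<Longrightarrow> f ^ n \<in> polys A"
    by (induction n) (simp_all add: 01 polys_closed)
qed

lemma polys_sum: "(\<And>a. a \<in> S \<Longrightarrow> f a \<in> polys A) \<Longrightarrow> (\<Sum>a\<in>S. f a) \<in> polys A"
  by (induction S rule: infinite_finite_induct) (simp_all add: polys_closed polys_closed_derived)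

lemma polys_prod: "(\<And>a. a \<in> S \<Longrightarrow> f a \<in> polys A) \<Longrightarrow> (\<Prod>a\<in>S. f a) \<in> polys A"
  by (induction S rule: infinite_finite_induct) (simp_all add: polys_closed polys_closed_derived)

lemma polys_mono: "A \<subseteq> A' \<Longrightarrow> polys A \<subseteq> polys A'"
  by (auto simp: polys_def)

lemma polys_induct [consumes 1, case_names cst X add mult]:
  assumes "f \<in> polys A" "\<And>c. P (cst c)" "\<And>a. a \<in> A \<Longrightarrow> P (X a)"
    "\<And>f g. f \<in> polys A \<Longrightarrow> g \<in> polys A \<Longrightarrow> P f \<Longrightarrow> P g \<Longrightarrow> P (f + g)"
    "\<And>f g. f \<in> polys A \<Longrightarrow> g \<in> polys A \<Longrightarrow> P f \<Longrightarrow> P g \<Longrightarrow> P (f * g)"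
  shows "P f"
proof -
  obtain p where p: "f = incl p" "vars p \<subseteq> A" using assms(1) by (auto simp: polys_def)
  have "incl p \<in> polys A \<and> P (incl p)"
    by (rule mpol_induct[OF p(2), where P = "\<lambda>p. incl p \<in> polys A \<and> P (incl p)"])
      (auto simp: incl_hom polys_closed assms simp flip: cst_def X_def)
  then show ?thesis by (simp add: p)
qed

lemma endo_eqI:
  assumes "endo F" "endo F'" "\<And>a. F (X a) = F' (X a)"
  shows "F = F'"
proof
  fix f
  have incl: "F (incl p) = F' (incl p)" for p :: mpol
    by (induction p rule: mpol_induct[where A = UNIV])
      (use assms in \<open>auto simp: incl_hom endoD cst_def[symmetric] X_def[symmetric]\<close>)
  obtain p q :: mpol where f: "f = Fract p q" "q \<noteq> 0" by (cases f) auto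
  then have "f = incl p / incl q" by (simp add: incl_def)
  then show "F f = F' f" by (simp add: endoD(9)[OF assms(1)] endoD(9)[OF assms(2)] incl)
qed


text \<open>Permutations of the variables and shifts are instances of one family closed under
  composition, so that injectivity, which \<open>fract_map\<close> needs, is proved once, by exhibiting the
  inverse substitution.\<close>
definition aff :: "(idx \<Rightarrow> idx) \<Rightarrow> (idx \<Rightarrow> complex) \<Rightarrow> ratfun \<Rightarrow> ratfun" where
  "aff g m = fract_map (subst (\<lambda>a. Var (g a) + Const (m a)))"

lemma aff:
  assumes "bij g"
  shows endo_aff: "endo (aff g m)" and aff_X: "aff g m (X a) = X (g a) + cst (m a)"
proof -
  let ?h = "subst (\<lambda>a. Var (g a) + Const (m a))" and ?h' = "subst (\<lambda>a. Var (inv g a) + Const (- m (inv g a)))"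
  have "Const (- c) + Const c = 0" for c by (simp flip: Const_hom)
  then have inv: "?h' (?h p) = p" for p
    by (induction p rule: mpol_induct[where A = UNIV])
      (simp_all add: subst_hom bij_is_inj[OF assms] add.assoc)
  have inj: "p = 0" if "?h p = 0" for p
    using inv[of p] that by simp
  have F: "aff g m (Fract p q) = Fract (?h p) (?h q)" if "q \<noteq> 0" for p q
    unfolding aff_def by (rule fract_map_Fract) (use that inj subst_hom in auto)
  have I: "aff g m (incl p) = incl (?h p)" for p :: mpol
    by (simp add: incl_def F)
  show "endo (aff g m)"
    unfolding endo_def
  proof (intro conjI allI)
    fix f g' :: ratfun
    obtain p q p' q' where f: "f = Fract p q" "q \<noteq> 0" "g' = Fract p' q'" "q' \<noteq> 0"
      by (metis Fract_cases)
    have "?h q \<noteq> 0" "?h q' \<noteq> 0" using f inj by auto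
    then show "aff g m (f + g') = aff g m f + aff g m g'" "aff g m (f * g') = aff g m f * aff g m g'"
      using f by (simp_all add: F subst_hom)
  next
    fix c show "aff g m (cst c) = cst c" by (simp add: cst_def I subst_hom)
  qed
  show "aff g m (X a) = X (g a) + cst (m a)"
    by (simp add: X_def cst_def I subst_hom incl_hom)
qed

lemma aff_comp:
  assumes "bij g" "bij g'"
  shows "aff g m \<circ> aff g' m' = aff (g \<circ> g') (\<lambda>a. m (g' a) + m' a)"
  by (rule endo_eqI)
    (use assms in \<open>simp_all add: aff bij_comp endo_comp endoD[OF endo_aff] cst_hom algebra_simps\<close>)

lemma aff_id: "aff id 0 = id"
  by (rule endo_eqI) (simp_all add: aff endo_id cst_hom)

lemma act_aff: "act g = aff g 0"
  by (simp add: act_def aff_def Const_hom)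

definition sh :: "(idx \<Rightarrow> complex) \<Rightarrow> ratfun \<Rightarrow> ratfun" where "sh m = aff id m"

lemma phi_sh: "phi a = sh (\<lambda>b. if a = b then 1 else 0)"
proof -
  have "Const (if a = b then 1 else 0) = (if a = b then 1 else 0)" for b
    by (simp add: Const_hom)
  then show ?thesis by (simp add: phi_def sh_def aff_def)
qed

lemma sh_sh: "sh m (sh m' f) = sh (\<lambda>a. m a + m' a) f"
  using aff_comp[of id id m m'] by (simp add: sh_def fun_eq_iff)

lemma sh_0: "sh 0 = id" "sh (\<lambda>_. 0) = id"
  using aff_id by (simp_all add: sh_def zero_fun_def)

lemma inv_sh: "inv (sh m) = sh (\<lambda>a. - m a)"
  by (rule inv_unique_comp) (simp_all add: fun_eq_iff sh_sh sh_0)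

lemma act_hom: "bij g \<Longrightarrow> endo (act g)" and act_X: "bij g \<Longrightarrow> act g (X a) = X (g a)"
  by (simp_all add: act_aff aff cst_hom)

lemma sh_hom: "endo (sh m)" and sh_X: "sh m (X a) = X a + cst (m a)"
  by (simp_all add: sh_def aff)

lemma act_comp: "bij g \<Longrightarrow> bij g' \<Longrightarrow> act g (act g' f) = act (g \<circ> g') f"
  using aff_comp[of g g' 0 0] by (simp add: act_aff fun_eq_iff zero_fun_def)

lemma act_id: "act id = id"
  by (simp add: act_aff aff_id)

text \<open>A permutation of the variables carries a shift to the permuted shift.\<close>
lemma sh_act: "bij g \<Longrightarrow> sh m (act g f) = act g (sh (m \<circ> g) f)"
  using aff_comp[of id g m 0] aff_comp[of g id 0 "m \<circ> g"]
  by (simp add: act_aff sh_def fun_eq_iff zero_fun_def comp_def)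

lemma endo_polys:
  assumes "endo F" "f \<in> polys A" "\<And>a. a \<in> A \<Longrightarrow> F (X a) \<in> polys A'"
  shows "F f \<in> polys A'"
  using assms(2) by (induction rule: polys_induct) (use assms in \<open>auto simp: endoD polys_closed\<close>)

lemma endo_polys_eq:
  assumes "endo F" "endo F'" "f \<in> polys A" "\<And>a. a \<in> A \<Longrightarrow> F (X a) = F' (X a)"
  shows "F f = F' f"
  using assms(3) by (induction rule: polys_induct) (use assms in \<open>auto simp: endoD polys_closed\<close>)

lemma sh_polys: "f \<in> polys A \<Longrightarrow> sh m f \<in> polys A"
  by (rule endo_polys[OF sh_hom]) (auto simp: sh_X polys_closed)

lemma act_polys: "bij g \<Longrightarrow> f \<in> polys A \<Longrightarrow> (\<And>a. a \<in> A \<Longrightarrow> g a \<in> A) \<Longrightarrow> act g f \<in> polys A"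
  by (rule endo_polys[OF act_hom]) (auto simp: act_X polys_closed)

lemma ev_incl: "ev v (incl p) = insertion id v p"
  by (simp add: ev_def incl_hom)

lemma ev_hom:
  "f \<in> polys A \<Longrightarrow> g \<in> polys A \<Longrightarrow> ev v (f + g) = ev v f + ev v g"
  "f \<in> polys A \<Longrightarrow> g \<in> polys A \<Longrightarrow> ev v (f * g) = ev v f * ev v g"
  "ev v (cst c) = c" "ev v (X a) = v a"
  by (auto simp: polys_def ev_incl insertion_add insertion_mult insertion_Const insertion_Var cst_def X_def
      simp flip: incl_hom)

lemma ev_hom_derived:
  shows "ev v 0 = 0" "ev v 1 = 1"
    "f \<in> polys A \<Longrightarrow> g \<in> polys A \<Longrightarrow> ev v (f - g) = ev v f - ev v g"
    "f \<in> polys A \<Longrightarrow> ev v (f ^ n) = ev v f ^ n"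
proof -
  show 01: "ev v 0 = 0" "ev v 1 = 1" using ev_hom(3)[of v 0] ev_hom(3)[of v 1] by (simp_all add: cst_hom)
  show "f \<in> polys A \<Longrightarrow> g \<in> polys A \<Longrightarrow> ev v (f - g) = ev v f - ev v g"
    using ev_hom(1)[of "f - g" A g v] by (simp add: polys_closed_derived)
  show "f \<in> polys A \<Longrightarrow> ev v (f ^ n) = ev v f ^ n"
    by (induction n) (simp_all add: 01 ev_hom(2)[of _ A] polys_closed_derived)
qed

lemma ev_sum: "(\<And>a. a \<in> S \<Longrightarrow> f a \<in> polys A) \<Longrightarrow> ev v (\<Sum>a\<in>S. f a) = (\<Sum>a\<in>S. ev v (f a))"
  by (induction S rule: infinite_finite_induct) (simp_all add: ev_hom(1)[of _ A] polys_sum ev_hom_derived)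

lemma ev_prod: "(\<And>a. a \<in> S \<Longrightarrow> f a \<in> polys A) \<Longrightarrow> ev v (\<Prod>a\<in>S. f a) = (\<Prod>a\<in>S. ev v (f a))"
  by (induction S rule: infinite_finite_induct) (simp_all add: ev_hom(2)[of _ A] polys_prod ev_hom_derived)

text \<open>Evaluation after an endomorphism is evaluation at the point of the images of the variables.\<close>
lemma ev_endo:
  assumes "endo F" "f \<in> polys A" "\<And>a. a \<in> A \<Longrightarrow> F (X a) \<in> polys UNIV \<and> ev v (F (X a)) = w a"
  shows "ev v (F f) = ev w f"
  using assms(2)
proof (induction rule: polys_induct)
  case (add f g)
  have "F f \<in> polys UNIV" "F g \<in> polys UNIV" using add assms by (auto intro: endo_polys[where A = A])
  then show ?case using add assms by (simp add: endoD ev_hom(1)[where A = UNIV] ev_hom(1)[where A = A])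
next
  case (mult f g)
  have "F f \<in> polys UNIV" "F g \<in> polys UNIV" using mult assms by (auto intro: endo_polys[where A = A])
  then show ?case using mult assms by (simp add: endoD ev_hom(2)[where A = UNIV] ev_hom(2)[where A = A])
qed (use assms in \<open>auto simp: endoD ev_hom\<close>)

lemma ev_sh: "f \<in> polys A \<Longrightarrow> ev v (sh m f) = ev (\<lambda>a. v a + m a) f"
  by (rule ev_endo[OF sh_hom]) (auto simp: sh_X ev_hom(1)[where A = UNIV] ev_hom polys_closed)

lemma ev_act: "bij g \<Longrightarrow> f \<in> polys A \<Longrightarrow> ev v (act g f) = ev (v \<circ> g) f"
  by (rule ev_endo[OF act_hom]) (auto simp: act_X ev_hom polys_closed)

lemma X_inj: "X a = X b \<longleftrightarrow> a = b"
proof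
  assume "X a = X b"
  then have "(ev (\<lambda>c. if c = a then 1 else 0) (X a)) = ev (\<lambda>c. if c = a then 1 else 0) (X b)" by simp
  then show "a = b" by (simp add: ev_hom split: if_splits)
qed simp

section \<open>Divided differences along words\<close>

abbreviation next_idx :: "idx \<Rightarrow> idx" where "next_idx s \<equiv> (fst s, snd s + 1)"

lemma bij_simple_refl [simp]: "bij (simple_refl s)"
  by (simp add: simple_refl_def)

lemma simple_refl_sq [simp]: "simple_refl s \<circ> simple_refl s = id" "simple_refl s (simple_refl s a) = a"
  by (simp_all add: simple_refl_def)

lemma simple_refl_simps [simp]: "simple_refl s s = next_idx s" "simple_refl s (next_idx s) = s"
   "simple_refl s (fst s, Suc (snd s)) = s"
  by (simp_all add: simple_refl_def)

lemma next_idx_neq [simp]: "s \<noteq> next_idx s" "next_idx s \<noteq> s"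
  by (metis n_not_Suc_n Suc_eq_plus1 snd_conv)+

lemma X_next_idx: "X s - X (next_idx s) \<noteq> 0" "X s - X (fst s, Suc (snd s)) \<noteq> 0"
  using next_idx_neq[of s] by (auto simp: X_inj)

lemma dd_simple_linear:
  "dd_simple s (f + g) = dd_simple s f + dd_simple s g" "dd_simple s (cst c * f) = cst c * dd_simple s f"
  "dd_simple s 0 = 0"
  using endoD[OF act_hom[OF bij_simple_refl[of s]]]
  by (simp_all add: dd_simple_def add_divide_distrib diff_divide_distrib algebra_simps)

lemma dd_simple_mult:
  "dd_simple s (f * g) = dd_simple s f * g + act (simple_refl s) f * dd_simple s g"
  by (simp add: dd_simple_def endoD(2)[OF act_hom[OF bij_simple_refl[of s]]] flip: add_divide_distrib)
    (simp add: algebra_simps)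

lemma dd_simple_inv: "act (simple_refl s) f = f \<Longrightarrow> dd_simple s f = 0"
  by (simp add: dd_simple_def)

text \<open>The relation \<open>s = 1 - \<alpha>\<^sub>s \<partial>\<^sub>s\<close>, which trades permutations for divided differences.\<close>
lemma act_simple_refl_dd: "act (simple_refl s) f = f - (X s - X (next_idx s)) * dd_simple s f"
  using X_next_idx[of s] by (simp add: dd_simple_def)

lemma dd_simple_sq: "dd_simple s (dd_simple s f) = 0"
proof -
  note r = endoD[OF act_hom[OF bij_simple_refl[of s]]]
  have "act (simple_refl s) (dd_simple s f) = (act (simple_refl s) f - f) / (X (next_idx s) - X s)"
    by (simp add: dd_simple_def r act_X act_comp act_id)
  also have "\<dots> = dd_simple s f" by (simp add: dd_simple_def divide_simps X_inj) (simp add: algebra_simps)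
  finally show ?thesis by (rule dd_simple_inv)
qed

lemma dd_simple_cst: "dd_simple s (cst c) = 0"
  using endoD[OF act_hom[OF bij_simple_refl[of s]]] by (simp add: dd_simple_def)

lemma dd_simple_X: "dd_simple s (X a) = cst (if a = s then 1 else if a = next_idx s then -1 else 0)"
proof -
  have "(X (next_idx s) - X s) / (X s - X (next_idx s)) = -1"
    using X_next_idx[of s] by (simp add: divide_eq_eq)
  then show ?thesis using X_next_idx[of s]
    by (auto simp: dd_simple_def act_X cst_hom cst_minus)
      (simp add: simple_refl_def)
qed

text \<open>The quotient is a polynomial: this is clear for constants and variables, and the Leibniz
  rule passes it to products.\<close>
lemma dd_simple_polys:
  assumes "f \<in> polys A" "s \<in> A" "next_idx s \<in> A"
  shows "dd_simple s f \<in> polys A"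
  using assms(1)
proof (induction rule: polys_induct)
  case (mult f g)
  have "act (simple_refl s) f \<in> polys A"
    by (rule act_polys) (use mult assms in \<open>auto simp: simple_refl_def transpose_def\<close>)
  then show ?case using mult by (simp add: dd_simple_mult polys_closed)
qed (simp_all add: dd_simple_linear dd_simple_cst dd_simple_X polys_closed polys_closed_derived)

lemma simple_refl_conj:
  assumes "bij g" "g s = s'" "g (next_idx s) = next_idx s'"
  shows "g \<circ> simple_refl s = simple_refl s' \<circ> g"
proof
  fix a
  have "g a = s' \<longleftrightarrow> a = s" "g a = next_idx s' \<longleftrightarrow> a = next_idx s"
    using assms(2,3) bij_is_inj[OF assms(1)] by (metis injD)+
  then show "(g \<circ> simple_refl s) a = (simple_refl s' \<circ> g) a"
    using assms(2,3) unfolding simple_refl_def transpose_def comp_apply by simp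
qed

lemma simple_refl_fix:
  assumes "s \<noteq> t" "next_idx s \<noteq> t" "next_idx t \<noteq> s"
  shows "simple_refl s t = t" "simple_refl s (next_idx t) = next_idx t"
proof -
  have "next_idx s \<noteq> next_idx t" using assms(1) by (simp add: prod_eq_iff)
  then show "simple_refl s t = t" "simple_refl s (next_idx t) = next_idx t"
    using assms by (metis simple_refl_def transpose_apply_other)+
qed

lemma act_dd_simple:
  assumes "bij g" "g s = s'" "g (next_idx s) = next_idx s'"
  shows "act g (dd_simple s f) = dd_simple s' (act g f)"
proof -
  have "g \<circ> simple_refl s = simple_refl s' \<circ> g"
    by (rule simple_refl_conj[OF assms])
  then have "act g (act (simple_refl s) f) = act (simple_refl s') (act g f)"
    using assms(1) by (simp add: act_comp)
  then show ?thesis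
    unfolding dd_simple_def endoD[OF act_hom[OF assms(1)]] act_X[OF assms(1)] assms(2,3) by simp
qed

lemma dd_simple_commute:
  assumes "s \<noteq> t" "next_idx s \<noteq> t" "next_idx t \<noteq> s"
  shows "dd_simple s (dd_simple t f) = dd_simple t (dd_simple s f)"
proof -
  note r = endoD[OF act_hom[OF bij_simple_refl[of s]]]
  note 1 = simple_refl_fix[OF assms]
  have 2: "act (simple_refl s) (dd_simple t f) = dd_simple t (act (simple_refl s) f)"
    by (rule act_dd_simple) (use 1 in auto)
  have 3: "dd_simple t (f - act (simple_refl s) f) = dd_simple t f - dd_simple t (act (simple_refl s) f)"
    using dd_simple_linear(1)[of t "f - act (simple_refl s) f" "act (simple_refl s) f"] by simp
  have 4: "dd_simple t (1 / (X s - X (next_idx s))) = 0"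
  proof (rule dd_simple_inv)
    have "simple_refl t s = s" "simple_refl t (next_idx s) = next_idx s"
      using assms simple_refl_fix[of t s] by auto
    then show "act (simple_refl t) (1 / (X s - X (next_idx s))) = 1 / (X s - X (next_idx s))"
      using endoD[OF act_hom[OF bij_simple_refl[of t]]] by (simp add: act_X)
  qed
  have 5: "act (simple_refl t) (1 / (X s - X (next_idx s))) = 1 / (X s - X (next_idx s))"
    using act_simple_refl_dd[of t "1 / (X s - X (next_idx s))"] by (simp only: 4) simp
  have "dd_simple t (1 / (X s - X (next_idx s)) * (f - act (simple_refl s) f))
     = 1 / (X s - X (next_idx s)) * dd_simple t (f - act (simple_refl s) f)"
    by (simp only: dd_simple_mult 4 5) simp
  then show ?thesis
    by (simp add: dd_simple_def[of s] 2 3)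
qed

text \<open>The braid relation once both sides are expanded: \<open>f\<close>, \<open>a\<close>, \<open>b\<close>, \<open>c\<close>, \<open>d\<close>, \<open>e\<close> stand for the
  images of a function under \<open>1\<close>, \<open>s\<close>, \<open>t\<close>, \<open>st\<close>, \<open>ts\<close>, \<open>sts\<close>.\<close>
lemma braid_identity:
  fixes x y z :: "'a::field"
  assumes "x \<noteq> y" "y \<noteq> z" "x \<noteq> z"
  shows "((((f-a)/(x-y) - (b-d)/(x-z))/(y-z)) - ((a-f)/(y-x) - (c-e)/(y-z))/(x-z))/(x-y)
    = ((((f-b)/(y-z) - (a-c)/(x-z))/(x-y)) - ((b-f)/(z-y) - (d-e)/(x-y))/(x-z))/(y-z)"
proof -
  define p q where "p = x - y" and "q = y - z"
  have d: "x - y = p" "y - z = q" "x - z = p + q" "y - x = - p" "z - y = - q" "p \<noteq> 0" "q \<noteq> 0" "p + q \<noteq> 0"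
    using assms by (auto simp: p_def q_def)
  show ?thesis unfolding d using d(6-8)
    by (simp add: divide_simps) (simp add: algebra_simps)
qed

lemma simple_refl_braid:
  "simple_refl s \<circ> simple_refl (next_idx s) \<circ> simple_refl s = simple_refl (next_idx s) \<circ> simple_refl s \<circ> simple_refl (next_idx s)"
  by (cases s) (auto simp: fun_eq_iff simple_refl_def transpose_def)

lemma dd_simple_braid:
  assumes t: "t = next_idx s"
  shows "dd_simple s (dd_simple t (dd_simple s f)) = dd_simple t (dd_simple s (dd_simple t f))"
proof -
  define i p where "i = fst s" and "p = snd s"
  have s: "s = (i, p)" "t = (i, Suc p)" by (auto simp: t i_def p_def)
  have X: "X (i, p) \<noteq> X (i, Suc p)" "X (i, Suc p) \<noteq> X (i, Suc (Suc p))" "X (i, p) \<noteq> X (i, Suc (Suc p))"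
    by (simp_all add: X_inj)
  note rs = endoD[OF act_hom[OF bij_simple_refl[of s]]] act_X[OF bij_simple_refl[of s]]
  note rt = endoD[OF act_hom[OF bij_simple_refl[of t]]] act_X[OF bij_simple_refl[of t]]
  have v: "simple_refl s (i, p) = (i, Suc p)" "simple_refl s (i, Suc p) = (i, p)" "simple_refl s (i, Suc (Suc p)) = (i, Suc (Suc p))"
     "simple_refl t (i, p) = (i, p)" "simple_refl t (i, Suc p) = (i, Suc (Suc p))" "simple_refl t (i, Suc (Suc p)) = (i, Suc p)"
    by (simp_all add: s simple_refl_def transpose_def)
  have tst: "act (simple_refl t) (act (simple_refl s) (act (simple_refl t) f)) = act (simple_refl s) (act (simple_refl t) (act (simple_refl s) f))"
  proof -
    have "simple_refl t \<circ> simple_refl s \<circ> simple_refl t = simple_refl s \<circ> simple_refl t \<circ> simple_refl s"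
      unfolding t by (rule simple_refl_braid[symmetric])
    then show ?thesis by (simp add: act_comp bij_comp comp_assoc)
  qed
  have ss: "act (simple_refl s) (act (simple_refl s) f) = f" "act (simple_refl t) (act (simple_refl t) f) = f" for f
    by (simp_all add: act_comp act_id)
  have ds: "dd_simple s f = (f - act (simple_refl s) f) / (X (i,p) - X (i, Suc p))" for f by (simp add: dd_simple_def s)
  have dt: "dd_simple t f = (f - act (simple_refl t) f) / (X (i,Suc p) - X (i, Suc (Suc p)))" for f by (simp add: dd_simple_def s)
  show ?thesis
    unfolding ds dt rs rt v ss tst
    by (rule braid_identity[OF X])
qed

text \<open>The product along an arbitrary word. Working with words postpones the choice of a reduced
  expression made in \<open>dd\<close>.\<close>
definition dd_word :: "idx list \<Rightarrow> ratfun \<Rightarrow> ratfun" where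
  "dd_word ws = foldr (\<circ>) (map dd_simple ws) id"

lemma dd_word_simps [simp]: "dd_word [] f = f" "dd_word (s # ws) f = dd_simple s (dd_word ws f)"
  by (simp_all add: dd_word_def)

lemma dd_word_append: "dd_word (ws @ us) f = dd_word ws (dd_word us f)"
  by (induction ws) auto

lemma dd_word_linear: "dd_word ws (f + g) = dd_word ws f + dd_word ws g" "dd_word ws (cst c * f) = cst c * dd_word ws f" "dd_word ws 0 = 0"
  by (induction ws) (auto simp: dd_simple_linear)

lemma word_prod_simps [simp]: "word_prod [] = id" "word_prod (s # ws) = simple_refl s \<circ> word_prod ws"
  by (simp_all add: word_prod_def)

lemma word_prod_append: "word_prod (ws @ us) = word_prod ws \<circ> word_prod us"
  by (induction ws) (auto simp: comp_assoc)

lemma word_prod_snoc: "word_prod (ws @ [s]) = word_prod ws \<circ> simple_refl s"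
  by (simp add: word_prod_append)

context
  fixes k :: nat and lam :: "nat \<Rightarrow> nat"
begin

lemma finite_I: "finite (I k lam)"
proof -
  have "I k lam \<subseteq> (SIGMA i:{1..k}. {1..lam i})" by (auto simp: I_def)
  then show ?thesis by (rule finite_subset) auto
qed

lemma G_props:
  assumes "g \<in> G k lam"
  shows "bij g" "fst (g a) = fst a" "g a \<in> I k lam \<longleftrightarrow> a \<in> I k lam"
proof -
  have p: "g permutes I k lam" using assms by (simp add: G_def)
  show "bij g" using p by (rule permutes_bij)
  show "g a \<in> I k lam \<longleftrightarrow> a \<in> I k lam" using p by (rule permutes_in_image)
  show "fst (g a) = fst a"
    using assms p by (cases "a \<in> I k lam") (auto simp: G_def permutes_not_in)
qed

lemma G_id: "id \<in> G k lam"
  by (simp add: G_def permutes_id)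

lemma G_comp: "g \<in> G k lam \<Longrightarrow> h \<in> G k lam \<Longrightarrow> g \<circ> h \<in> G k lam"
  using G_props[of g] G_props[of h] by (auto simp: G_def permutes_compose)

lemma G_inv: "g \<in> G k lam \<Longrightarrow> inv g \<in> G k lam"
proof -
  assume g: "g \<in> G k lam"
  then have "fst (inv g a) = fst a" for a
    using G_props(2)[OF g, of "inv g a"] G_props(1)[OF g] by (simp add: bij_is_surj surj_f_inv_f)
  then show ?thesis using g by (simp add: G_def permutes_inv)
qed

lemma simple_in_I: "s \<in> simple k lam \<Longrightarrow> s \<in> I k lam \<and> next_idx s \<in> I k lam"
  by (auto simp: simple_def)

lemma simple_refl_G: "s \<in> simple k lam \<Longrightarrow> simple_refl s \<in> G k lam"
  using simple_in_I[of s]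
  by (auto simp: G_def simple_refl_def permutes_swap_id transpose_def)

lemma word_prod_G: "ws \<in> lists (simple k lam) \<Longrightarrow> word_prod ws \<in> G k lam"
  by (induction ws) (auto simp: G_id G_comp simple_refl_G)

definition inversions :: "(idx \<Rightarrow> idx) \<Rightarrow> (idx \<times> idx) set" where
  "inversions g = {(x, y). x \<in> I k lam \<and> y \<in> I k lam \<and> fst x = fst y \<and> snd x < snd y \<and> snd (g y) < snd (g x)}"

abbreviation inv_num :: "(idx \<Rightarrow> idx) \<Rightarrow> nat" where "inv_num g \<equiv> card (inversions g)"

definition descent :: "(idx \<Rightarrow> idx) \<Rightarrow> idx \<Rightarrow> bool" where
  "descent g s \<longleftrightarrow> snd (g (next_idx s)) < snd (g s)"

lemma finite_inversions: "finite (inversions g)"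
  by (rule finite_subset[of _ "I k lam \<times> I k lam"]) (auto simp: inversions_def finite_I)

lemma G_neq:
  assumes "g \<in> G k lam" "fst a = fst b" "a \<noteq> b"
  shows "snd (g a) \<noteq> snd (g b)"
proof
  assume "snd (g a) = snd (g b)"
  then have "g a = g b" using G_props(2)[OF assms(1)] assms(2) by (metis prod_eqI)
  then show False using assms G_props(1)[OF assms(1)] by (metis bij_is_inj injD)
qed

lemma descent_comp: "g \<in> G k lam \<Longrightarrow> descent (g \<circ> simple_refl s) s \<longleftrightarrow> \<not> descent g s"
  using G_neq[of g s "next_idx s"] next_idx_neq[of s] unfolding descent_def comp_apply simple_refl_simps by fastforce

text \<open>The reflection permutes the pairs of indices other than the pair that it exchanges, and it
  keeps their order; so inversions of the product correspond to the remaining inversions.\<close>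
lemma inv_num_descent:
  assumes g: "g \<in> G k lam" and s: "s \<in> simple k lam" and d: "descent g s"
  shows "inv_num g = Suc (inv_num (g \<circ> simple_refl s))"
proof -
  let ?r = "simple_refl s"
  have inj: "inj ?r" using bij_simple_refl bij_is_inj by blast
  have rI: "?r a \<in> I k lam \<longleftrightarrow> a \<in> I k lam" "fst (?r a) = fst a" for a
    using G_props[OF simple_refl_G[OF s]] by auto
  have mono: "snd (?r x) < snd (?r y)" if "fst x = fst y" "snd x < snd y" "(x, y) \<noteq> (s, next_idx s)" for x y
    using that by (cases x; cases y; cases s) (auto simp: simple_refl_def transpose_def)
  have mem: "(s, next_idx s) \<in> inversions g" using simple_in_I[OF s] d by (auto simp: inversions_def descent_def)
  have nmem: "(s, next_idx s) \<notin> inversions (g \<circ> ?r)" using d by (auto simp: inversions_def descent_def)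
  have "inversions (g \<circ> ?r) = map_prod ?r ?r ` (inversions g - {(s, next_idx s)})"
  proof (intro equalityI subsetI)
    fix z assume z: "z \<in> inversions (g \<circ> ?r)"
    obtain x y where xy: "z = (x, y)" by (cases z)
    have "(x, y) \<noteq> (s, next_idx s)" using z nmem xy by auto
    then have "(?r x, ?r y) \<in> inversions g" using z mono[of x y] by (auto simp: xy inversions_def rI)
    moreover have "(?r x, ?r y) \<noteq> (s, next_idx s)"
    proof
      assume "(?r x, ?r y) = (s, next_idx s)"
      then have "x = next_idx s" "y = s" by (metis simple_refl_sq(2) simple_refl_simps(1) prod.inject, metis simple_refl_sq(2) simple_refl_simps(2) prod.inject)
      then show False using z by (simp add: xy inversions_def)
    qed
    ultimately have "(?r x, ?r y) \<in> inversions g - {(s, next_idx s)}" by blast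
    then have "map_prod ?r ?r (?r x, ?r y) \<in> map_prod ?r ?r ` (inversions g - {(s, next_idx s)})" by (rule imageI)
    then show "z \<in> map_prod ?r ?r ` (inversions g - {(s, next_idx s)})" by (simp add: xy)
  next
    fix z assume "z \<in> map_prod ?r ?r ` (inversions g - {(s, next_idx s)})"
    then obtain x y where xy: "z = (?r x, ?r y)" "(x, y) \<in> inversions g" "(x, y) \<noteq> (s, next_idx s)" by auto
    then show "z \<in> inversions (g \<circ> ?r)" using mono[of x y] by (auto simp: inversions_def rI)
  qed
  then have "inv_num (g \<circ> ?r) = card (inversions g - {(s, next_idx s)})"
    by (simp add: card_image inj_on_subset[OF prod.inj_map[OF inj inj]])
  then show ?thesis using card_Suc_Diff1[OF finite_inversions mem] by simp
qed

lemma inv_num_asc: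
  assumes g: "g \<in> G k lam" and s: "s \<in> simple k lam" and d: "\<not> descent g s"
  shows "inv_num (g \<circ> simple_refl s) = Suc (inv_num g)"
proof -
  have "descent (g \<circ> simple_refl s) s" using descent_comp g d by blast
  then have "inv_num (g \<circ> simple_refl s) = Suc (inv_num (g \<circ> simple_refl s \<circ> simple_refl s))"
    using inv_num_descent g s G_comp simple_refl_G by blast
  then show ?thesis by (simp add: comp_assoc)
qed

lemma inv_num_id: "inv_num id = 0"
proof -
  have "inversions id = {}" by (auto simp: inversions_def)
  then show ?thesis by simp
qed

text \<open>Applying \<open>g\<close> to an inversion and exchanging its entries gives an inversion of the inverse.\<close>
lemma inv_num_inv:
  assumes g: "g \<in> G k lam"
  shows "inv_num (inv g) = inv_num g"
proof -
  have b: "bij g" using G_props g by blast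
  have "bij_betw (\<lambda>(x, y). (g y, g x)) (inversions g) (inversions (inv g))"
  proof (rule bij_betw_byWitness[where f' = "\<lambda>(x, y). (inv g y, inv g x)"])
    show "(\<lambda>(x, y). (g y, g x)) ` inversions g \<subseteq> inversions (inv g)"
      using b G_props[OF g] by (auto simp: inversions_def bij_is_inj)
    show "(\<lambda>(x, y). (inv g y, inv g x)) ` inversions (inv g) \<subseteq> inversions g"
      using b G_props[OF G_inv[OF g]] by (auto simp: inversions_def bij_is_surj surj_f_inv_f)
  qed (use b in \<open>auto simp: bij_is_inj bij_is_surj surj_f_inv_f\<close>)
  then show ?thesis using bij_betw_same_card by metis
qed

text \<open>Without descents \<open>g\<close> increases along every row, so it does not decrease any index; as it
  permutes each row, the sum of all indices is unchanged, and no index can grow.\<close>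
lemma no_descent_id:
  assumes g: "g \<in> G k lam" and nd: "\<And>s. s \<in> simple k lam \<Longrightarrow> \<not> descent g s"
  shows "g = id"
proof -
  have p: "g permutes I k lam" using g by (simp add: G_def)
  have le: "snd a \<le> snd (g a)" if "a \<in> I k lam" for a
  proof -
    have "(i, p) \<in> I k lam \<Longrightarrow> p \<le> snd (g (i, p))" for i p
    proof (induction p)
      case (Suc p)
      show ?case
      proof (cases "p = 0")
        case True
        have "g (i, Suc p) \<in> I k lam" using G_props(3)[OF g] Suc.prems by blast
        then show ?thesis using True by (auto simp: I_def)
      next
        case False
        have s: "(i, p) \<in> simple k lam" using Suc.prems False by (auto simp: simple_def I_def)
        have "snd (g (i, p)) \<noteq> snd (g (i, Suc p))" by (rule G_neq[OF g]) auto
        then have "snd (g (i, p)) < snd (g (i, Suc p))" using nd[OF s] by (simp add: descent_def)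
        moreover have "p \<le> snd (g (i, p))" using Suc.IH s by (auto simp: simple_def)
        ultimately show ?thesis by simp
      qed
    qed simp
    then show ?thesis using that by (cases a) simp
  qed
  have "(\<Sum>a\<in>I k lam. snd a) = (\<Sum>a\<in>I k lam. snd (g a))"
    using sum.permute[OF p, of snd] by (simp add: comp_def)
  then have "snd a = snd (g a)" if "a \<in> I k lam" for a
    using sum_mono_inv[of snd "I k lam" "\<lambda>a. snd (g a)" a] le that finite_I by auto
  then have "g a = a" for a
    using permutes_not_in[OF p, of a] G_props(2)[OF g, of a] by (metis prod_eqI)
  then show ?thesis by (simp add: fun_eq_iff)
qed

text \<open>Measuring the length of a permutation by its inversions makes descents directly visible;
  \<open>len_inv_num\<close> identifies this number with the Coxeter length.\<close>
definition reduced :: "idx list \<Rightarrow> bool" where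
  "reduced ws \<longleftrightarrow> ws \<in> lists (simple k lam) \<and> inv_num (word_prod ws) = length ws"

lemma inv_num_word_le: "ws \<in> lists (simple k lam) \<Longrightarrow> inv_num (word_prod ws) \<le> length ws"
proof (induction ws rule: rev_induct)
  case Nil then show ?case unfolding word_prod_simps inv_num_id by simp
next
  case (snoc s ws)
  then have "inv_num (word_prod ws) \<le> length ws" "ws \<in> lists (simple k lam)" "s \<in> simple k lam" by auto
  then show ?case unfolding word_prod_snoc
    using inv_num_descent[OF word_prod_G, of ws s] inv_num_asc[OF word_prod_G, of ws s]
    unfolding length_append list.size by linarith
qed

lemma reduced_snoc: 
  assumes "s \<in> simple k lam"
  shows "reduced (ws @ [s]) \<longleftrightarrow> reduced ws \<and> \<not> descent (word_prod ws) s"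
proof (cases "ws \<in> lists (simple k lam)")
  case True
  show ?thesis
    using inv_num_descent[OF word_prod_G[OF True], of s] inv_num_asc[OF word_prod_G[OF True], of s] assms True inv_num_word_le[OF True]
    by (cases "descent (word_prod ws) s") (auto simp: reduced_def word_prod_snoc)
qed (simp add: reduced_def)

lemma exists_red: 
  assumes "g \<in> G k lam"
  shows "\<exists>ws. reduced ws \<and> word_prod ws = g"
  using assms
proof (induction "inv_num g" arbitrary: g rule: less_induct)
  case less
  show ?case
  proof (cases "\<exists>s\<in>simple k lam. descent g s")
    case True
    then obtain s where s: "s \<in> simple k lam" "descent g s" by blast
    have G: "g \<circ> simple_refl s \<in> G k lam" using less.prems s G_comp simple_refl_G by blast
    obtain ws where ws: "reduced ws" "word_prod ws = g \<circ> simple_refl s"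
      using less.hyps[of "g \<circ> simple_refl s"] inv_num_descent[OF less.prems s] G by auto
    have "reduced (ws @ [s])" using ws s reduced_snoc descent_comp[OF less.prems] by simp
    moreover have "word_prod (ws @ [s]) = g" using ws by (simp add: word_prod_snoc comp_assoc)
    ultimately show ?thesis by blast
  next
    case False
    then have "g = id" using no_descent_id less.prems by blast
    then show ?thesis using inv_num_id by (intro exI[of _ "[]"]) (simp add: reduced_def)
  qed
qed

lemma len_inv_num:
  assumes "g \<in> G k lam"
  shows "len k lam g = inv_num g"
  unfolding len_def
proof (rule Least_equality)
  show "\<exists>ws\<in>lists (simple k lam). word_prod ws = g \<and> length ws = inv_num g"
    using exists_red[OF assms] by (auto simp: reduced_def)
next
  fix n assume "\<exists>ws\<in>lists (simple k lam). word_prod ws = g \<and> length ws = n"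
  then show "inv_num g \<le> n" using inv_num_word_le by blast
qed

lemma reduced_expr_iff: "g \<in> G k lam \<Longrightarrow> reduced_expr k lam g ws \<longleftrightarrow> reduced ws \<and> word_prod ws = g"
  by (auto simp: reduced_expr_def reduced_def len_inv_num)

text \<open>The theorem of Matsumoto for divided differences. If the two words end in different letters
  \<open>s\<close> and \<open>t\<close>, both are descents of the product \<open>w\<close>, so \<open>w\<close> has a reduced word that ends in the
  longest word in \<open>s\<close> and \<open>t\<close>, written in either order. The induction hypothesis compares the
  given words with these two, and the commutation or braid relation compares the two with each
  other.\<close>
lemma dd_word_unique:
  assumes "reduced a" "reduced b" "word_prod a = word_prod b"
  shows "dd_word a f = dd_word b f"
  using assms
proof (induction "length a" arbitrary: a b f rule: less_induct)
  case less
  have len: "length a = length b" using less.prems by (simp add: reduced_def)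
  show ?case
  proof (cases a rule: rev_cases)
    case Nil
    then show ?thesis using len by simp
  next
    case (snoc a' s)
    note a = snoc
    obtain b' t where b: "b = b' @ [t]" using len a by (cases b rule: rev_cases) auto
    have S: "s \<in> simple k lam" "t \<in> simple k lam" using less.prems by (auto simp: a b reduced_def)
    have r: "reduced a'" "reduced b'" and da: "\<not> descent (word_prod a') s" and db: "\<not> descent (word_prod b') t"
      using less.prems S by (auto simp: a b reduced_snoc)
    define w where "w = word_prod a"
    have w: "w \<in> G k lam" using less.prems word_prod_G by (auto simp: w_def reduced_def)
    have wa: "word_prod a' = w \<circ> simple_refl s"
      by (simp add: w_def a word_prod_snoc comp_assoc)
    have wb: "word_prod b' = w \<circ> simple_refl t"
      unfolding w_def less.prems(3) by (simp add: b word_prod_snoc comp_assoc)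
    have dw: "descent w s" "descent w t" using da db descent_comp[OF w] by (auto simp: wa wb)
    have IHa: "dd_word a' f = dd_word c f" if "reduced c" "word_prod c = word_prod a'" for c f
      using less.hyps[of a' c f] r that by (simp add: a)
    have IHb: "dd_word b' f = dd_word c f" if "reduced c" "word_prod c = word_prod b'" for c f
      using less.hyps[of b' c f] r that len by (simp add: a b)
    have G: "g \<circ> simple_refl s \<in> G k lam" "g \<circ> simple_refl t \<in> G k lam" if "g \<in> G k lam" for g
      using that S G_comp simple_refl_G by blast+
    have braid: "dd_word a f = dd_word b f" 
      if st: "t = next_idx u \<and> s = u \<or> s = next_idx u \<and> t = u" for u
    proof -
      define i p where "i = fst u" and "p = snd u"
      have braidG: "simple_refl s \<circ> simple_refl t \<circ> simple_refl s = simple_refl t \<circ> simple_refl s \<circ> simple_refl t"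
        using st simple_refl_braid[of u] by metis
      \<comment> \<open>\<open>w\<close> is \<open>g\<close> times the longest element \<open>sts = tst\<close>, with lengths adding\<close>
      define g where "g = w \<circ> simple_refl s \<circ> simple_refl t \<circ> simple_refl s"
      have gG: "g \<in> G k lam" using w G by (simp add: g_def)
      have g1: "g \<circ> simple_refl s \<circ> simple_refl t = w \<circ> simple_refl s"
        by (simp add: g_def fun_eq_iff)
      have g': "g = w \<circ> simple_refl t \<circ> simple_refl s \<circ> simple_refl t"
        using braidG by (simp add: g_def fun_eq_iff)
      have g2: "g \<circ> simple_refl t \<circ> simple_refl s = w \<circ> simple_refl t"
        by (simp add: g' fun_eq_iff)
      have asc: "\<not> descent g s \<and> \<not> descent (g \<circ> simple_refl s) t \<and> \<not> descent g t \<and> \<not> descent (g \<circ> simple_refl t) s"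
        using st
      proof
        assume "t = next_idx u \<and> s = u"
        then have st: "s = (i, p)" "t = (i, Suc p)" by (auto simp: i_def p_def)
        have "snd (w (i, Suc (Suc p))) < snd (w (i, Suc p))" "snd (w (i, Suc p)) < snd (w (i, p))"
          using dw by (simp_all add: descent_def st)
        then show ?thesis by (simp add: g_def descent_def simple_refl_def transpose_def st)
      next
        assume "s = next_idx u \<and> t = u"
        then have st: "t = (i, p)" "s = (i, Suc p)" by (auto simp: i_def p_def)
        have "snd (w (i, Suc (Suc p))) < snd (w (i, Suc p))" "snd (w (i, Suc p)) < snd (w (i, p))"
          using dw by (simp_all add: descent_def st)
        then show ?thesis by (simp add: g_def descent_def simple_refl_def transpose_def st)
      qed
      obtain c where c: "reduced c" "word_prod c = g" using exists_red[OF gG] by blast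
      have r1: "reduced (c @ [s])" using c asc reduced_snoc S by simp
      then have r1: "reduced ((c @ [s]) @ [t])" using c asc reduced_snoc[of t "c @ [s]"] S by (simp add: word_prod_snoc)
      have r2: "reduced (c @ [t])" using c asc reduced_snoc S by simp
      then have r2: "reduced ((c @ [t]) @ [s])" using c asc reduced_snoc[of s "c @ [t]"] S by (simp add: word_prod_snoc)
      have 1: "dd_word a' f = dd_word c (dd_simple s (dd_simple t f))" for f
        using IHa[OF r1] c g1 by (simp add: wa word_prod_append dd_word_append comp_assoc)
      have 2: "dd_word b' f = dd_word c (dd_simple t (dd_simple s f))" for f
        using IHb[OF r2] c g2 by (simp add: wb word_prod_append dd_word_append comp_assoc)
      show ?thesis using st dd_simple_braid[of t s f] dd_simple_braid[of s t f] by (auto simp: a b dd_word_append 1 2)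
    qed
    show ?thesis
    proof (cases "s = t")
      case True
      then show ?thesis using IHa[of b'] r by (simp add: a b dd_word_append wa wb)
    next
      case ne: False
      show ?thesis
      proof (cases "t = next_idx s \<or> s = next_idx t")
        case True
        then show ?thesis using braid by blast
      next
        case False
        \<comment> \<open>here \<open>w\<close> is \<open>g\<close> times \<open>st = ts\<close>\<close>
        define g where "g = w \<circ> simple_refl s \<circ> simple_refl t"
        have gG: "g \<in> G k lam" using w G by (simp add: g_def)
        have comm: "simple_refl s \<circ> simple_refl t = simple_refl t \<circ> simple_refl s"
          by (rule simple_refl_conj[OF bij_simple_refl]; rule simple_refl_fix) (use ne False in auto)
        have g': "g = w \<circ> simple_refl t \<circ> simple_refl s" using comm by (simp add: g_def comp_assoc)
        have fx: "simple_refl s t = t" "simple_refl s (next_idx t) = next_idx t" "simple_refl t s = s" "simple_refl t (next_idx s) = next_idx s"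
          using ne False simple_refl_fix[of s t] simple_refl_fix[of t s] by auto
        have "g s = w (next_idx s)" "g (next_idx s) = w s" unfolding g_def comp_apply fx simple_refl_simps by (rule refl)+
        moreover have "g t = w (next_idx t)" "g (next_idx t) = w t" unfolding g' comp_apply fx simple_refl_simps by (rule refl)+
        ultimately have asc: "\<not> descent g s" "\<not> descent g t"
          using dw unfolding descent_def by simp_all
        obtain c where c: "reduced c" "word_prod c = g" using exists_red[OF gG] by blast
        have r1: "reduced (c @ [s])" and r2: "reduced (c @ [t])" using c asc reduced_snoc S by auto
        have 1: "dd_word a' f = dd_word c (dd_simple t f)" for f
          using IHa[OF r2] c by (simp add: wa word_prod_append dd_word_append g_def fun_eq_iff)
        have 2: "dd_word b' f = dd_word c (dd_simple s f)" for f
          using IHb[OF r1] c by (simp add: wb word_prod_append dd_word_append g' fun_eq_iff)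
        show ?thesis using dd_simple_commute[of s t f] ne False by (auto simp: a b dd_word_append 1 2)
      qed
    qed
  qed
qed

text \<open>At the first letter \<open>s\<close> that shortens the product, the word read so far can be replaced by a
  reduced word that ends in \<open>s\<close>, and \<open>\<partial>\<^sub>s \<partial>\<^sub>s = 0\<close>.\<close>
lemma dd_word_nonreduced:
  assumes "ws \<in> lists (simple k lam)" "\<not> reduced ws"
  shows "dd_word ws f = 0"
  using assms
proof (induction ws arbitrary: f rule: rev_induct)
  case Nil
  then show ?case using inv_num_id by (simp add: reduced_def)
next
  case (snoc s ws)
  show ?case
  proof (cases "reduced ws")
    case False
    then show ?thesis using snoc by (simp add: dd_word_append)
  next
    case True
    define g where "g = word_prod ws \<circ> simple_refl s"
    have S: "s \<in> simple k lam" and W: "word_prod ws \<in> G k lam" using snoc word_prod_G by auto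
    have d: "descent (word_prod ws) s" using snoc.prems True reduced_snoc S by blast
    have gG: "g \<in> G k lam" using S W G_comp simple_refl_G by (auto simp: g_def)
    obtain c where c: "reduced c" "word_prod c = g" using exists_red[OF gG] by blast
    have "reduced (c @ [s])" using reduced_snoc[OF S, of c] c d descent_comp[OF W] by (simp add: g_def)
    then have "dd_word ws f = dd_word (c @ [s]) f" for f
      by (rule dd_word_unique[OF True]) (use c in \<open>simp add: word_prod_append g_def comp_assoc\<close>)
    then show ?thesis by (simp add: dd_word_append dd_simple_sq dd_word_linear)
  qed
qed

lemma dd_eq_dd_word:
  assumes "reduced ws" "word_prod ws = g"
  shows "dd k lam g = dd_word ws"
proof -
  have g: "g \<in> G k lam" using assms word_prod_G by (auto simp: reduced_def)
  have "reduced_expr k lam g (SOME ws. reduced_expr k lam g ws)"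
    by (rule someI[of _ ws]) (simp add: reduced_expr_iff g assms)
  then have "dd_word (SOME ws. reduced_expr k lam g ws) f = dd_word ws f" for f
    using assms by (intro dd_word_unique) (auto simp: reduced_expr_iff g)
  then show ?thesis unfolding dd_def dd_word_def[symmetric] by (intro ext)
qed

end

section \<open>Divided differences over an interval\<close>

text \<open>Indices are treated as single variables, so that a pair is not split inside \<open>next_idx s\<close>.\<close>
declare split_paired_All [simp del] split_paired_Ex [simp del]

lemma transpose_conj:
  assumes "bij g"
  shows "g \<circ> transpose a b = transpose (g a) (g b) \<circ> g"
proof
  fix x
  have "g x = g a \<longleftrightarrow> x = a" "g x = g b \<longleftrightarrow> x = b"
    using bij_is_inj[OF assms] by (metis injD)+
  then show "(g \<circ> transpose a b) x = (transpose (g a) (g b) \<circ> g) x"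
    unfolding transpose_def comp_apply by simp
qed

text \<open>The symmetric form of an iterated divided difference. In the step from \<open>n\<close> to \<open>n + 1\<close> the
  new reflection \<open>s\<close> exchanges the last variable \<open>x\<^sub>a\<close> and a new one \<open>x\<^sub>b\<close>. It fixes every summand
  with \<open>j < a\<close> up to the factor \<open>1/(x\<^sub>j - x\<^sub>a)\<close>, whose divided difference is \<open>1/((x\<^sub>j - x\<^sub>a)(x\<^sub>j -
  x\<^sub>b))\<close>; the summand with \<open>j = a\<close> splits into those with \<open>j = a\<close> and \<open>j = b\<close>.\<close>
lemma dd_word_interval:
  assumes "\<And>q. p < q \<Longrightarrow> q < p + n \<Longrightarrow> act (simple_refl (i, q)) F = F"
  shows "dd_word (rev (map (Pair i) [p..<p + n])) F
    = (\<Sum>j=p..p + n. act (transpose (i, p) (i, j)) F / (\<Prod>b\<in>{p..p + n} - {j}. X (i, j) - X (i, b)))"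
  using assms
proof (induction n)
  case 0
  have "act (\<lambda>a. a) F = F" using act_id by (simp add: id_def)
  then show ?case by simp
next
  case (Suc n)
  define a b where "a = p + n" and "b = Suc (p + n)"
  let ?s = "(i, a)"
  let ?r = "simple_refl ?s"
  let ?F = "\<lambda>j. act (transpose (i, p) (i, j)) F"
  note r = endoD[OF act_hom[OF bij_simple_refl[of ?s]]]
  have rX: "act ?r (X (i, a)) = X (i, b)" "act ?r (X (i, b)) = X (i, a)"
    "\<And>j. j \<noteq> a \<Longrightarrow> j \<noteq> b \<Longrightarrow> act ?r (X (i, j)) = X (i, j)"
    by (simp_all add: act_X a_def b_def simple_refl_def transpose_def)
  have Xne: "X (i, x) - X (i, y) \<noteq> 0" if "x \<noteq> y" for x y using that by (simp add: X_inj)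
  have IH: "dd_word (rev (map (Pair i) [p..<a])) F = (\<Sum>j=p..a. ?F j / (\<Prod>b\<in>{p..a} - {j}. X (i, j) - X (i, b)))"
    unfolding a_def by (rule Suc.IH) (use Suc.prems in auto)
  have early: "dd_simple ?s (?F j / (\<Prod>b\<in>{p..a} - {j}. X (i, j) - X (i, b)))
      = ?F j / (\<Prod>c\<in>{p..b} - {j}. X (i, j) - X (i, c))" if j: "j \<in> {p..<a}" for j
  proof -
    \<comment> \<open>the factors that the new reflection fixes\<close>
    let ?A = "?F j / (\<Prod>b\<in>{p..<a} - {j}. X (i, j) - X (i, b))"
    have sets: "{p..a} - {j} = insert a ({p..<a} - {j})" "{p..b} - {j} = insert b (insert a ({p..<a} - {j}))"
      using j by (auto simp: a_def b_def)
    have nin: "a \<notin> {p..<a} - {j}" "b \<notin> insert a ({p..<a} - {j})" by (auto simp: a_def b_def)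
    have rF: "act ?r F = F" by (rule Suc.prems) (use j in \<open>auto simp: a_def\<close>)
    have "?r \<circ> transpose (i, p) (i, j) = transpose (?r (i, p)) (?r (i, j)) \<circ> ?r"
      by (rule transpose_conj) simp
    moreover have "?r (i, p) = (i, p)" "?r (i, j) = (i, j)" using j by (auto simp: simple_refl_def transpose_def)
    ultimately have "act ?r (?F j) = act (transpose (i, p) (i, j)) (act ?r F)"
      by (simp add: act_comp)
    then have Finv: "act ?r (?F j) = ?F j" by (simp add: rF)
    have "act ?r (\<Prod>b\<in>{p..<a} - {j}. X (i, j) - X (i, b)) = (\<Prod>b\<in>{p..<a} - {j}. X (i, j) - X (i, b))"
      unfolding endo_prod[OF act_hom[OF bij_simple_refl]] r
      by (rule prod.cong) (use j rX(3) in \<open>auto simp: a_def b_def\<close>)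
    then have Ainv: "act ?r ?A = ?A" by (simp add: r Finv)
    have rj: "act ?r (X (i, j)) = X (i, j)" using j by (intro rX) (auto simp: a_def b_def)
    have "dd_simple ?s (1 / (X (i, j) - X (i, a))) = (1 / (X (i, j) - X (i, a)) - 1 / (X (i, j) - X (i, b))) / (X (i, a) - X (i, b))"
      by (simp add: dd_simple_def r rj rX) (simp add: a_def b_def)
    also have "\<dots> = 1 / (X (i, j) - X (i, a)) / (X (i, j) - X (i, b))"
    proof -
      have "j \<noteq> a" "j \<noteq> b" "a \<noteq> b" using j by (auto simp: a_def b_def)
      then show ?thesis using Xne[of j a] Xne[of j b] Xne[of a b] by (simp add: divide_simps)
    qed
    finally have B: "dd_simple ?s (1 / (X (i, j) - X (i, a))) = 1 / (X (i, j) - X (i, a)) / (X (i, j) - X (i, b))" .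
    have "?F j / (\<Prod>b\<in>{p..a} - {j}. X (i, j) - X (i, b)) = ?A * (1 / (X (i, j) - X (i, a)))"
      unfolding sets by (subst prod.insert) (use nin in auto)
    then have "dd_simple ?s (?F j / (\<Prod>b\<in>{p..a} - {j}. X (i, j) - X (i, b))) = ?A * (1 / (X (i, j) - X (i, a)) / (X (i, j) - X (i, b)))"
      by (simp only: dd_simple_mult dd_simple_inv[OF Ainv] Ainv B) simp
    also have "\<dots> = ?F j / (\<Prod>c\<in>{p..b} - {j}. X (i, j) - X (i, c))"
      unfolding sets using nin by (simp add: mult_ac)
    finally show ?thesis .
  qed
  have last: "dd_simple ?s (?F a / (\<Prod>b\<in>{p..a} - {a}. X (i, a) - X (i, b)))
      = ?F a / (\<Prod>c\<in>{p..b} - {a}. X (i, a) - X (i, c)) + ?F b / (\<Prod>c\<in>{p..b} - {b}. X (i, b) - X (i, c))"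
  proof -
    have sets: "{p..a} - {a} = {p..<a}" "{p..b} - {a} = insert b {p..<a}" "{p..b} - {b} = insert a {p..<a}"
      by (auto simp: a_def b_def)
    have nin: "a \<notin> {p..<a}" "b \<notin> {p..<a}" by (auto simp: a_def b_def)
    have P: "act ?r (\<Prod>b\<in>{p..<a}. X (i, a) - X (i, b)) = (\<Prod>c\<in>{p..<a}. X (i, b) - X (i, c))"
      unfolding endo_prod[OF act_hom[OF bij_simple_refl]] r
      by (rule prod.cong) (use rX in \<open>auto simp: a_def b_def\<close>)
    have Fb: "act ?r (?F a) = ?F b"
    proof (cases "n = 0")
      case True
      then show ?thesis by (simp add: a_def b_def act_comp simple_refl_def)
    next
      case False
      have rF: "act ?r F = F" by (rule Suc.prems) (use False in \<open>auto simp: a_def\<close>)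
      have "?r \<circ> transpose (i, p) (i, a) = transpose (?r (i, p)) (?r (i, a)) \<circ> ?r"
        by (rule transpose_conj) simp
      moreover have "?r (i, p) = (i, p)" "?r (i, a) = (i, b)"
        using False by (auto simp: simple_refl_def transpose_def a_def b_def)
      ultimately have "act ?r (?F a) = act (transpose (i, p) (i, b)) (act ?r F)"
        by (simp add: act_comp)
      then show ?thesis by (simp add: rF)
    qed
    have "dd_simple ?s (?F a / (\<Prod>b\<in>{p..<a}. X (i, a) - X (i, b)))
      = (?F a / (\<Prod>b\<in>{p..<a}. X (i, a) - X (i, b)) - ?F b / (\<Prod>c\<in>{p..<a}. X (i, b) - X (i, c))) / (X (i, a) - X (i, b))"
      unfolding dd_simple_def r Fb P by (simp add: a_def b_def)
    also have "\<dots> = ?F a / (\<Prod>b\<in>{p..<a}. X (i, a) - X (i, b)) / (X (i, a) - X (i, b)) + ?F b / (\<Prod>c\<in>{p..<a}. X (i, b) - X (i, c)) / (X (i, b) - X (i, a))"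
    proof -
      have "A / (x - y) + B / (y - x) = (A - B) / (x - y)" for A B x y :: ratfun
      proof -
        have "B / (y - x) = - (B / (x - y))" by (subst minus_divide_right) simp
        then show ?thesis by (simp add: diff_divide_distrib)
      qed
      then show ?thesis by (rule sym)
    qed
    finally show ?thesis
      unfolding sets using nin by (simp add: mult_ac)
  qed
  have split: "(\<Sum>j=p..b. f j) = (\<Sum>j\<in>{p..<a}. f j) + (f a + f b)" for f :: "nat \<Rightarrow> ratfun"
  proof -
    have "{p..b} = insert b (insert a {p..<a})" by (auto simp: a_def b_def)
    then show ?thesis by (simp add: a_def b_def add_ac)
  qed
  have split': "(\<Sum>j=p..a. f j) = (\<Sum>j\<in>{p..<a}. f j) + f a" for f :: "nat \<Rightarrow> ratfun"
  proof -
    have "{p..a} = insert a {p..<a}" by (auto simp: a_def)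
    then show ?thesis by (simp add: add_ac)
  qed
  have dsum: "dd_simple ?s (\<Sum>j\<in>S. f j) = (\<Sum>j\<in>S. dd_simple ?s (f j))" for f :: "nat \<Rightarrow> ratfun" and S
    by (induction S rule: infinite_finite_induct) (simp_all add: dd_simple_linear)
  have "rev (map (Pair i) [p..<p + Suc n]) = ?s # rev (map (Pair i) [p..<a])"
    by (simp add: a_def)
  then have "dd_word (rev (map (Pair i) [p..<p + Suc n])) F = dd_simple ?s (\<Sum>j=p..a. ?F j / (\<Prod>b\<in>{p..a} - {j}. X (i, j) - X (i, b)))"
    by (simp only: dd_word_simps IH)
  also have "\<dots> = (\<Sum>j=p..b. ?F j / (\<Prod>c\<in>{p..b} - {j}. X (i, j) - X (i, c)))"
    unfolding split split' dd_simple_linear dsum last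
    by (simp only: sum.cong[OF refl early] add.assoc)
  finally show ?case by (simp add: b_def)
qed

lemma dd_simple_sum: "dd_simple s (\<Sum>j\<in>S. f j) = (\<Sum>j\<in>S. dd_simple s (f j))"
  by (induction S rule: infinite_finite_induct) (simp_all add: dd_simple_linear)

lemma dd_word_sum: "dd_word ws (\<Sum>j\<in>S. f j) = (\<Sum>j\<in>S. dd_word ws (f j))"
  by (induction S rule: infinite_finite_induct) (simp_all add: dd_word_linear)

lemma dd_word_polys:
  assumes "f \<in> polys A" "\<And>s. s \<in> set ws \<Longrightarrow> s \<in> A \<and> next_idx s \<in> A"
  shows "dd_word ws f \<in> polys A"
  using assms(2) by (induction ws) (auto intro!: dd_simple_polys assms(1))

lemma dd_simple_inv_mult: "act (simple_refl s) g = g \<Longrightarrow> dd_simple s (g * f) = g * dd_simple s f"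
  by (simp add: dd_simple_mult dd_simple_inv)

lemma dd_word_inv_mult: "(\<And>s. s \<in> set ws \<Longrightarrow> act (simple_refl s) g = g) \<Longrightarrow> dd_word ws (g * f) = g * dd_word ws f"
  by (induction ws) (simp_all add: dd_simple_inv_mult)

lemma dd_simple_eq0_iff: "dd_simple s f = 0 \<longleftrightarrow> act (simple_refl s) f = f"
  using X_next_idx[of s] by (auto simp: dd_simple_def)


section \<open>Order of vanishing at a point\<close>

text \<open>Membership in the \<open>n\<close>-th power of the maximal ideal of polynomials at \<open>v\<close>, presented by
  generators so that the effect of a divided difference can be proved by induction.\<close>
inductive vanishes :: "idx set \<Rightarrow> (idx \<Rightarrow> complex) \<Rightarrow> nat \<Rightarrow> ratfun \<Rightarrow> bool" for A v where
  vanishes_0: "f \<in> polys A \<Longrightarrow> vanishes A v 0 f"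
| vanishes_Suc: "vanishes A v n f \<Longrightarrow> g \<in> polys A \<Longrightarrow> ev v g = 0 \<Longrightarrow> vanishes A v (Suc n) (g * f)"
| vanishes_add: "vanishes A v n f \<Longrightarrow> vanishes A v n g \<Longrightarrow> vanishes A v n (f + g)"

lemma vanishes_polys: "vanishes A v n f \<Longrightarrow> f \<in> polys A"
  by (induction rule: vanishes.induct) (auto simp: polys_closed)

lemma vanishes_zero: "vanishes A v n 0"
proof (induction n)
  case 0
  then show ?case by (intro vanishes_0 polys_closed_derived)
next
  case (Suc n)
  from vanishes_Suc[OF this polys_closed_derived(1)] show ?case by (simp add: ev_hom_derived)
qed

lemma vanishes_mult: "vanishes A v n f \<Longrightarrow> g \<in> polys A \<Longrightarrow> vanishes A v n (g * f)"
proof (induction rule: vanishes.induct)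
  case (vanishes_Suc n f h)
  have "vanishes A v (Suc n) (h * (g * f))" using vanishes_Suc by (intro vanishes.vanishes_Suc) auto
  then show ?case by (simp add: mult_ac)
qed (auto simp: distrib_left intro: vanishes.intros polys_closed)

lemma vanishes_minus: "vanishes A v n f \<Longrightarrow> vanishes A v n (- f)"
  using vanishes_mult[of A v n f "-1"] by (simp add: polys_closed_derived)

lemma vanishes_sum: "(\<And>a. a \<in> S \<Longrightarrow> vanishes A v n (f a)) \<Longrightarrow> vanishes A v n (\<Sum>a\<in>S. f a)"
  by (induction S rule: infinite_finite_induct) (auto simp: vanishes_zero intro: vanishes_add)

lemma vanishes_power: "g \<in> polys A \<Longrightarrow> ev v g = 0 \<Longrightarrow> vanishes A v n (g ^ n)"
  by (induction n) (auto intro: vanishes.intros polys_closed_derived)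

lemma vanishes_ev: "vanishes A v m f \<Longrightarrow> m \<noteq> 0 \<Longrightarrow> ev v f = 0"
proof (induction rule: vanishes.induct)
  case (vanishes_Suc n f g)
  then show ?case using vanishes_polys[of A v n f] by (simp add: ev_hom(2)[where A = A])
next
  case (vanishes_add n f g)
  then show ?case using vanishes_polys[of A v n f] vanishes_polys[of A v n g] by (auto simp: ev_hom(1)[where A = A])
qed auto

lemma vanishes_endo:
  assumes "vanishes A w n f" "endo F" "\<And>g. g \<in> polys A \<Longrightarrow> F g \<in> polys A \<and> ev v (F g) = ev w g"
  shows "vanishes A v n (F f)"
  using assms(1)
  by (induction rule: vanishes.induct) (auto simp: endoD[OF assms(2)] assms(3) intro: vanishes.intros)

text \<open>A divided difference along a reflection that fixes the point lowers the order of vanishing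
  by at most one: the Leibniz rule either spends one factor or keeps it, permuted.\<close>
lemma vanishes_dd_simple:
  assumes s: "s \<in> A" "next_idx s \<in> A" "v (next_idx s) = v s" and f: "vanishes A v m f" "m = Suc n"
  shows "vanishes A v n (dd_simple s f)"
  using f
proof (induction arbitrary: n rule: vanishes.induct)
  case (vanishes_Suc m f g)
  have v: "v \<circ> simple_refl s = v" using s(3) by (auto simp: fun_eq_iff simple_refl_def transpose_def)
  have rg: "act (simple_refl s) g \<in> polys A"
    by (rule act_polys) (use vanishes_Suc s in \<open>auto simp: simple_refl_def transpose_def\<close>)
  have ev: "ev v (act (simple_refl s) g) = 0"
    using ev_act[OF bij_simple_refl vanishes_Suc(2), of v s] vanishes_Suc v by simp
  have "vanishes A v n (dd_simple s g * f)"
    using vanishes_Suc s by (intro vanishes_mult dd_simple_polys) auto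
  moreover have "vanishes A v n (act (simple_refl s) g * dd_simple s f)"
  proof (cases m)
    case 0
    then show ?thesis using vanishes_Suc rg s vanishes_polys[of A v m f] by (auto intro!: vanishes_0 polys_closed dd_simple_polys)
  next
    case (Suc m')
    then have "vanishes A v (Suc m') (act (simple_refl s) g * dd_simple s f)"
      using vanishes_Suc.IH[OF Suc] rg ev by (intro vanishes.vanishes_Suc)
    then show ?thesis using vanishes_Suc Suc by simp
  qed
  ultimately show ?case by (auto simp: dd_simple_mult intro: vanishes_add)
qed (auto simp: dd_simple_linear intro: vanishes_add)

lemma vanishes_dd_word:
  assumes "\<And>s. s \<in> set ws \<Longrightarrow> s \<in> A \<and> next_idx s \<in> A \<and> v (next_idx s) = v s" "vanishes A v (length ws + n) f"
  shows "vanishes A v n (dd_word ws f)"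
  using assms
proof (induction ws arbitrary: n)
  case (Cons s ws)
  have "vanishes A v (Suc n) (dd_word ws f)" using Cons.IH[of "Suc n"] Cons.prems by simp
  then show ?case using Cons.prems(1)[of s] by (auto intro!: vanishes_dd_simple)
qed simp

lemma ev_dd_word_vanishes:
  assumes "\<And>s. s \<in> set ws \<Longrightarrow> s \<in> A \<and> next_idx s \<in> A \<and> v (next_idx s) = v s" "vanishes A v n f" "length ws < n"
  shows "ev v (dd_word ws f) = 0"
proof -
  have "vanishes A v (length ws + (n - length ws)) f" using assms by simp
  from vanishes_dd_word[OF assms(1) this] have "vanishes A v (n - length ws) (dd_word ws f)" by simp
  then show ?thesis using assms(3) vanishes_ev[of A v "n - length ws"] by simp
qed

section \<open>Stabilizers with interval blocks\<close>

context
  fixes k :: nat and lam :: "nat \<Rightarrow> nat"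
begin

abbreviation II :: "idx set" where "II \<equiv> I k lam"

text \<open>Each level set of \<open>c\<close> in a row \<open>i < k\<close> is an interval. Both \<open>v\<close> and its dominant shifts have
  this property, and the facts below make their stabilizers standard parabolic subgroups.\<close>
definition interval_blocks :: "(idx \<Rightarrow> complex) \<Rightarrow> bool" where
  "interval_blocks c \<longleftrightarrow> (\<forall>i p q r. i < k \<longrightarrow> (i, p) \<in> II \<longrightarrow> (i, q) \<in> II \<longrightarrow> p \<le> r \<longrightarrow> r \<le> q \<longrightarrow> c (i, p) = c (i, q) \<longrightarrow> c (i, r) = c (i, p))"

lemma interval_blocksD: "interval_blocks c \<Longrightarrow> i < k \<Longrightarrow> (i, p) \<in> II \<Longrightarrow> (i, q) \<in> II \<Longrightarrow> p \<le> r \<Longrightarrow> r \<le> q \<Longrightarrow> c (i, p) = c (i, q) \<Longrightarrow> c (i, r) = c (i, p)"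
  unfolding interval_blocks_def by blast

definition stab_simples :: "(idx \<Rightarrow> complex) \<Rightarrow> idx set" where
  "stab_simples c = {s \<in> simple k lam. fst s < k \<and> c (next_idx s) = c s}"

lemma stab_simples_simple: "lists (stab_simples c) \<subseteq> lists (simple k lam)"
  by (auto simp: stab_simples_def)

lemma stab_iff: "g \<in> stab k lam c \<longleftrightarrow> g \<in> G_under k lam \<and> c \<circ> g = c"
proof -
  have "act_dual g c = c \<longleftrightarrow> c \<circ> g = c" if "bij g"
  proof
    assume "act_dual g c = c"
    then have "c (inv g (g a)) = c (g a)" for a by (simp add: act_dual_def fun_eq_iff)
    then show "c \<circ> g = c" using that by (simp add: bij_is_inj fun_eq_iff)
  next
    assume "c \<circ> g = c"
    then have "c (g (inv g a)) = c (inv g a)" for a by (metis comp_apply)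
    then show "act_dual g c = c" using that by (simp add: bij_is_surj surj_f_inv_f fun_eq_iff act_dual_def)
  qed
  then show ?thesis by (auto simp: stab_def G_under_def dest: G_props(1))
qed

lemma row_iff: "a \<in> row lam i \<longleftrightarrow> 1 \<le> i \<and> fst a = i \<and> 1 \<le> snd a \<and> snd a \<le> lam i"
  by (cases a) (auto simp: row_def)

lemma I_iff: "a \<in> II \<longleftrightarrow> 1 \<le> fst a \<and> fst a \<le> k \<and> 1 \<le> snd a \<and> snd a \<le> lam (fst a)"
  by (cases a) (auto simp: I_def)

lemma G_under_G: "g \<in> G_under k lam \<Longrightarrow> g \<in> G k lam"
  by (simp add: G_under_def)

lemma G_under_fix: "g \<in> G_under k lam \<Longrightarrow> \<not> fst a < k \<Longrightarrow> g a = a"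
proof -
  assume g: "g \<in> G_under k lam" "\<not> fst a < k"
  show "g a = a"
  proof (cases "a \<in> II")
    case True
    then have "a \<in> row lam k" using g by (auto simp: row_iff I_iff)
    then show ?thesis using g by (simp add: G_under_def)
  next
    case False
    then show ?thesis using g by (auto simp: G_under_def G_def permutes_not_in)
  qed
qed

lemma G_underI: "g \<in> G k lam \<Longrightarrow> (\<And>a. fst a = k \<Longrightarrow> g a = a) \<Longrightarrow> g \<in> G_under k lam"
  by (auto simp: G_under_def row_def)

lemma G_under_id: "id \<in> G_under k lam"
  by (intro G_underI G_id) auto

lemma G_under_comp: "g \<in> G_under k lam \<Longrightarrow> h \<in> G_under k lam \<Longrightarrow> g \<circ> h \<in> G_under k lam"
  by (intro G_underI G_comp) (auto simp: G_under_G G_under_fix)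

lemma G_under_inv: "g \<in> G_under k lam \<Longrightarrow> inv g \<in> G_under k lam"
proof (intro G_underI G_inv)
  fix a :: idx assume g: "g \<in> G_under k lam" and "fst a = k"
  then have "g a = a" by (simp add: G_under_fix)
  then show "inv g a = a" using G_props(1)[OF G_under_G[OF g]] by (metis bij_is_inj inv_f_f)
qed (simp add: G_under_G)

lemma finite_G_under: "finite (G_under k lam)"
proof (rule finite_subset)
  show "G_under k lam \<subseteq> {g. g permutes II}" by (auto simp: G_under_def G_def)
  show "finite {g. g permutes II}" by (rule finite_permutations[OF finite_I])
qed

lemma stab_G_under: "g \<in> stab k lam c \<Longrightarrow> g \<in> G_under k lam"
  and stab_G: "g \<in> stab k lam c \<Longrightarrow> g \<in> G k lam"
  and stab_bij: "g \<in> stab k lam c \<Longrightarrow> bij g"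
  and stab_inv_c: "g \<in> stab k lam c \<Longrightarrow> c (g a) = c a"
  by (auto simp: stab_iff G_under_G fun_eq_iff dest: G_under_G G_props(1))

lemma stab_id: "id \<in> stab k lam c"
  by (simp add: stab_iff G_under_id)

lemma stab_comp: "g \<in> stab k lam c \<Longrightarrow> h \<in> stab k lam c \<Longrightarrow> g \<circ> h \<in> stab k lam c"
  by (auto simp: stab_iff G_under_comp fun_eq_iff)

lemma stab_inv: "g \<in> stab k lam c \<Longrightarrow> inv g \<in> stab k lam c"
proof -
  assume g: "g \<in> stab k lam c"
  have "c (inv g a) = c a" for a
    using stab_inv_c[OF g, of "inv g a"] stab_bij[OF g] by (simp add: bij_is_surj surj_f_inv_f)
  then show ?thesis using g by (auto simp: stab_iff G_under_inv)
qed

lemma stab_simples_stab: "s \<in> stab_simples c \<Longrightarrow> simple_refl s \<in> stab k lam c"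
proof -
  assume s: "s \<in> stab_simples c"
  have "simple_refl s \<in> G_under k lam"
    by (rule G_underI[OF simple_refl_G]) (use s in \<open>auto simp: stab_simples_def simple_refl_def transpose_def\<close>)
  moreover have "c \<circ> simple_refl s = c" using s by (auto simp: stab_simples_def fun_eq_iff simple_refl_def transpose_def)
  ultimately show ?thesis by (simp add: stab_iff)
qed

lemma word_prod_stab: "ws \<in> lists (stab_simples c) \<Longrightarrow> word_prod ws \<in> stab k lam c"
  by (induction ws) (auto simp: stab_id stab_comp stab_simples_stab)

text \<open>If \<open>s\<close> exchanged indices of different blocks, then, the blocks being intervals in the order
  of the row and preserved by \<open>g\<close>, the images could not be inverted.\<close>
lemma descent_stab_simples:
  assumes c: "interval_blocks c" and g: "g \<in> stab k lam c" and s: "s \<in> simple k lam" and d: "descent g s"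
  shows "s \<in> stab_simples c"
proof -
  define i p where "i = fst s" and "p = snd s"
  have s_eq: "s = (i, p)" by (simp add: i_def p_def)
  have ik: "i < k"
  proof (rule ccontr)
    assume "\<not> i < k"
    then have "g s = s" "g (next_idx s) = next_idx s" using G_under_fix[OF stab_G_under[OF g]] by (simp_all add: i_def)
    then show False using d by (simp add: descent_def)
  qed
  obtain a b where ab: "g s = (i, a)" "g (next_idx s) = (i, b)"
    using G_props(2)[OF stab_G[OF g], of s] G_props(2)[OF stab_G[OF g], of "next_idx s"]
    by (metis fst_conv i_def prod.collapse)
  have mem: "(i, p) \<in> II" "(i, Suc p) \<in> II" using simple_in_I[OF s] by (simp_all add: s_eq)
  have mem2: "(i, a) \<in> II" "(i, b) \<in> II" using mem G_props(3)[OF stab_G[OF g], of s] G_props(3)[OF stab_G[OF g], of "next_idx s"] ab by (simp_all add: s_eq)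
  have ba: "b < a" using d ab by (simp add: descent_def)
  have ca: "c (i, a) = c (i, p)" "c (i, b) = c (i, Suc p)"
    using stab_inv_c[OF g, of s] stab_inv_c[OF g, of "next_idx s"] ab by (simp_all add: s_eq)
  have "c (i, Suc p) = c (i, p)"
  proof (cases "Suc p \<le> a")
    case True
    then show ?thesis using interval_blocksD[OF c ik mem(1) mem2(1), of "Suc p"] ca by simp
  next
    case False
    then have "b \<le> p" using ba by simp
    then have "c (i, p) = c (i, b)" using interval_blocksD[OF c ik mem2(2) mem(2), of p] ca by simp
    then show ?thesis using ca by simp
  qed
  then show ?thesis using s ik by (simp add: stab_simples_def s_eq)
qed

text \<open>The last letter of a reduced word is a descent, so it lies in the stabilizer and can be
  split off.\<close>
lemma reduced_stab:
  assumes c: "interval_blocks c"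
  shows "reduced k lam ws \<Longrightarrow> word_prod ws \<in> stab k lam c \<Longrightarrow> ws \<in> lists (stab_simples c)"
proof (induction ws rule: rev_induct)
  case (snoc s ws)
  have s: "s \<in> simple k lam" using snoc.prems by (auto simp: reduced_def)
  have r: "reduced k lam ws" "\<not> descent (word_prod ws) s" using snoc.prems reduced_snoc[OF s] by auto
  have W: "word_prod ws \<in> G k lam" using r word_prod_G by (auto simp: reduced_def)
  have d: "descent (word_prod (ws @ [s])) s"
    using r descent_comp[OF W, of s] by (simp add: word_prod_snoc)
  have sw: "s \<in> stab_simples c" by (rule descent_stab_simples[OF c snoc.prems(2) s d])
  have "word_prod (ws @ [s]) \<circ> simple_refl s = word_prod ws" by (simp add: word_prod_snoc comp_assoc)
  then have "word_prod ws \<in> stab k lam c" using stab_comp[OF snoc.prems(2) stab_simples_stab[OF sw]] by simp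
  then show ?case using snoc.IH r sw by auto
qed simp

lemma descent_exists:
  assumes "interval_blocks c" "g \<in> stab k lam c" "g \<noteq> id"
  shows "\<exists>s\<in>stab_simples c. descent g s"
  using no_descent_id[OF stab_G[OF assms(2)]] descent_stab_simples[OF assms(1,2)] assms(3) by blast

text \<open>Inside a block any two indices are joined by steps from an index to the next one.\<close>
lemma block_chain:
  assumes c: "interval_blocks c" and adj: "\<And>s. s \<in> stab_simples c \<Longrightarrow> P s (next_idx s)" and trans: "\<And>x y z. P x y \<Longrightarrow> P y z \<Longrightarrow> P x z"
    and x: "x \<in> II" "y \<in> II" "fst x = fst y" "fst x < k" "snd x < snd y" "c x = c y"
  shows "P x y"
proof -
  define i p where "i = fst x" and "p = snd x"
  have "P (i, p) (i, q)" if "p < q" "(i, q) \<in> II" "c (i, q) = c (i, p)" for q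
    using that
  proof (induction q)
    case (Suc q)
    have mem: "(i, p) \<in> II" using x(1) by (simp add: i_def p_def)
    have q: "(i, q) \<in> II" using Suc.prems mem by (auto simp: I_def)
    have cq: "c (i, q) = c (i, p)"
      using interval_blocksD[OF c _ mem Suc.prems(2), of q] Suc.prems x by (simp add: i_def)
    have sw: "(i, q) \<in> stab_simples c" using q Suc.prems cq x by (auto simp: stab_simples_def simple_def i_def)
    have 1: "P (i, q) (i, Suc q)" using adj[OF sw] by simp
    show ?case
    proof (cases "p = q")
      case False
      then have "P (i, p) (i, q)" using Suc.IH q cq Suc.prems by simp
      then show ?thesis using 1 trans by blast
    qed (use 1 in simp)
  qed simp
  moreover have "x = (i, p)" "y = (i, snd y)" using x by (simp_all add: i_def p_def prod_eq_iff)
  ultimately show ?thesis using x by (metis snd_conv)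
qed

lemma block_asc:
  assumes "interval_blocks c" "g \<in> G k lam" "\<And>s. s \<in> stab_simples c \<Longrightarrow> \<not> descent g s"
    and "x \<in> II" "y \<in> II" "fst x = fst y" "fst x < k" "snd x < snd y" "c x = c y"
  shows "snd (g x) < snd (g y)"
proof (rule block_chain[where P = "\<lambda>x y. snd (g x) < snd (g y)" and c = c])
  fix s assume "s \<in> stab_simples c"
  then show "snd (g s) < snd (g (next_idx s))"
    using assms(3)[of s] G_neq[OF assms(2), of s "next_idx s"] next_idx_neq[of s] unfolding descent_def by fastforce
qed (use assms in auto)

lemma block_descent:
  assumes "interval_blocks c" "\<And>s. s \<in> stab_simples c \<Longrightarrow> descent g s"
    and "x \<in> II" "y \<in> II" "fst x = fst y" "fst x < k" "snd x < snd y" "c x = c y"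
  shows "snd (g y) < snd (g x)"
proof (rule block_chain[where P = "\<lambda>x y. snd (g y) < snd (g x)" and c = c])
  fix s assume "s \<in> stab_simples c"
  then show "snd (g (next_idx s)) < snd (g s)"
    using assms(2)[of s] unfolding descent_def by blast
qed (use assms in auto)

text \<open>Appending ascents from the stabilizer of \<open>c\<close> must stop, because the number of inversions is
  bounded.\<close>
lemma reduced_extend:
  assumes "reduced k lam ws"
  shows "\<exists>e\<in>lists (stab_simples c). reduced k lam (ws @ e) \<and> (\<forall>s\<in>stab_simples c. descent (word_prod (ws @ e)) s)"
proof -
  define N where "N = card (II \<times> II)"
  have bound: "length e \<le> N" if "reduced k lam (ws @ e)" for e
  proof -
    have "length e \<le> inv_num k lam (word_prod (ws @ e))" using that by (simp add: reduced_def)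
    also have "\<dots> \<le> N" unfolding N_def
      by (rule card_mono) (auto simp: inversions_def finite_I)
    finally show ?thesis .
  qed
  let ?P = "\<lambda>n. \<exists>e\<in>lists (stab_simples c). reduced k lam (ws @ e) \<and> length e = n"
  have "?P 0" using assms by (intro bexI[of _ "[]"]) auto
  then obtain n where n: "?P n" "\<And>m. ?P m \<Longrightarrow> m \<le> n"
    using GreatestI_nat[of ?P 0 N] Greatest_le_nat[of ?P _ N] bound by blast
  then obtain e where e: "e \<in> lists (stab_simples c)" "reduced k lam (ws @ e)" "length e = n" by blast
  have "descent (word_prod (ws @ e)) s" if s: "s \<in> stab_simples c" for s
  proof (rule ccontr)
    assume "\<not> ?thesis"
    then have "reduced k lam ((ws @ e) @ [s])" using e s by (subst reduced_snoc) (auto simp: stab_simples_def)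
    then have "?P (Suc n)" using e s by (intro bexI[of _ "e @ [s]"]) auto
    then show False using n(2) by fastforce
  qed
  then show ?thesis using e by blast
qed

text \<open>If \<open>g\<close> and \<open>g'\<close> both reverse every block, then \<open>g' g\<^sup>-\<^sup>1\<close> preserves the order in every
  block, so it has no descents.\<close>
lemma longest_unique:
  assumes c: "interval_blocks c" and g: "g \<in> stab k lam c" "g' \<in> stab k lam c"
    and d: "\<And>s. s \<in> stab_simples c \<Longrightarrow> descent g s" "\<And>s. s \<in> stab_simples c \<Longrightarrow> descent g' s"
  shows "g = g'"
proof -
  define h where "h = g' \<circ> inv g"
  have h: "h \<in> stab k lam c" using g stab_comp stab_inv by (simp add: h_def)
  have bg: "bij g" using g stab_bij by blast
  have "h = id"
  proof (rule ccontr)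
    assume "h \<noteq> id"
    then obtain s where s: "s \<in> stab_simples c" "descent h s" using descent_exists c h by blast
    define x y where "x = inv g s" and "y = inv g (next_idx s)"
    have gx: "g x = s" "g y = next_idx s" using bg by (simp_all add: x_def y_def bij_is_surj surj_f_inv_f)
    have fst: "fst x = fst s" "fst y = fst s"
      using G_props(2)[OF stab_G[OF g(1)], of x] G_props(2)[OF stab_G[OF g(1)], of y] gx by auto
    have cxy: "c x = c y" using stab_inv_c[OF g(1), of x] stab_inv_c[OF g(1), of y] gx s by (simp add: stab_simples_def)
    have mem: "x \<in> II" "y \<in> II"
      using G_props(3)[OF stab_G[OF g(1)], of x] G_props(3)[OF stab_G[OF g(1)], of y] gx s simple_in_I by (auto simp: stab_simples_def)
    have k: "fst s < k" using s by (simp add: stab_simples_def)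
    have "\<not> snd x < snd y" 
      using block_descent[OF c d(1) mem] gx fst k cxy by fastforce
    moreover have "x \<noteq> y" using gx next_idx_neq by metis
    then have "snd x \<noteq> snd y" using fst by (metis prod_eqI)
    ultimately have "snd (g' x) < snd (g' y)"
      using block_descent[OF c d(2) mem(2,1)] fst k cxy by simp
    then show False using s by (simp add: descent_def h_def x_def y_def)
  qed
  then have "g' \<circ> inv g \<circ> g = g" by (simp add: h_def)
  then show ?thesis using bg by (simp add: comp_assoc bij_is_inj)
qed

text \<open>An element that increases along the blocks of \<open>c\<close> preserves all order relations inside a
  block; so the inversions that \<open>r\<close> creates persist.\<close>
lemma reduced_append_min:
  assumes c: "interval_blocks c" and ws: "reduced k lam ws" "\<And>s. s \<in> stab_simples c \<Longrightarrow> \<not> descent (word_prod ws) s"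
    and r: "r \<in> lists (stab_simples c)" "reduced k lam r"
  shows "reduced k lam (ws @ r)"
  using r
proof (induction r rule: rev_induct)
  case Nil then show ?case using ws by simp
next
  case (snoc s r)
  have s: "s \<in> stab_simples c" "s \<in> simple k lam" and r: "r \<in> lists (stab_simples c)" using snoc.prems by (auto simp: stab_simples_def)
  have reduced: "reduced k lam r" and nd: "\<not> descent (word_prod r) s" using snoc.prems reduced_snoc[OF s(2)] by auto
  have W: "word_prod ws \<in> G k lam" using ws word_prod_G by (auto simp: reduced_def)
  have S: "word_prod r \<in> stab k lam c" by (rule word_prod_stab[OF r])
  have neq: "snd (word_prod r s) \<noteq> snd (word_prod r (next_idx s))"
    using G_neq[OF stab_G[OF S]] next_idx_neq[of s] by simp
  have "snd (word_prod ws (word_prod r s)) < snd (word_prod ws (word_prod r (next_idx s)))"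
  proof (rule block_asc[OF c W ws(2)])
    show "snd (word_prod r s) < snd (word_prod r (next_idx s))" using nd neq by (simp add: descent_def)
    show "c (word_prod r s) = c (word_prod r (next_idx s))" using s stab_inv_c[OF S] by (simp add: stab_simples_def)
  qed (use s simple_in_I[of s] in \<open>simp_all add: G_props(2,3)[OF stab_G[OF S]] stab_simples_def\<close>)
  then have "\<not> descent (word_prod (ws @ r)) s" by (simp add: descent_def word_prod_append)
  then have "reduced k lam ((ws @ r) @ [s])" using snoc.IH[OF r reduced] reduced_snoc[OF s(2)] by blast
  then show ?case by simp
qed

lemma shortest_asc:
  assumes "w \<in> shortest_reps k lam (stab k lam v) (stab k lam u)" "s \<in> stab_simples u"
  shows "\<not> descent w s"
proof
  assume d: "descent w s"
  have w: "w \<in> G k lam" using assms stab_G by (auto simp: shortest_reps_def)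
  have s: "s \<in> simple k lam" using assms by (simp add: stab_simples_def)
  have "len k lam w \<le> len k lam (w \<circ> simple_refl s)" using assms stab_simples_stab by (auto simp: shortest_reps_def)
  then show False using inv_num_descent[OF w s d] len_inv_num[OF w] len_inv_num[OF G_comp[OF w simple_refl_G[OF s]]] by simp
qed

text \<open>Write \<open>w = w' h\<close> with \<open>w'\<close> shortest in the coset, hence increasing along the blocks of \<open>u\<close>.
  A descent of \<open>h\<close> inside a block is then a descent of \<open>w\<close>.\<close>
lemma not_shortest_descent:
  assumes u: "interval_blocks u" and w: "w \<in> stab k lam v"
    and ns: "w \<notin> shortest_reps k lam (stab k lam v) (stab k lam u)"
  shows "\<exists>s\<in>stab_simples u. descent w s"
proof -
  let ?P = "\<lambda>h. h \<in> stab k lam u"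
  obtain h0 where h0: "?P h0" "\<And>h. ?P h \<Longrightarrow> inv_num k lam (w \<circ> h0) \<le> inv_num k lam (w \<circ> h)"
    using ex_has_least_nat[of ?P id "\<lambda>h. inv_num k lam (w \<circ> h)"] stab_id by blast
  define w' where "w' = w \<circ> h0"
  define h where "h = inv h0"
  have h: "h \<in> stab k lam u" using h0 stab_inv by (simp add: h_def)
  have wG: "w \<circ> h \<in> G k lam" if "h \<in> stab k lam u" for h using that w stab_G G_comp by blast
  have wh: "w = w' \<circ> h" using stab_bij[OF h0(1)] by (simp add: w'_def h_def fun_eq_iff bij_is_surj surj_f_inv_f)
  have asc: "\<not> descent w' s" if s: "s \<in> stab_simples u" for s
  proof
    assume d: "descent w' s"
    have "inv_num k lam w' \<le> inv_num k lam (w' \<circ> simple_refl s)"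
      using h0(2)[OF stab_comp[OF h0(1) stab_simples_stab[OF s]]] by (simp add: w'_def comp_assoc)
    then show False using inv_num_descent[OF wG[OF h0(1)] _ d[unfolded w'_def]] s by (simp add: w'_def stab_simples_def)
  qed
  have "h \<noteq> id"
  proof
    assume "h = id"
    then have "w' = w" using wh by simp
    then have "len k lam w \<le> len k lam (w \<circ> h)" if "h \<in> stab k lam u" for h
      using h0(2)[OF that] wG[OF that] w by (simp add: len_inv_num stab_G w'_def)
    then show False using ns w by (simp add: shortest_reps_def)
  qed
  then obtain s where s: "s \<in> stab_simples u" "descent h s" using descent_exists u h by blast
  have "snd (w' (h (next_idx s))) < snd (w' (h s))"
  proof (rule block_asc[OF u _ asc])
    show "w' \<in> G k lam" using wG h0 by (simp add: w'_def)
    show "snd (h (next_idx s)) < snd (h s)" using s by (simp add: descent_def)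
    show "u (h (next_idx s)) = u (h s)" using s stab_inv_c[OF h] by (simp add: stab_simples_def)
  qed (use s simple_in_I[of s] in \<open>simp_all add: G_props(2,3)[OF stab_G[OF h]] stab_simples_def\<close>)
  then have "descent w s" by (simp add: descent_def wh)
  then show ?thesis using s by blast
qed

end

section \<open>Shifts and dominant representatives\<close>

lemma Ints_complex_eqI: "(z::complex) \<in> \<int> \<Longrightarrow> w \<in> \<int> \<Longrightarrow> Re z = Re w \<Longrightarrow> z = w"
  by (auto elim!: Ints_cases)

context
  fixes k :: nat and lam :: "nat \<Rightarrow> nat"
begin

text \<open>The vectors by which elements of the shift group translate. The last row does not move.\<close>
definition shifts :: "(idx \<Rightarrow> complex) set" where
  "shifts = {m. (\<forall>a. m a \<in> \<int>) \<and> (\<forall>a. m a \<noteq> 0 \<longrightarrow> a \<in> I k lam \<and> fst a < k)}"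

lemma gimel_step:
  assumes "sh m \<in> gimel k lam" "a \<in> I k lam" "fst a < k"
  shows "sh (m(a := m a + 1)) \<in> gimel k lam" "sh (m(a := m a - 1)) \<in> gimel k lam"
proof -
  obtain i j where a: "a = (i, j)" by (cases a)
  have "phi (i, j) \<circ> sh m = sh (m(a := m a + 1))"
    by (simp add: fun_eq_iff phi_sh sh_sh a) (auto intro!: arg_cong2[where f = sh])
  then show "sh (m(a := m a + 1)) \<in> gimel k lam" using gimel_phi[OF assms(1), of i j] assms a by simp
  have "inv (phi (i, j)) \<circ> sh m = sh (m(a := m a - 1))"
    by (simp add: fun_eq_iff phi_sh inv_sh sh_sh a) (auto intro!: arg_cong2[where f = sh])
  then show "sh (m(a := m a - 1)) \<in> gimel k lam" using gimel_inv[OF assms(1), of i j] assms a by simp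
qed

lemma gimel_steps:
  assumes "sh m \<in> gimel k lam" "a \<in> I k lam" "fst a < k" "z \<in> \<int>"
  shows "sh (m(a := m a + z)) \<in> gimel k lam"
proof -
  obtain n where z: "z = of_int n" using assms(4) by (auto elim: Ints_cases)
  have "sh (m(a := m a + of_int n)) \<in> gimel k lam"
  proof (induction n rule: int_induct[where k = 0])
    case base
    have "m(a := m a + of_int 0) = m" by simp
    then show ?case using assms(1) by simp
  next
    case (step1 i)
    have "(m(a := m a + of_int i))(a := (m(a := m a + of_int i)) a + 1) = m(a := m a + of_int (i + 1))"
      by (simp add: fun_eq_iff)
    then show ?case using gimel_step(1)[OF step1(2) assms(2,3)] by metis
  next
    case (step2 i)
    have "(m(a := m a + of_int i))(a := (m(a := m a + of_int i)) a - 1) = m(a := m a + of_int (i - 1))"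
      by (simp add: fun_eq_iff)
    then show ?case using gimel_step(2)[OF step2(2) assms(2,3)] by metis
  qed
  then show ?thesis by (simp add: z)
qed

lemma shifts_gimel:
  assumes "m \<in> shifts"
  shows "sh m \<in> gimel k lam"
proof -
  have "sh m \<in> gimel k lam" if "finite S" "m \<in> shifts" "{a. m a \<noteq> 0} \<subseteq> S" for S m
    using that
  proof (induction S arbitrary: m)
    case empty
    then have "m = 0" by auto
    then show ?case using gimel_id sh_0(1) by metis
  next
    case (insert a S)
    show ?case
    proof (cases "m a = 0")
      case True
      then have "{a. m a \<noteq> 0} \<subseteq> S" using insert.prems by blast
      then show ?thesis using insert by blast
    next
      case False
      have a: "a \<in> I k lam" "fst a < k" "m a \<in> \<int>" using False insert.prems by (auto simp: shifts_def)
      have "sh (m(a := 0)) \<in> gimel k lam"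
        by (rule insert.IH) (use insert.prems in \<open>auto simp: shifts_def\<close>)
      from gimel_steps[OF this a] show ?thesis by simp
    qed
  qed
  moreover have "{a. m a \<noteq> 0} \<subseteq> I k lam" using assms by (auto simp: shifts_def)
  ultimately show ?thesis using assms finite_I by blast
qed

lemma gimel_shifts:
  assumes "\<xi> \<in> gimel k lam"
  shows "\<exists>m\<in>shifts. \<xi> = sh m"
  using assms
proof (induction rule: gimel.induct)
  case gimel_id
  have "id = sh 0" by (rule sh_0(1)[symmetric])
  moreover have "0 \<in> shifts" by (simp add: shifts_def)
  ultimately show ?case by blast
next
  case (gimel_phi \<xi> i j)
  then obtain m where "m \<in> shifts" "\<xi> = sh m" by blast
  then show ?case using gimel_phi
    by (intro bexI[of _ "\<lambda>b. (if (i, j) = b then 1 else 0) + m b"]) (auto simp: fun_eq_iff phi_sh sh_sh shifts_def)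
next
  case (gimel_inv \<xi> i j)
  then obtain m where "m \<in> shifts" "\<xi> = sh m" by blast
  then show ?case using gimel_inv
    by (intro bexI[of _ "\<lambda>b. - (if (i, j) = b then 1 else 0) + m b"]) (auto simp: fun_eq_iff phi_sh inv_sh sh_sh shifts_def)
qed

lemma is_shift_iff:
  assumes "v \<in> Vdual k lam" "m \<in> shifts"
  shows "is_shift k lam v (sh m) w \<longleftrightarrow> w = v + m"
proof
  assume w: "is_shift k lam v (sh m) w"
  show "w = v + m"
  proof
    fix a
    show "w a = (v + m) a"
    proof (cases "a \<in> I k lam")
      case True
      then have X: "X a \<in> polys (I k lam)" by (rule polys_closed)
      then have "ev w (X a) = ev v (sh m (X a))" using w by (simp add: is_shift_def R_eq)
      then show ?thesis using ev_sh[OF X] by (simp add: ev_hom)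
    next
      case False
      then have "m a = 0" using assms by (auto simp: shifts_def)
      then show ?thesis using False w assms by (simp add: Vdual_def is_shift_def)
    qed
  qed
next
  assume w: "w = v + m"
  have "w \<in> Vdual k lam" using assms by (auto simp: w Vdual_def shifts_def)
  then show "is_shift k lam v (sh m) w"
    by (simp add: is_shift_def R_eq ev_sh w plus_fun_def)
qed

lemma gimel_orbit_eq:
  assumes "v \<in> Vdual k lam"
  shows "gimel_orbit k lam v = (\<lambda>m. v + m) ` shifts"
  unfolding gimel_orbit_def
  using shifts_gimel gimel_shifts is_shift_iff[OF assms] by blast

lemma shifts_comp:
  assumes "m \<in> shifts" "g \<in> G_under k lam"
  shows "m \<circ> g \<in> shifts"
  using assms G_props[OF G_under_G[OF assms(2)]] by (auto simp: shifts_def)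

end

locale maximal_stabilizer =
  fixes k :: nat and lam :: "nat \<Rightarrow> nat" and v :: "idx \<Rightarrow> complex"
  assumes Vdual: "v \<in> Vdual k lam"
    and max: "\<And>w. w \<in> gimel_orbit k lam v \<Longrightarrow> stab k lam w \<subseteq> stab k lam v"
    and interval: "\<And>i a. 1 \<le> i \<Longrightarrow> i \<le> k \<Longrightarrow> a \<in> row lam i \<Longrightarrow>
           \<exists>p q. stab_orbit k lam v a = {(i, r) | r. p \<le> r \<and> r \<le> p + q}"
begin

abbreviation "IX \<equiv> I k lam"
abbreviation "Sh \<equiv> shifts k lam"
abbreviation "W \<equiv> stab k lam v"
abbreviation "SV \<equiv> stab_simples k lam v"

lemma stab_sub: "m \<in> Sh \<Longrightarrow> stab k lam (v + m) \<subseteq> W"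
  by (rule max) (simp add: gimel_orbit_eq[OF Vdual])

lemma transpose_G_under:
  assumes "a \<in> IX" "b \<in> IX" "fst a = fst b" "fst a < k"
  shows "transpose a b \<in> G_under k lam"
  by (rule G_underI) (use assms in \<open>auto simp: G_def permutes_swap_id transpose_def\<close>)

text \<open>Shifting the value at \<open>b\<close> to that at \<open>a\<close> stays in the orbit of \<open>v\<close>, and the shifted point is
  fixed by the transposition of \<open>a\<close> and \<open>b\<close>. By maximality the transposition already fixes \<open>v\<close>.\<close>
lemma integral_eq:
  assumes ab: "a \<in> IX" "b \<in> IX" "fst a = fst b" "fst a < k" and int: "v a - v b \<in> \<int>"
  shows "v a = v b"
proof (cases "a = b")
  case False
  define m where "m = (\<lambda>c. if c = b then v a - v b else 0)"
  have m: "m \<in> Sh" using ab int by (auto simp: shifts_def m_def)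
  have "(v + m) a = (v + m) b" using False by (simp add: m_def)
  then have "transpose a b \<in> stab k lam (v + m)"
    using transpose_G_under[OF ab] by (auto simp: stab_iff fun_eq_iff transpose_def)
  then have "transpose a b \<in> W" using stab_sub[OF m] by blast
  from stab_inv_c[OF this, of a] show ?thesis by simp
qed simp

lemma interval_blocks_v: "interval_blocks k lam v"
  unfolding interval_blocks_def
proof (intro allI impI)
  fix i p q r
  assume i: "i < k" and p: "(i, p) \<in> IX" and q: "(i, q) \<in> IX" and r: "p \<le> r" "r \<le> q" and eq: "v (i, p) = v (i, q)"
  have "transpose (i, p) (i, q) \<in> W"
    using transpose_G_under[OF p q] i eq by (auto simp: stab_iff fun_eq_iff transpose_def)
  then have "(i, q) \<in> stab_orbit k lam v (i, p)" unfolding stab_orbit_def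
    by (rule rev_image_eqI) simp
  moreover have "(i, p) \<in> stab_orbit k lam v (i, p)" unfolding stab_orbit_def
    by (rule rev_image_eqI[OF stab_id]) simp
  moreover have "\<exists>p' q'. stab_orbit k lam v (i, p) = {(i, r) | r. p' \<le> r \<and> r \<le> p' + q'}"
    by (rule interval) (use p in \<open>auto simp: I_def row_def\<close>)
  ultimately have "(i, r) \<in> stab_orbit k lam v (i, p)" using r by auto
  then show "v (i, r) = v (i, p)" by (auto simp: stab_orbit_def dest: stab_inv_c)
qed

text \<open>This translates the condition that singles out the representative of an orbit into one about
  simple reflections.\<close>
lemma stab_orbit_eq_iff:
  assumes "(i, p) \<in> IX" "(i, p + 1) \<in> IX"
  shows "stab_orbit k lam v (i, p) = stab_orbit k lam v (i, p + 1) \<longleftrightarrow> (i, p) \<in> SV"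
proof
  assume "stab_orbit k lam v (i, p) = stab_orbit k lam v (i, p + 1)"
  moreover have "(i, p) \<in> stab_orbit k lam v (i, p)" unfolding stab_orbit_def
    by (rule rev_image_eqI[OF stab_id]) simp
  ultimately obtain g where g: "g \<in> W" "(i, p) = g (i, p + 1)" by (auto simp: stab_orbit_def)
  then have "v (i, p) = v (i, p + 1)" using stab_inv_c[OF g(1), of "(i, p + 1)"] by simp
  moreover have "i < k" using G_under_fix[OF stab_G_under[OF g(1)], of "(i, p + 1)"] g(2) by (cases "i < k") auto
  ultimately show "(i, p) \<in> SV" using assms by (simp add: stab_simples_def simple_def)
next
  assume s: "(i, p) \<in> SV"
  let ?r = "simple_refl (i, p)"
  have r: "?r \<in> W" by (rule stab_simples_stab[OF s])
  have "stab_orbit k lam v a \<subseteq> stab_orbit k lam v (?r a)" for a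
  proof
    fix b assume "b \<in> stab_orbit k lam v a"
    then obtain g where "g \<in> W" "b = g a" by (auto simp: stab_orbit_def)
    then have "g \<circ> ?r \<in> W" "b = (g \<circ> ?r) (?r a)" using r stab_comp by auto
    then show "b \<in> stab_orbit k lam v (?r a)" unfolding stab_orbit_def by blast
  qed
  from this[of "(i, p)"] this[of "(i, p + 1)"]
  show "stab_orbit k lam v (i, p) = stab_orbit k lam v (i, p + 1)"
    by (simp add: simple_refl_def)
qed

text \<open>As in the definition of the representative, integers are compared through their real parts.\<close>
definition dominant :: "(idx \<Rightarrow> complex) \<Rightarrow> bool" where
  "dominant m \<longleftrightarrow> (\<forall>s\<in>SV. Re (m (next_idx s)) \<le> Re (m s))"

lemma dominant_chain:
  assumes m: "dominant m" and "x \<in> IX" "y \<in> IX" "fst x = fst y" "fst x < k" "snd x \<le> snd y" "v x = v y"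
  shows "Re (m y) \<le> Re (m x)"
proof (cases "snd x = snd y")
  case True
  then have "x = y" using assms by (simp add: prod_eq_iff)
  then show ?thesis by simp
next
  case False
  show ?thesis
    by (rule block_chain[where P = "\<lambda>x y. Re (m y) \<le> Re (m x)" and c = v and k = k and lam = lam])
      (use assms False interval_blocks_v in \<open>auto simp: dominant_def\<close>)
qed

text \<open>Equal values of \<open>v + m\<close> come from values of \<open>v\<close> that differ by an integer, so the blocks of
  \<open>v + m\<close> refine those of \<open>v\<close>.\<close>
lemma shift_eqD:
  assumes m: "m \<in> Sh" and ab: "a \<in> IX" "b \<in> IX" "fst a = fst b" "fst a < k" and eq: "(v + m) a = (v + m) b"
  shows "v a = v b" "m a = m b"
proof -
  have "v a - v b = m b - m a" using eq by (simp add: algebra_simps)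
  also have "\<dots> \<in> \<int>" using m by (auto simp: shifts_def)
  finally show "v a = v b" by (rule integral_eq[OF ab])
  then show "m a = m b" using eq by simp
qed

lemma interval_blocks_shift:
  assumes m: "m \<in> Sh" and d: "dominant m"
  shows "interval_blocks k lam (v + m)"
  unfolding interval_blocks_def
proof (intro allI impI)
  fix i p q r
  assume i: "i < k" and p: "(i, p) \<in> IX" and q: "(i, q) \<in> IX" and r: "p \<le> r" "r \<le> q" and eq: "(v + m) (i, p) = (v + m) (i, q)"
  note e = shift_eqD[OF m p q _ _ eq]
  have rI: "(i, r) \<in> IX" using p q r by (auto simp: I_def)
  have vr: "v (i, r) = v (i, p)" using interval_blocksD[OF interval_blocks_v i p q r] e i by simp
  have "Re (m (i, q)) \<le> Re (m (i, r))" "Re (m (i, r)) \<le> Re (m (i, p))"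
    by (rule dominant_chain[OF d]; use p q r rI i vr e in simp)+
  then have "Re (m (i, r)) = Re (m (i, p))" using e i by simp
  then have "m (i, r) = m (i, p)" using m by (intro Ints_complex_eqI) (auto simp: shifts_def)
  then show "(v + m) (i, r) = (v + m) (i, p)" using vr by simp
qed

text \<open>By the rearrangement inequality, a permutation in \<open>W\<close> that minimizes the sum of index times
  value puts the values in decreasing order: exchanging two neighbours in the wrong order would
  lower the sum.\<close>
lemma exists_dominant:
  assumes m: "m \<in> Sh"
  shows "\<exists>g\<in>W. dominant (m \<circ> g)"
proof -
  have fin: "finite W" using finite_G_under by (rule rev_finite_subset) (auto simp: stab_def)
  have ne: "W \<noteq> {}" using stab_id by auto
  define \<Phi> where "\<Phi> = (\<lambda>g. \<Sum>a\<in>IX. real (snd a) * Re (m (g a)))"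
  define g where "g = arg_min_on \<Phi> W"
  have g: "g \<in> W" "\<And>h. h \<in> W \<Longrightarrow> \<not> \<Phi> h < \<Phi> g"
    using arg_min_if_finite[OF fin ne, of \<Phi>] by (auto simp: g_def)
  have "Re (m (g (next_idx s))) \<le> Re (m (g s))" if s: "s \<in> SV" for s
  proof -
    let ?r = "simple_refl s"
    have r: "?r permutes IX" using stab_simples_stab[OF s] stab_G by (auto simp: G_def)
    have sI: "s \<in> IX" "next_idx s \<in> IX" using s simple_in_I by (auto simp: stab_simples_def)
    have "\<Phi> (g \<circ> ?r) = (\<Sum>a\<in>IX. real (snd (?r a)) * Re (m (g a)))"
      using sum.permute[OF r, of "\<lambda>a. real (snd (?r a)) * Re (m (g a))"] by (simp add: \<Phi>_def comp_def)
    then have "\<Phi> (g \<circ> ?r) - \<Phi> g = (\<Sum>a\<in>IX. real (snd (?r a)) * Re (m (g a)) - real (snd a) * Re (m (g a)))"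
      by (simp add: \<Phi>_def sum_subtractf)
    also have "\<dots> = (\<Sum>a\<in>{s, next_idx s}. real (snd (?r a)) * Re (m (g a)) - real (snd a) * Re (m (g a)))"
      by (rule sum.mono_neutral_right) (use sI finite_I in \<open>auto simp: simple_refl_def transpose_def\<close>)
    also have "\<dots> = Re (m (g s)) - Re (m (g (next_idx s)))"
      by (subst sum.insert) (use next_idx_neq[of s] in \<open>auto simp: algebra_simps\<close>)
    finally show ?thesis using g(2)[OF stab_comp[OF g(1) stab_simples_stab[OF s]]] by simp
  qed
  then have "dominant (m \<circ> g)" unfolding dominant_def comp_apply by blast
  then show ?thesis using g(1) by blast
qed

text \<open>By induction on the length of \<open>g\<close>. At a descent \<open>s\<close> of \<open>g\<close> the two dominance conditions give
  opposite inequalities, hence equal values, and \<open>g\<close> can be replaced by the shorter \<open>gs\<close>.\<close>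
lemma dominant_unique:
  assumes m: "m \<in> Sh" and d: "dominant m"
  shows "g \<in> W \<Longrightarrow> dominant (m \<circ> g) \<Longrightarrow> m \<circ> g = m"
proof (induction "inv_num k lam g" arbitrary: g rule: less_induct)
  case less
  show ?case
  proof (cases "g = id")
    case False
    then obtain s where s: "s \<in> SV" "descent g s" using descent_exists[OF interval_blocks_v less.prems(1)] by blast
    have sS: "s \<in> simple k lam" and sk: "fst s < k" and vs: "v (next_idx s) = v s" using s by (auto simp: stab_simples_def)
    have 1: "Re (m (g (next_idx s))) \<le> Re (m (g s))" using less.prems s by (auto simp: dominant_def)
    have 2: "Re (m (g s)) \<le> Re (m (g (next_idx s)))"
      by (rule dominant_chain[OF d])
       (use s(2) simple_in_I[OF sS] sk vs in \<open>simp_all add: descent_def G_props(2,3)[OF stab_G[OF less.prems(1)]] stab_inv_c[OF less.prems(1)]\<close>)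
    have eq: "m (g s) = m (g (next_idx s))"
      using 1 2 m by (intro Ints_complex_eqI) (auto simp: shifts_def)
    have same: "m \<circ> (g \<circ> simple_refl s) = m \<circ> g"
      using eq by (auto simp: fun_eq_iff simple_refl_def transpose_def)
    have "m \<circ> (g \<circ> simple_refl s) = m"
    proof (rule less.hyps)
      show "inv_num k lam (g \<circ> simple_refl s) < inv_num k lam g"
        using inv_num_descent[OF stab_G[OF less.prems(1)] sS s(2)] by simp
      show "g \<circ> simple_refl s \<in> W" by (rule stab_comp[OF less.prems(1) stab_simples_stab[OF s(1)]])
      show "dominant (m \<circ> (g \<circ> simple_refl s))" using less.prems by (simp only: same)
    qed
    then show ?thesis by (simp add: same)
  qed simp
qed

lemma act_dual_shift:
  assumes "g \<in> W"
  shows "act_dual g (v + m) = v + (m \<circ> inv g)"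
  using stab_inv_c[OF stab_inv[OF assms]] by (auto simp: act_dual_def fun_eq_iff)

definition shift_orbit :: "(idx \<Rightarrow> complex) \<Rightarrow> (idx \<Rightarrow> complex) set" where
  "shift_orbit m = (\<lambda>g. act_dual g (v + m)) ` W"

lemma shift_orbit_eq: "shift_orbit m = (\<lambda>g. v + (m \<circ> g)) ` W"
proof -
  have "inv ` W = W"
  proof (intro equalityI subsetI)
    fix g assume "g \<in> W"
    then have "g = inv (inv g)" "inv g \<in> W" using stab_inv stab_bij by (auto simp: inv_inv_eq)
    then show "g \<in> inv ` W" by blast
  qed (auto intro: stab_inv)
  then have "(\<lambda>g. v + (m \<circ> g)) ` W = (\<lambda>g. v + (m \<circ> g)) ` inv ` W" by simp
  then show ?thesis by (auto simp: shift_orbit_def image_image act_dual_shift)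
qed

lemma J_eq: "J k lam v = shift_orbit ` {m \<in> Sh. dominant m}"
proof (intro equalityI subsetI)
  fix Ob assume "Ob \<in> J k lam v"
  then obtain m where m: "m \<in> Sh" "Ob = shift_orbit m"
    by (auto simp: J_def gimel_orbit_eq[OF Vdual] shift_orbit_def)
  obtain g where g: "g \<in> W" "dominant (m \<circ> g)" using exists_dominant[OF m(1)] by blast
  have "(\<lambda>h. v + (m \<circ> h)) ` W = (\<lambda>h. v + (m \<circ> g \<circ> h)) ` W"
  proof (intro equalityI subsetI)
    fix x assume "x \<in> (\<lambda>h. v + (m \<circ> h)) ` W"
    then obtain h where h: "h \<in> W" "x = v + (m \<circ> h)" by blast
    then have "x = v + (m \<circ> g \<circ> (inv g \<circ> h))"
      using stab_bij[OF g(1)] by (simp add: fun_eq_iff bij_is_surj surj_f_inv_f)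
    then show "x \<in> (\<lambda>h. v + (m \<circ> g \<circ> h)) ` W" using stab_comp[OF stab_inv[OF g(1)] h(1)] by blast
  next
    fix x assume "x \<in> (\<lambda>h. v + (m \<circ> g \<circ> h)) ` W"
    then show "x \<in> (\<lambda>h. v + (m \<circ> h)) ` W" using stab_comp[OF g(1)] by (auto simp: comp_assoc)
  qed
  then have "Ob = shift_orbit (m \<circ> g)" by (simp add: m shift_orbit_eq)
  then show "Ob \<in> shift_orbit ` {m \<in> Sh. dominant m}" using g m shifts_comp stab_G_under by blast
next
  fix Ob assume "Ob \<in> shift_orbit ` {m \<in> Sh. dominant m}"
  then show "Ob \<in> J k lam v" by (auto simp: J_def gimel_orbit_eq[OF Vdual] shift_orbit_def)
qed

lemma rep_shift_orbit:
  assumes m: "m \<in> Sh" "dominant m"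
  shows "rep k lam v (shift_orbit m) = v + m"
proof -
  have dom: "(\<forall>i p. (i, p) \<in> IX \<longrightarrow> (i, p + 1) \<in> IX \<longrightarrow> stab_orbit k lam v (i, p) = stab_orbit k lam v (i, p + 1)
      \<longrightarrow> Re ((v + n) (i, p) - v (i, p)) \<ge> Re ((v + n) (i, p + 1) - v (i, p + 1))) \<longleftrightarrow> dominant n" for n
  proof -
    have "(i, p) \<in> SV \<Longrightarrow> (i, p) \<in> IX \<and> (i, p + 1) \<in> IX" for i p
      by (auto simp: stab_simples_def simple_def)
    then show ?thesis using stab_orbit_eq_iff unfolding dominant_def by (simp add: Ball_def split_paired_All) blast
  qed
  show ?thesis
    unfolding rep_def
  proof (rule the_equality, intro conjI)
    show "v + m \<in> shift_orbit m" unfolding shift_orbit_eq by (rule rev_image_eqI[OF stab_id]) simp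
    show "\<forall>i p. (i, p) \<in> IX \<longrightarrow> (i, p + 1) \<in> IX \<longrightarrow> stab_orbit k lam v (i, p) = stab_orbit k lam v (i, p + 1)
      \<longrightarrow> Re ((v + m) (i, p) - v (i, p)) \<ge> Re ((v + m) (i, p + 1) - v (i, p + 1))"
      unfolding dom by (rule m)
  next
    fix u assume u: "u \<in> shift_orbit m \<and> (\<forall>i p. (i, p) \<in> IX \<longrightarrow> (i, p + 1) \<in> IX \<longrightarrow> stab_orbit k lam v (i, p) = stab_orbit k lam v (i, p + 1)
      \<longrightarrow> Re (u (i, p) - v (i, p)) \<ge> Re (u (i, p + 1) - v (i, p + 1)))"
    then obtain g where g: "g \<in> W" "u = v + (m \<circ> g)" by (auto simp: shift_orbit_eq)
    then have "dominant (m \<circ> g)" using u dom[of "m \<circ> g"] by blast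
    then show "u = v + m" using dominant_unique[OF m g(1)] g by simp
  qed
qed

lemma shift_of_shift_orbit:
  assumes m: "m \<in> Sh" "dominant m"
  shows "shift_of k lam v (shift_orbit m) = sh m"
  unfolding shift_of_def rep_shift_orbit[OF m]
proof (rule the_equality)
  show "sh m \<in> gimel k lam \<and> is_shift k lam v (sh m) (v + m)"
    using shifts_gimel is_shift_iff[OF Vdual] m by blast
next
  fix \<xi> assume x: "\<xi> \<in> gimel k lam \<and> is_shift k lam v \<xi> (v + m)"
  then obtain n where n: "n \<in> Sh" "\<xi> = sh n" using gimel_shifts by blast
  then have "v + m = v + n" using x is_shift_iff[OF Vdual] by blast
  then have "m = n" by simp
  then show "\<xi> = sh m" using n by simp
qed

text \<open>Functionals with a polynomial factor \<open>g\<close> and an arbitrary shift occur when generators act;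
  those of the theorem have \<open>g = 1\<close> and \<open>m\<close> dominant.\<close>
definition word_functional :: "idx list \<Rightarrow> ratfun \<Rightarrow> (idx \<Rightarrow> complex) \<Rightarrow> ratfun \<Rightarrow> complex" where
  "word_functional ws g m = restr k lam (\<lambda>f. ev v (dd_word ws (g * sh m f)))"

lemma functional_at_shift_orbit:
  assumes m: "m \<in> Sh" "dominant m" and ws: "reduced k lam ws" "word_prod ws = w"
  shows "functional_at k lam v (shift_orbit m) w = word_functional ws 1 m"
  unfolding functional_at_def shift_of_shift_orbit[OF m] word_functional_def dd_eq_dd_word[OF ws] by (simp add: comp_def)

lemma functionals_eq:
  assumes S: "\<And>u. S u \<subseteq> W"
  shows "(\<Union>Ob\<in>J k lam v. \<Union>w\<in>S (rep k lam v Ob). {functional_at k lam v Ob w})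
    = {word_functional ws 1 m | ws m. m \<in> Sh \<and> dominant m \<and> ws \<in> lists SV \<and> reduced k lam ws \<and> word_prod ws \<in> S (v + m)}"
    (is "?L = ?R")
proof (intro equalityI subsetI)
  fix l assume "l \<in> ?L"
  then obtain m w where m: "m \<in> Sh" "dominant m" and w: "w \<in> S (v + m)" and l: "l = functional_at k lam v (shift_orbit m) w"
    by (auto simp: J_eq rep_shift_orbit)
  have wW: "w \<in> W" using w S by blast
  obtain ws where ws: "reduced k lam ws" "word_prod ws = w" using exists_red[OF stab_G[OF wW]] by blast
  have "ws \<in> lists SV" using reduced_stab[OF interval_blocks_v ws(1)] wW ws by simp
  then show "l \<in> ?R" using functional_at_shift_orbit[OF m ws] l m ws w by blast
next
  fix l assume "l \<in> ?R"
  then obtain ws m where *: "m \<in> Sh" "dominant m" "reduced k lam ws" "l = word_functional ws 1 m" "word_prod ws \<in> S (v + m)" by blast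
  have "l = functional_at k lam v (shift_orbit m) (word_prod ws)" using * functional_at_shift_orbit by simp
  moreover have "word_prod ws \<in> S (rep k lam v (shift_orbit m))" using * by (simp add: rep_shift_orbit)
  ultimately show "l \<in> ?L" using * unfolding J_eq
    by (intro UN_I[of "shift_orbit m"] UN_I[of "word_prod ws"]) auto
qed

lemma B_under_eq: "B_under k lam v = {word_functional ws 1 m | ws m. m \<in> Sh \<and> dominant m \<and> ws \<in> lists SV \<and> reduced k lam ws}"
  unfolding B_under_def functionals_eq[of "\<lambda>_. W", OF subset_refl] using word_prod_stab by blast

lemma B_eq: "B k lam v = {word_functional ws 1 m | ws m. m \<in> Sh \<and> dominant m \<and> ws \<in> lists SV \<and> reduced k lam ws
    \<and> word_prod ws \<in> shortest_reps k lam W (stab k lam (v + m))}"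
  unfolding B_def by (rule functionals_eq) (auto simp: shortest_reps_def)

end

section \<open>The generators as sums of divided differences\<close>

lemma support_closed:
  assumes "inj g" "\<And>a. a \<notin> S \<Longrightarrow> g a = a" "a \<in> S"
  shows "g a \<in> S"
proof (rule ccontr)
  assume n: "g a \<notin> S"
  then have "g (g a) = g a" by (rule assms(2))
  then have "g a = a" using assms(1) by (simp add: inj_eq)
  then show False using assms(3) n by simp
qed

definition unit_shift :: "complex \<Rightarrow> idx \<Rightarrow> idx \<Rightarrow> complex" where
  "unit_shift e a = (\<lambda>b. if a = b then e else 0)"

text \<open>The common form of \<open>E\<^sub>i\<close> (\<open>e = 1\<close>, \<open>i' = i + 1\<close>) and \<open>F\<^sub>i\<close> (\<open>e = -1\<close>, \<open>i' = i - 1\<close>).\<close>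
definition shift_op :: "(nat \<Rightarrow> nat) \<Rightarrow> complex \<Rightarrow> nat \<Rightarrow> nat \<Rightarrow> ratfun \<Rightarrow> ratfun" where
  "shift_op lam e i' i f = (\<Sum>s\<in>row lam i. (\<Prod>a\<in>row lam i'. X s - X a) / (\<Prod>b\<in>row lam i - {s}. X s - X b) * sh (unit_shift e s) f)"

lemma row_image: "1 \<le> i \<Longrightarrow> row lam i = Pair i ` {1..lam i}"
  by (auto simp: row_def)

lemma sum_row: "1 \<le> i \<Longrightarrow> (\<Sum>s\<in>row lam i. f s) = (\<Sum>j=1..lam i. f (i, j))"
  by (simp add: row_image sum.reindex inj_on_def)

lemma prod_row_minus: "1 \<le> i \<Longrightarrow> (\<Prod>s\<in>row lam i - {(i, j)}. f s) = (\<Prod>b\<in>{1..lam i} - {j}. f (i, b))"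
proof -
  assume "1 \<le> i"
  then have "row lam i - {(i, j)} = Pair i ` ({1..lam i} - {j})" by (auto simp: row_image)
  then show ?thesis by (simp add: prod.reindex inj_on_def)
qed

lemma opE_shift_op: "1 \<le> i \<Longrightarrow> opE lam i f = shift_op lam 1 (i + 1) i f"
  unfolding opE_def shift_op_def phi_sh sum_row unit_shift_def ..

lemma opF_shift_op: "1 \<le> i \<Longrightarrow> opF lam i f = shift_op lam (-1) (i - 1) i f"
proof -
  have "inv (phi a) = sh (unit_shift (-1) a)" for a
    by (auto simp: phi_sh inv_sh unit_shift_def intro!: arg_cong[where f = sh])
  then show "1 \<le> i \<Longrightarrow> ?thesis" unfolding opF_def shift_op_def sum_row by simp
qed

context
  fixes k :: nat and lam :: "nat \<Rightarrow> nat"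
begin

lemma bR_iff: "f \<in> bR k lam \<longleftrightarrow> f \<in> polys (I k lam) \<and> (\<forall>g\<in>G k lam. act g f = f)"
  by (simp add: bR_def R_eq)

lemma bR_polys: "f \<in> bR k lam \<Longrightarrow> f \<in> polys (I k lam)"
  by (simp add: bR_iff)

lemma act_sh_bR:
  assumes f: "f \<in> bR k lam" and g: "g \<in> G k lam"
  shows "act g (sh (m \<circ> g) f) = sh m f"
  using sh_act[OF G_props(1)[OF g], of m f] f g by (simp add: bR_iff)

lemma row_sub: "i \<le> k \<Longrightarrow> row lam i \<subseteq> I k lam"
  by (auto simp: row_def I_def)

lemma G_row_bij:
  assumes g: "g \<in> G k lam" and i: "i \<le> k"
  shows "bij_betw g (row lam i) (row lam i)"
proof (rule bij_betw_byWitness[where f' = "inv g"])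
  note b = G_props(1)[OF g]
  have "h a \<in> row lam i" if "h \<in> G k lam" "a \<in> row lam i" for h a
    using that G_props(2,3)[OF that(1), of a] i by (auto simp: row_iff I_iff)
  then show "g ` row lam i \<subseteq> row lam i" "inv g ` row lam i \<subseteq> row lam i"
    using g G_inv[OF g] by auto
qed (use G_props(1)[OF g] in \<open>auto simp: bij_is_inj bij_is_surj surj_f_inv_f\<close>)

lemma act_shift_op:
  assumes f: "f \<in> bR k lam" and g: "g \<in> G k lam" and i: "i \<le> k" "i' \<le> k"
  shows "act g (shift_op lam e i' i f) = shift_op lam e i' i f"
proof -
  note b = G_props(1)[OF g]
  note h = endoD[OF act_hom[OF b]]
  have inj: "inj g" using b bij_is_inj by blast
  have t: "act g ((\<Prod>a\<in>row lam i'. X s - X a) / (\<Prod>b\<in>row lam i - {s}. X s - X b) * sh (unit_shift e s) f)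
    = (\<Prod>a\<in>row lam i'. X (g s) - X a) / (\<Prod>b\<in>row lam i - {g s}. X (g s) - X b) * sh (unit_shift e (g s)) f"
    if s: "s \<in> row lam i" for s
  proof -
    have "unit_shift e (g s) \<circ> g = unit_shift e s" using inj by (auto simp: unit_shift_def fun_eq_iff inj_eq)
    then have 1: "act g (sh (unit_shift e s) f) = sh (unit_shift e (g s)) f" using act_sh_bR[OF f g, of "unit_shift e (g s)"] by simp
    have 2: "act g (\<Prod>a\<in>row lam i'. X s - X a) = (\<Prod>a\<in>row lam i'. X (g s) - X a)"
      unfolding endo_prod[OF act_hom[OF b]] h act_X[OF b]
      by (rule prod.reindex_bij_betw[OF G_row_bij[OF g i(2)]])
    have "bij_betw g (row lam i - {s}) (row lam i - {g s})"
      using bij_betw_DiffI[OF G_row_bij[OF g i(1)], of "{s}" "{g s}"] s bij_betwE[OF G_row_bij[OF g i(1)]] by simp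
    then have 3: "act g (\<Prod>b\<in>row lam i - {s}. X s - X b) = (\<Prod>b\<in>row lam i - {g s}. X (g s) - X b)"
      unfolding endo_prod[OF act_hom[OF b]] h act_X[OF b]
      by (rule prod.reindex_bij_betw)
    show ?thesis unfolding h 1 2 3 ..
  qed
  show ?thesis
    unfolding shift_op_def endo_sum[OF act_hom[OF b]]
    by (simp only: sum.cong[OF refl t])
      (rule sum.reindex_bij_betw[OF G_row_bij[OF g i(1)]])
qed

text \<open>The summand of index \<open>(i, j)\<close> in a generator applied to \<open>f\<close>, with the arguments translated
  by \<open>m\<close>.\<close>
definition term_at :: "complex \<Rightarrow> nat \<Rightarrow> nat \<Rightarrow> (idx \<Rightarrow> complex) \<Rightarrow> ratfun \<Rightarrow> nat \<Rightarrow> ratfun" where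
  "term_at e i' i m f j = (\<Prod>a\<in>row lam i'. (X (i, j) + cst (m (i, j))) - (X a + cst (m a)))
      / (\<Prod>b\<in>{1..lam i} - {j}. (X (i, j) + cst (m (i, j))) - (X (i, b) + cst (m (i, b)))) * sh (m + unit_shift e (i, j)) f"

lemma sh_shift_op:
  assumes "1 \<le> i"
  shows "sh m (shift_op lam e i' i f) = (\<Sum>j=1..lam i. term_at e i' i m f j)"
proof -
  note h = endoD[OF sh_hom[of m]]
  have "sh m (sh (unit_shift e s) f) = sh (m + unit_shift e s) f" for s
    unfolding sh_sh plus_fun_def ..
  then show ?thesis
    unfolding shift_op_def sum_row[OF assms] prod_row_minus[OF assms] term_at_def
    by (simp only: endo_sum[OF sh_hom] h endo_prod[OF sh_hom] sh_X)
qed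


text \<open>Let \<open>F\<^sub>j\<close> be the summand of index \<open>j\<close> times \<open>H\<close>, without the part of its denominator that
  comes from the block. A permutation of the block that moves \<open>p\<close> to \<open>j\<close> carries \<open>F\<^sub>p\<close> to \<open>F\<^sub>j\<close>,
  because \<open>m\<close> is constant on the block and \<open>f\<close> is symmetric. So the sum is the right-hand side of
  \<open>dd_word_interval\<close> for \<open>F\<^sub>p\<close>.\<close>
lemma block_sum:
  assumes i: "1 \<le> i" "i < k" "i' \<noteq> i" and C: "{p..p + n} \<subseteq> {1..lam i}"
    and mC: "\<And>j. j \<in> {p..p + n} \<Longrightarrow> m (i, j) = m (i, p)"
    and Hinv: "\<And>g. g \<in> G_under k lam \<Longrightarrow> (\<And>a. a \<notin> Pair i ` {p..p + n} \<Longrightarrow> g a = a) \<Longrightarrow> act g H = H"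
    and f: "f \<in> bR k lam"
  defines "P \<equiv> \<lambda>j. X (i, j) + cst (m (i, p))"
  shows "H * (\<Sum>j=p..p + n. term_at e i' i m f j) = dd_word (rev (map (Pair i) [p..<p + n]))
    (H * (\<Prod>a\<in>row lam i'. P p - (X a + cst (m a))) / (\<Prod>b\<in>{1..lam i} - {p..p + n}. P p - (X (i, b) + cst (m (i, b)))) * sh (m + unit_shift e (i, p)) f)"
proof -
  let ?C = "{p..p + n}"
  define F where "F = (\<lambda>j. H * (\<Prod>a\<in>row lam i'. P j - (X a + cst (m a))) / (\<Prod>b\<in>{1..lam i} - ?C. P j - (X (i, b) + cst (m (i, b)))) * sh (m + unit_shift e (i, j)) f)"
  have F: "act g (F p) = F j" if g: "g \<in> G_under k lam" "\<And>a. a \<notin> Pair i ` ?C \<Longrightarrow> g a = a" "g (i, p) = (i, j)" for g j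
  proof -
    note gG = G_under_G[OF g(1)]
    note b = G_props(1)[OF gG]
    note h = endoD[OF act_hom[OF b]]
    have inj: "inj g" using b bij_is_inj by blast
    have mg: "m (g a) = m a" for a
    proof (cases "a \<in> Pair i ` ?C")
      case True
      have "g a \<in> Pair i ` ?C" by (rule support_closed[OF inj g(2) True])
      then obtain j1 j2 where "a = (i, j1)" "j1 \<in> ?C" "g a = (i, j2)" "j2 \<in> ?C" using True by blast
      then show ?thesis using mC[of j1] mC[of j2] by simp
    qed (simp add: g(2))
    have "(m + unit_shift e (i, j)) \<circ> g = m + unit_shift e (i, p)"
    proof
      fix a
      have "(i, j) = g a \<longleftrightarrow> (i, p) = a" using g(3) inj by (metis injD)
      then show "((m + unit_shift e (i, j)) \<circ> g) a = (m + unit_shift e (i, p)) a" by (simp add: mg unit_shift_def)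
    qed
    then have 1: "act g (sh (m + unit_shift e (i, p)) f) = sh (m + unit_shift e (i, j)) f"
      using act_sh_bR[OF f gG, of "m + unit_shift e (i, j)"] by simp
    have Pj: "act g (P p) = P j" using g(3) by (simp add: P_def h act_X[OF b])
    have Xr: "act g (X a) = X a" if "a \<notin> Pair i ` ?C" for a using g(2)[OF that] by (simp add: act_X[OF b])
    have 2: "act g (\<Prod>a\<in>row lam i'. P p - (X a + cst (m a))) = (\<Prod>a\<in>row lam i'. P j - (X a + cst (m a)))"
      unfolding endo_prod[OF act_hom[OF b]] h Pj
    proof (rule prod.cong[OF refl])
      fix a assume "a \<in> row lam i'"
      then have "a \<notin> Pair i ` ?C" using i by (auto simp: row_def split: if_splits)
      then show "P j - (act g (X a) + cst (m a)) = P j - (X a + cst (m a))" by (simp add: Xr)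
    qed
    have 3: "act g (\<Prod>b\<in>{1..lam i} - ?C. P p - (X (i, b) + cst (m (i, b)))) = (\<Prod>b\<in>{1..lam i} - ?C. P j - (X (i, b) + cst (m (i, b))))"
      unfolding endo_prod[OF act_hom[OF b]] h Pj
      by (rule prod.cong[OF refl]) (simp add: Xr image_iff)
    have "act g H = H" by (rule Hinv) (use g in auto)
    then show ?thesis unfolding F_def h 1 2 3 by simp
  qed
  have CI: "(i, j) \<in> I k lam" if "j \<in> ?C" for j using that C i by (auto simp: I_def)
  have trG: "transpose (i, j) (i, j') \<in> G_under k lam" if "j \<in> ?C" "j' \<in> ?C" for j j'
    by (rule G_underI) (use CI[OF that(1)] CI[OF that(2)] i in \<open>auto simp: G_def permutes_swap_id transpose_def\<close>)
  have tr: "transpose (i, j) (i, j') a = a" if "j \<in> ?C" "j' \<in> ?C" "a \<notin> Pair i ` ?C" for j j' a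
    using that by (auto simp: transpose_def)
  have B: "act (transpose (i, p) (i, j)) (F p) / (\<Prod>b\<in>?C - {j}. X (i, j) - X (i, b)) = H * term_at e i' i m f j"
    if j: "j \<in> ?C" for j
  proof -
    have 1: "act (transpose (i, p) (i, j)) (F p) = F j"
      by (rule F) (use j trG[of p j] tr[of p j] in auto)
    have set: "{1..lam i} - {j} = (?C - {j}) \<union> ({1..lam i} - ?C)" using j C by auto
    have P: "X (i, j) + cst (m (i, j)) = P j" by (simp only: P_def mC[OF j])
    have in_C: "P j - (X (i, b) + cst (m (i, b))) = X (i, j) - X (i, b)" if "b \<in> ?C - {j}" for b
      using mC[of b] that by (simp add: P_def)
    have "(\<Prod>b\<in>{1..lam i} - {j}. P j - (X (i, b) + cst (m (i, b))))
      = (\<Prod>b\<in>?C - {j}. P j - (X (i, b) + cst (m (i, b)))) * (\<Prod>b\<in>{1..lam i} - ?C. P j - (X (i, b) + cst (m (i, b))))"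
      unfolding set by (rule prod.union_disjoint) auto
    also have "(\<Prod>b\<in>?C - {j}. P j - (X (i, b) + cst (m (i, b)))) = (\<Prod>b\<in>?C - {j}. X (i, j) - X (i, b))"
      by (rule prod.cong[OF refl in_C])
    finally show ?thesis unfolding 1 unfolding F_def term_at_def P
      by (simp add: mult_ac)
  qed
  have "dd_word (rev (map (Pair i) [p..<p + n])) (F p)
    = (\<Sum>j=p..p + n. act (transpose (i, p) (i, j)) (F p) / (\<Prod>b\<in>?C - {j}. X (i, j) - X (i, b)))"
  proof (rule dd_word_interval)
    fix q assume q: "p < q" "q < p + n"
    show "act (simple_refl (i, q)) (F p) = F p"
      by (rule F) (use q trG[of q "Suc q"] tr[of q "Suc q"] in \<open>auto simp: simple_refl_def\<close>)
  qed
  also have "\<dots> = (\<Sum>j=p..p + n. H * term_at e i' i m f j)"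
    by (rule sum.cong[OF refl B])
  finally show ?thesis
    unfolding sum_distrib_left F_def by (rule sym)
qed

text \<open>With \<open>m = 0\<close> and \<open>H = 1\<close> the whole row is one block, so the generator yields a divided
  difference of a polynomial.\<close>
lemma shift_op_bR:
  assumes i: "1 \<le> i" "i < k" "i' \<noteq> i" "i' \<le> k" and f: "f \<in> bR k lam"
  shows "shift_op lam e i' i f \<in> bR k lam"
proof (cases "lam i = 0")
  case True
  then have "shift_op lam e i' i f = 0" unfolding shift_op_def sum_row[OF i(1)] by simp
  then show ?thesis using endoD(4)[OF act_hom[OF G_props(1)]] by (auto simp: bR_iff polys_closed_derived)
next
  case False
  define n where "n = lam i - 1"
  have set: "{1..1 + n} = {1..lam i}" using False by (simp add: n_def)
  let ?P = "X (i, 1) + cst ((0 :: idx \<Rightarrow> complex) (i, 1))"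
  have "shift_op lam e i' i f = 1 * (\<Sum>j=1..1 + n. term_at e i' i 0 f j)"
    using sh_shift_op[OF i(1), of 0 e i' f] by (simp only: set sh_0) simp
  also have "\<dots> = dd_word (rev (map (Pair i) [1..<1 + n]))
    (1 * (\<Prod>a\<in>row lam i'. ?P - (X a + cst ((0 :: idx \<Rightarrow> complex) a))) / (\<Prod>b\<in>{1..lam i} - {1..1 + n}. ?P - (X (i, b) + cst ((0 :: idx \<Rightarrow> complex) (i, b)))) * sh (0 + unit_shift e (i, 1)) f)"
    by (rule block_sum) (use i f False in \<open>simp_all add: n_def endoD(5)[OF act_hom[OF G_props(1)[OF G_under_G]]]\<close>)
  also have "\<dots> = dd_word (rev (map (Pair i) [1..<1 + n])) ((\<Prod>a\<in>row lam i'. X (i, 1) - X a) * sh (unit_shift e (i, 1)) f)"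
    unfolding set by (simp add: cst_hom)
  also have "\<dots> \<in> polys (I k lam)"
  proof (rule dd_word_polys)
    have 1: "X (i, 1) \<in> polys (I k lam)" using i False by (intro polys_closed) (simp add: I_def)
    have "X a \<in> polys (I k lam)" if "a \<in> row lam i'" for a using row_sub[OF i(4)] that by (intro polys_closed) blast
    then show "(\<Prod>a\<in>row lam i'. X (i, 1) - X a) * sh (unit_shift e (i, 1)) f \<in> polys (I k lam)"
      using 1 sh_polys[OF bR_polys[OF f]] by (intro polys_closed(4) polys_prod polys_closed_derived) auto
  next
    fix s assume "s \<in> set (rev (map (Pair i) [1..<1 + n]))"
    then show "s \<in> I k lam \<and> next_idx s \<in> I k lam" using i by (auto simp: I_def n_def)
  qed
  finally have "shift_op lam e i' i f \<in> polys (I k lam)" .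
  then show ?thesis using act_shift_op[OF f] i by (simp add: bR_iff)
qed

lemma elem_sym_polys: "i \<le> k \<Longrightarrow> elem_sym (row lam i) j \<in> polys (I k lam)"
  unfolding elem_sym_def by (intro polys_sum polys_prod polys_closed) (use row_sub in blast)

lemma act_elem_sym:
  assumes g: "g \<in> G k lam" and i: "i \<le> k"
  shows "act g (elem_sym (row lam i) j) = elem_sym (row lam i) j"
proof -
  note b = G_props(1)[OF g]
  let ?S = "{T. T \<subseteq> row lam i \<and> card T = j}"
  have "bij_betw ((`) g) (Pow (row lam i)) (Pow (row lam i))"
    by (rule bij_betw_Pow[OF G_row_bij[OF g i]])
  then have P: "bij_betw ((`) g) (Pow (row lam i)) (Pow (row lam i))" .
  have inj: "inj g" using b bij_is_inj by blast
  have card: "card (g ` T) = card T" for T using inj by (simp add: card_image inj_on_subset)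
  have "(`) g ` ?S = ?S"
  proof (intro equalityI subsetI)
    fix T assume "T \<in> (`) g ` ?S"
    then obtain T' where "T' \<in> ?S" "T = g ` T'" by blast
    then show "T \<in> ?S" using bij_betwE[OF P] card by auto
  next
    fix T assume T: "T \<in> ?S"
    then have "T \<in> (`) g ` Pow (row lam i)" using P by (auto simp: bij_betw_def)
    then obtain T' where "T' \<subseteq> row lam i" "T = g ` T'" by auto
    then show "T \<in> (`) g ` ?S" using T card by auto
  qed
  then have "bij_betw ((`) g) ?S ?S" using bij_betw_subset[OF P, of ?S ?S] by auto
  then have "(\<Sum>T\<in>?S. \<Prod>b\<in>g ` T. X b) = (\<Sum>T\<in>?S. \<Prod>b\<in>T. X b)"
    by (rule sum.reindex_bij_betw)
  moreover have "act g (elem_sym (row lam i) j) = (\<Sum>T\<in>?S. \<Prod>b\<in>g ` T. X b)"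
    unfolding elem_sym_def endo_sum[OF act_hom[OF b]] endo_prod[OF act_hom[OF b]] act_X[OF b]
    by (subst prod.reindex) (auto intro: inj_on_subset[OF inj])
  ultimately show ?thesis by (simp add: elem_sym_def)
qed

lemma op_gamma_bR:
  assumes "a \<in> I k lam" "f \<in> bR k lam"
  shows "op_gamma lam a f \<in> bR k lam"
proof -
  have i: "fst a \<le> k" using assms by (auto simp: I_def)
  show ?thesis unfolding op_gamma_def bR_iff
    using assms i act_elem_sym elem_sym_polys by (auto simp: endoD(2)[OF act_hom[OF G_props(1)]] bR_iff polys_closed)
qed

lemma bR_Omega: "bR k lam \<subseteq> Omega k lam"
proof
  fix f assume "f \<in> bR k lam"
  then obtain p where "f = incl p" "vars p \<subseteq> I k lam" by (auto simp: bR_def R_def)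
  moreover have "vars 1 \<subseteq> I k lam" using vars_Const[of 1] by (simp add: Const_hom)
  ultimately show "f \<in> Omega k lam" unfolding Omega_def incl_def using one_neq_zero by blast
qed

lemma restr_cong: "(\<And>f. f \<in> bR k lam \<Longrightarrow> A f = A' f) \<Longrightarrow> restr k lam A = restr k lam A'"
  by (auto simp: restr_def)

lemma restr_add: "restr k lam (\<lambda>f. A f + A' f) = restr k lam A + restr k lam A'"
  by (auto simp: restr_def)

lemma restr_scale: "restr k lam (\<lambda>f. c * A f) = fscale c (restr k lam A)"
  by (auto simp: restr_def fscale_def)

lemma restr_zero: "restr k lam (\<lambda>f. 0) = 0"
  by (auto simp: restr_def)

lemma restr_sum: "restr k lam (\<lambda>f. \<Sum>y\<in>S. A y f) = (\<Sum>y\<in>S. restr k lam (A y))"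
  by (induction S rule: infinite_finite_induct) (simp_all add: restr_add restr_zero)

end

section \<open>Closure and spanning\<close>

lemma interval_Min_Max:
  fixes C :: "nat set"
  assumes "finite C" "C \<noteq> {}" "\<And>x y z. x \<in> C \<Longrightarrow> y \<in> C \<Longrightarrow> x \<le> z \<Longrightarrow> z \<le> y \<Longrightarrow> z \<in> C"
  shows "\<exists>p n. C = {p..p + n}"
proof (intro exI)
  have "C = {Min C..Max C}"
  proof (intro equalityI subsetI)
    fix z assume "z \<in> {Min C..Max C}"
    then show "z \<in> C" using assms(3)[of "Min C" "Max C" z] assms(1,2) by simp
  qed (simp add: assms(1))
  then show "C = {Min C..Min C + (Max C - Min C)}" using assms(1,2) by simp
qed

context maximal_stabilizer
begin

abbreviation "bRR \<equiv> bR k lam"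

lemma SV_IX: "s \<in> SV \<Longrightarrow> s \<in> IX \<and> next_idx s \<in> IX"
  using simple_in_I by (auto simp: stab_simples_def)

lemma dd_word_IX:
  assumes "f \<in> polys IX" "ws \<in> lists SV"
  shows "dd_word ws f \<in> polys IX"
proof (rule dd_word_polys[OF assms(1)])
  fix s assume "s \<in> set ws"
  then have "s \<in> SV" using assms(2) by blast
  then show "s \<in> IX \<and> next_idx s \<in> IX" by (rule SV_IX)
qed

lemma M_subspace: "functional.subspace (M k lam v)"
  unfolding M_def by (rule functional.subspace_span)

lemmas M_add = functional.subspace_add[OF M_subspace]
lemmas M_scale = functional.subspace_scale[OF M_subspace]
lemmas M_zero = functional.subspace_0[OF M_subspace]
lemmas M_sum = functional.subspace_sum[OF M_subspace]

text \<open>The intermediate shape in the reduction to \<open>g = 1\<close>: divided differences \<open>us\<close> and a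
  permutation \<open>h\<close> stand between the factor \<open>g\<close> and the shifted function.\<close>
definition twisted_functional :: "idx list \<Rightarrow> ratfun \<Rightarrow> (idx \<Rightarrow> idx) \<Rightarrow> idx list \<Rightarrow> (idx \<Rightarrow> complex) \<Rightarrow> ratfun \<Rightarrow> complex" where
  "twisted_functional ws g h us m = restr k lam (\<lambda>f. ev v (dd_word ws (g * act h (dd_word us (sh m f)))))"

lemma word_functional_dominant_mem:
  assumes "m \<in> Sh" "dominant m" "ws \<in> lists SV"
  shows "twisted_functional [] 1 id ws m \<in> M k lam v"
proof (cases "reduced k lam ws")
  case True
  then have "word_functional ws 1 m \<in> B_under k lam v" using assms unfolding B_under_eq by blast
  then show ?thesis unfolding M_def word_functional_def twisted_functional_def by (simp add: act_id functional.span_base)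
next
  case False
  have "ws \<in> lists (simple k lam)" using assms(3) stab_simples_simple by blast
  then have "twisted_functional [] 1 id ws m = restr k lam (\<lambda>f. 0)"
    unfolding twisted_functional_def by (intro restr_cong) (simp add: act_id ev_hom_derived dd_word_nonreduced[OF _ False])
  then show ?thesis using M_zero by (simp add: restr_zero)
qed

text \<open>The Leibniz rule moves the divided differences \<open>ws\<close> past \<open>g\<close>, one letter at a time; at the
  end \<open>g\<close> contributes its value at \<open>v\<close>.\<close>
lemma word_functional_Leibniz:
  assumes m: "m \<in> Sh" "dominant m" and ws: "ws \<in> lists SV"
  shows "us \<in> lists SV \<Longrightarrow> g \<in> polys IX \<Longrightarrow> twisted_functional ws g id us m \<in> M k lam v"
  using ws
proof (induction ws arbitrary: g us rule: rev_induct)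
  case Nil
  have "twisted_functional [] g id us m = restr k lam (\<lambda>f. ev v g * ev v (dd_word [] (1 * act id (dd_word us (sh m f)))))"
    unfolding twisted_functional_def using Nil
    by (intro restr_cong) (simp add: act_id ev_hom(2)[where A = IX] dd_word_IX sh_polys bR_polys)
  also have "\<dots> = fscale (ev v g) (twisted_functional [] 1 id us m)" by (simp only: restr_scale twisted_functional_def)
  finally show ?case using M_scale[OF word_functional_dominant_mem[OF m Nil(1)], of "ev v g"] by (simp only:)
next
  case (snoc s ws)
  have s: "s \<in> SV" and ws: "ws \<in> lists SV" using snoc.prems by auto
  let ?r = "simple_refl s"
  have rg: "act ?r g \<in> polys IX"
    by (rule act_polys) (use snoc.prems G_props(3)[OF simple_refl_G] s in \<open>auto simp: stab_simples_def\<close>)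
  have dg: "dd_simple s g \<in> polys IX" using dd_simple_polys snoc.prems SV_IX[OF s] by blast
  have us: "s # us \<in> lists SV" using snoc.prems s by simp
  have "twisted_functional (ws @ [s]) g id us m = restr k lam (\<lambda>f. ev v (dd_word ws (dd_simple s g * act id (dd_word us (sh m f))))
      + ev v (dd_word ws (act ?r g * act id (dd_word (s # us) (sh m f)))))"
    unfolding twisted_functional_def
  proof (rule restr_cong)
    fix f assume "f \<in> bRR"
    then have "sh m f \<in> polys IX" by (intro sh_polys bR_polys)
    then have "dd_word ws (dd_simple s g * dd_word us (sh m f)) \<in> polys IX" "dd_word ws (act ?r g * dd_word (s # us) (sh m f)) \<in> polys IX"
      using snoc.prems(1) us ws dg rg by (auto intro!: dd_word_IX polys_closed simp del: dd_word_simps)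
    then show "ev v (dd_word (ws @ [s]) (g * act id (dd_word us (sh m f))))
      = ev v (dd_word ws (dd_simple s g * act id (dd_word us (sh m f)))) + ev v (dd_word ws (act ?r g * act id (dd_word (s # us) (sh m f))))"
      by (simp add: dd_word_append act_id dd_simple_mult dd_word_linear ev_hom(1)[where A = IX])
  qed
  also have "\<dots> = twisted_functional ws (dd_simple s g) id us m + twisted_functional ws (act ?r g) id (s # us) m"
    unfolding twisted_functional_def restr_add ..
  finally show ?case using M_add[OF snoc.IH[OF snoc.prems(1) dg ws] snoc.IH[OF us rg ws]] by (simp only:)
qed

text \<open>The permutation is removed letter by letter with \<open>s = 1 - \<alpha>\<^sub>s \<partial>\<^sub>s\<close>.\<close>
lemma word_functional_twisted:
  assumes m: "m \<in> Sh" "dominant m" and ws: "ws \<in> lists SV"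
  shows "xs \<in> lists SV \<Longrightarrow> us \<in> lists SV \<Longrightarrow> g \<in> polys IX \<Longrightarrow> twisted_functional ws g (word_prod xs) us m \<in> M k lam v"
proof (induction xs arbitrary: g us rule: rev_induct)
  case Nil
  then show ?case using word_functional_Leibniz[OF m ws] unfolding word_prod_simps by blast
next
  case (snoc s xs)
  have s: "s \<in> SV" and xs: "xs \<in> lists SV" using snoc.prems by auto
  let ?w = "word_prod xs"
  have w: "?w \<in> G k lam" by (rule stab_G[OF word_prod_stab[OF xs]])
  note h = endoD[OF act_hom[OF G_props(1)[OF w]]]
  have aRA: "act ?w f \<in> polys IX" if "f \<in> polys IX" for f
    by (rule act_polys[OF G_props(1)[OF w] that]) (simp add: G_props(3)[OF w])
  \<comment> \<open>the factor that \<open>s = 1 - \<alpha>\<^sub>s \<partial>\<^sub>s\<close> produces\<close>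
  let ?g' = "- g * act ?w (X s - X (next_idx s))"
  have g': "?g' \<in> polys IX"
    using SV_IX[OF s] snoc.prems by (intro polys_closed(4) aRA polys_closed_derived polys_closed(2)) auto
  have us: "s # us \<in> lists SV" using snoc.prems s by simp
  have "twisted_functional ws g (word_prod (xs @ [s])) us m = restr k lam (\<lambda>f. ev v (dd_word ws (g * act ?w (dd_word us (sh m f))))
      + ev v (dd_word ws (?g' * act ?w (dd_word (s # us) (sh m f)))))"
    unfolding twisted_functional_def
  proof (rule restr_cong)
    fix f assume "f \<in> bRR"
    then have f: "sh m f \<in> polys IX" by (intro sh_polys bR_polys)
    have polys: "dd_word ws (g * act ?w (dd_word us (sh m f))) \<in> polys IX" "dd_word ws (?g' * act ?w (dd_word (s # us) (sh m f))) \<in> polys IX"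
      by (rule dd_word_IX[OF polys_closed(4)[OF snoc.prems(3) aRA[OF dd_word_IX[OF f snoc.prems(2)]]] ws],
        rule dd_word_IX[OF polys_closed(4)[OF g' aRA[OF dd_word_IX[OF f us]]] ws])
    have "act (word_prod (xs @ [s])) (dd_word us (sh m f)) = act ?w (act (simple_refl s) (dd_word us (sh m f)))"
      unfolding word_prod_snoc using G_props(1)[OF w] by (simp add: act_comp)
    also have "\<dots> = act ?w (dd_word us (sh m f)) - act ?w (X s - X (next_idx s)) * act ?w (dd_word (s # us) (sh m f))"
      unfolding act_simple_refl_dd h by simp
    finally have a: "act (word_prod (xs @ [s])) (dd_word us (sh m f)) = act ?w (dd_word us (sh m f)) - act ?w (X s - X (next_idx s)) * act ?w (dd_word (s # us) (sh m f))" .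
    have "g * act (word_prod (xs @ [s])) (dd_word us (sh m f)) = g * act ?w (dd_word us (sh m f)) + ?g' * act ?w (dd_word (s # us) (sh m f))"
      unfolding a right_diff_distrib by (simp add: mult.assoc)
    then show "ev v (dd_word ws (g * act (word_prod (xs @ [s])) (dd_word us (sh m f))))
      = ev v (dd_word ws (g * act ?w (dd_word us (sh m f)))) + ev v (dd_word ws (?g' * act ?w (dd_word (s # us) (sh m f))))"
      by (simp only: dd_word_linear ev_hom(1)[OF polys])
  qed
  also have "\<dots> = twisted_functional ws g ?w us m + twisted_functional ws ?g' ?w (s # us) m"
    unfolding twisted_functional_def restr_add ..
  finally show ?case using M_add[OF snoc.IH[OF xs snoc.prems(2,3)] snoc.IH[OF xs us g']] by (simp only:)
qed

text \<open>For a symmetric \<open>f\<close>, translating by \<open>m\<close> is translating by the dominant rearrangement of \<open>m\<close>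
  followed by a permutation from \<open>W\<close>.\<close>
lemma word_functional_mem:
  assumes m: "m \<in> Sh" and ws: "ws \<in> lists SV" and g: "g \<in> polys IX"
  shows "word_functional ws g m \<in> M k lam v"
proof -
  obtain h where h: "h \<in> W" "dominant (m \<circ> h)" using exists_dominant[OF m] by blast
  obtain xs where xs: "reduced k lam xs" "word_prod xs = h" using exists_red[OF stab_G[OF h(1)]] by blast
  have "xs \<in> lists SV" using reduced_stab[OF interval_blocks_v xs(1)] xs h by simp
  then have "twisted_functional ws g (word_prod xs) [] (m \<circ> h) \<in> M k lam v"
    using word_functional_twisted[OF shifts_comp[OF m stab_G_under[OF h(1)]] h(2) ws] g by simp
  moreover have "twisted_functional ws g (word_prod xs) [] (m \<circ> h) = word_functional ws g m"
    unfolding twisted_functional_def word_functional_def xs(2)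
    by (rule restr_cong) (simp add: act_sh_bR[OF _ stab_G[OF h(1)]])
  ultimately show ?thesis by simp
qed

text \<open>The factor \<open>H\<close> absorbs the denominators outside the block, which leaves a divided difference
  along the block of a polynomial times a shifted \<open>f\<close>. The second claim is what makes the
  functional additive over the blocks.\<close>
lemma block_functional:
  assumes m: "m \<in> Sh" "dominant m" and i: "1 \<le> i" "i < k" "i' \<noteq> i" "i' \<le> k" and e: "e \<in> \<int>"
    and H: "H \<in> polys IX" "\<And>g. g \<in> W \<Longrightarrow> act g H = H"
    and div: "\<And>p. p \<in> {1..lam i} \<Longrightarrow> \<exists>h\<in>polys IX. H = h * (\<Prod>b\<in>{b\<in>{1..lam i}. (v + m) (i, b) \<noteq> (v + m) (i, p)}. (X (i, p) + cst (m (i, p))) - (X (i, b) + cst (m (i, b))))"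
    and ws: "ws \<in> lists SV" and y: "y \<in> (\<lambda>j. (v + m) (i, j)) ` {1..lam i}"
  shows "restr k lam (\<lambda>f. ev v (dd_word ws (H * (\<Sum>j\<in>{j\<in>{1..lam i}. (v + m) (i, j) = y}. term_at lam e i' i m f j)))) \<in> M k lam v"
    and "f \<in> bRR \<Longrightarrow> H * (\<Sum>j\<in>{j\<in>{1..lam i}. (v + m) (i, j) = y}. term_at lam e i' i m f j) \<in> polys IX"
proof -
  let ?C = "{j\<in>{1..lam i}. (v + m) (i, j) = y}"
  have CI: "(i, j) \<in> IX" if "j \<in> {1..lam i}" for j using that i by (auto simp: I_def)
  have "\<exists>p n. ?C = {p..p + n}"
  proof (rule interval_Min_Max)
    fix a b c assume *: "a \<in> ?C" "b \<in> ?C" "a \<le> c" "c \<le> b"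
    then have "(v + m) (i, c) = (v + m) (i, a)"
      using interval_blocksD[OF interval_blocks_shift[OF m] i(2) CI CI, of a b c] by simp
    then show "c \<in> ?C" using * by auto
  qed (use y in auto)
  then obtain p n where C: "?C = {p..p + n}" by blast
  have pC: "p \<in> ?C" unfolding C by simp
  then have p: "p \<in> {1..lam i}" "(v + m) (i, p) = y" by auto
  have memC: "j \<in> {p..p + n} \<longleftrightarrow> j \<in> {1..lam i} \<and> (v + m) (i, j) = y" for j
    unfolding C[symmetric] by blast
  have sub: "{p..p + n} \<subseteq> {1..lam i}" using memC by blast
  have same: "v (i, j) = v (i, p)" "m (i, j) = m (i, p)" if "j \<in> {p..p + n}" for j
  proof -
    have j: "j \<in> {1..lam i}" "(v + m) (i, j) = (v + m) (i, p)" using that memC[of j] p by auto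
    show "v (i, j) = v (i, p)" "m (i, j) = m (i, p)"
      by (rule shift_eqD[OF m(1) CI[OF j(1)] CI[OF p(1)] _ _ j(2)]; simp add: i)+
  qed
  let ?P = "X (i, p) + cst (m (i, p))"
  let ?N = "\<Prod>a\<in>row lam i'. ?P - (X a + cst (m a))"
  let ?D = "\<Prod>b\<in>{1..lam i} - {p..p + n}. ?P - (X (i, b) + cst (m (i, b)))"
  let ?us = "rev (map (Pair i) [p..<p + n])"
  have us: "?us \<in> lists SV"
  proof -
    have "(i, q) \<in> SV" if "q \<in> {p..<p + n}" for q
      using that same[of q] same[of "Suc q"] CI[of q] CI[of "Suc q"] sub i by (auto simp: stab_simples_def simple_def)
    then show ?thesis by auto
  qed
  have Cc: "{b\<in>{1..lam i}. (v + m) (i, b) \<noteq> (v + m) (i, p)} = {1..lam i} - {p..p + n}"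
    using memC p(2) by blast
  obtain h where h: "h \<in> polys IX" "H = h * ?D" using div[OF p(1)] unfolding Cc by blast
  have Dne: "?D \<noteq> 0"
  proof
    assume "?D = 0"
    have "finite ({1..lam i} - {p..p + n})" by simp
    from prod_zero_iff[THEN iffD1, OF this \<open>?D = 0\<close>] obtain b where b: "b \<in> {1..lam i} - {p..p + n}" "?P - (X (i, b) + cst (m (i, b))) = 0" ..
    then have "ev v ?P = ev v (X (i, b) + cst (m (i, b)))" by simp
    then have "(v + m) (i, p) = (v + m) (i, b)"
      by (simp add: ev_hom(1)[where A = UNIV] polys_closed ev_hom)
    then show False using b memC[of b] p(2) by simp
  qed
  have N: "?N \<in> polys IX"
    using CI[OF p(1)] row_sub[OF i(4)] by (intro polys_prod polys_closed_derived polys_closed) auto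
  have eq: "H * (\<Sum>j\<in>?C. term_at lam e i' i m f j) = dd_word ?us (h * ?N * sh (m + unit_shift e (i, p)) f)" if f: "f \<in> bRR" for f
  proof -
    have "H * (\<Sum>j=p..p + n. term_at lam e i' i m f j) = dd_word ?us (H * ?N / ?D * sh (m + unit_shift e (i, p)) f)"
    proof (rule block_sum[where m = m, OF i(1-3) sub same(2) _ f])
      fix g assume g: "g \<in> G_under k lam" "\<And>a. a \<notin> Pair i ` {p..p + n} \<Longrightarrow> g a = a"
      have inj: "inj g" using G_props(1)[OF G_under_G[OF g(1)]] bij_is_inj by blast
      have "v (g a) = v a" for a
      proof (cases "a \<in> Pair i ` {p..p + n}")
        case True
        have "g a \<in> Pair i ` {p..p + n}" by (rule support_closed[OF inj g(2) True])
        then obtain j1 j2 where "a = (i, j1)" "j1 \<in> {p..p + n}" "g a = (i, j2)" "j2 \<in> {p..p + n}" using True by blast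
        then show ?thesis using same(1)[of j1] same(1)[of j2] by simp
      qed (simp add: g(2))
      then have "g \<in> W" using g by (simp add: stab_iff fun_eq_iff)
      then show "act g H = H" by (rule H(2))
    qed
    also have "H * ?N / ?D = h * ?N" using Dne h(2) by simp
    finally show ?thesis unfolding C .
  qed
  show "H * (\<Sum>j\<in>?C. term_at lam e i' i m f j) \<in> polys IX" if "f \<in> bRR"
    unfolding eq[OF that] using us polys_closed(4)[OF polys_closed(4)[OF h(1) N] sh_polys[OF bR_polys[OF that]]] by (rule dd_word_IX[rotated])
  have "restr k lam (\<lambda>f. ev v (dd_word ws (H * (\<Sum>j\<in>?C. term_at lam e i' i m f j)))) = word_functional (ws @ ?us) (h * ?N) (m + unit_shift e (i, p))"
    unfolding word_functional_def by (rule restr_cong) (simp only: eq dd_word_append)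
  moreover have "m + unit_shift e (i, p) \<in> Sh"
    using m(1) e CI[OF p(1)] i by (auto simp: shifts_def unit_shift_def)
  moreover have "ws @ ?us \<in> lists SV" using ws us by simp
  ultimately show "restr k lam (\<lambda>f. ev v (dd_word ws (H * (\<Sum>j\<in>?C. term_at lam e i' i m f j)))) \<in> M k lam v"
    using word_functional_mem polys_closed(4)[OF h(1) N] by simp
qed

text \<open>The product \<open>H\<^sub>0\<close> of all differences between indices in different blocks of \<open>v + m\<close> is
  nonzero at \<open>v\<close> and divisible by the needed denominators; its \<open>W\<close>-norm is invariant in addition.\<close>
lemma exists_denominator:
  assumes m: "m \<in> Sh" and i: "1 \<le> i" "i < k"
  shows "\<exists>H\<in>polys IX. (\<forall>g\<in>W. act g H = H) \<and> ev v H \<noteq> 0 \<and> (\<forall>p\<in>{1..lam i}. \<exists>h\<in>polys IX.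
    H = h * (\<Prod>b\<in>{b\<in>{1..lam i}. (v + m) (i, b) \<noteq> (v + m) (i, p)}. (X (i, p) + cst (m (i, p))) - (X (i, b) + cst (m (i, b)))))"
proof -
  let ?f = "\<lambda>a b. (X (i, a) + cst (m (i, a))) - (X (i, b) + cst (m (i, b)))"
  let ?C = "\<lambda>p. {b\<in>{1..lam i}. (v + m) (i, b) \<noteq> (v + m) (i, p)}"
  define D where "D = (\<lambda>p. \<Prod>b\<in>?C p. ?f p b)"
  define H0 where "H0 = (\<Prod>p\<in>{1..lam i}. D p)"
  define H where "H = (\<Prod>g\<in>W. act g H0)"
  have CI: "(i, j) \<in> IX" if "j \<in> {1..lam i}" for j using that i by (auto simp: I_def)
  have finW: "finite W" using finite_G_under by (rule rev_finite_subset) (auto simp: stab_def)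
  have fRA: "?f a b \<in> polys IX" if "a \<in> {1..lam i}" "b \<in> {1..lam i}" for a b
    using CI[OF that(1)] CI[OF that(2)] by (intro polys_closed polys_closed_derived)
  have fev: "ev v (?f a b) = (v + m) (i, a) - (v + m) (i, b)" for a b
    by (simp add: ev_hom_derived(3)[where A = UNIV] ev_hom(1)[where A = UNIV] polys_closed ev_hom)
  have DRA: "D p \<in> polys IX" if "p \<in> {1..lam i}" for p
    unfolding D_def by (rule polys_prod) (use that fRA in auto)
  have Dev: "ev v (D p) \<noteq> 0" if p: "p \<in> {1..lam i}" for p
  proof -
    have "ev v (D p) = (\<Prod>b\<in>?C p. ev v (?f p b))"
      unfolding D_def by (rule ev_prod[where A = IX]) (use p fRA in auto)
    then show ?thesis unfolding fev by auto
  qed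
  have H0: "H0 \<in> polys IX" unfolding H0_def by (rule polys_prod[OF DRA])
  have H0ev: "ev v H0 \<noteq> 0" unfolding H0_def using ev_prod[where A = IX, OF DRA, of "{1..lam i}"] Dev by simp
  have aRA: "act g H0 \<in> polys IX" if "g \<in> W" for g
    by (rule act_polys[OF stab_bij[OF that] H0]) (simp add: G_props(3)[OF stab_G[OF that]])
  have aev: "ev v (act g H0) = ev v H0" if "g \<in> W" for g
    using ev_act[OF stab_bij[OF that] H0, of v] that by (simp add: stab_iff)
  have H: "H \<in> polys IX" unfolding H_def by (rule polys_prod[OF aRA])
  have Hev: "ev v H \<noteq> 0"
    unfolding H_def using ev_prod[where A = IX, OF aRA, of W] aev H0ev finW by simp
  have Hinv: "act g H = H" if g: "g \<in> W" for g
  proof -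
    have "act g H = (\<Prod>h\<in>W. act (g \<circ> h) H0)"
      unfolding H_def endo_prod[OF act_hom[OF stab_bij[OF g]]]
      by (rule prod.cong) (use act_comp stab_bij g in auto)
    also have "\<dots> = (\<Prod>h\<in>W. act h H0)"
    proof (rule prod.reindex_bij_betw[where h = "(\<circ>) g" and g = "\<lambda>h. act h H0"])
      show "bij_betw ((\<circ>) g) W W"
        by (rule bij_betw_byWitness[where f' = "(\<circ>) (inv g)"])
          (use g stab_comp stab_inv stab_bij[OF g] in \<open>auto simp: fun_eq_iff bij_is_inj bij_is_surj surj_f_inv_f\<close>)
    qed
    finally show ?thesis by (simp add: H_def)
  qed
  have "\<exists>h\<in>polys IX. H = h * D p" if p: "p \<in> {1..lam i}" for p
  proof
    have "H = act id H0 * (\<Prod>g\<in>W - {id}. act g H0)"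
      unfolding H_def by (rule prod.remove[OF finW stab_id])
    moreover have "act id H0 = D p * (\<Prod>q\<in>{1..lam i} - {p}. D q)"
      unfolding act_id id_apply H0_def by (rule prod.remove) (use p in auto)
    ultimately show "H = ((\<Prod>q\<in>{1..lam i} - {p}. D q) * (\<Prod>g\<in>W - {id}. act g H0)) * D p"
      by (simp only: mult_ac)
    show "(\<Prod>q\<in>{1..lam i} - {p}. D q) * (\<Prod>g\<in>W - {id}. act g H0) \<in> polys IX"
      by (intro polys_closed(4) polys_prod) (auto intro: DRA aRA)
  qed
  then show ?thesis using H Hinv Hev unfolding D_def by blast
qed

text \<open>An invariant factor commutes with the divided differences and contributes its value at \<open>v\<close>,
  so multiplying by \<open>H\<close> changes the functional by a nonzero scalar. After that, the sum splits
  into blocks.\<close>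
lemma shift_op_functional:
  assumes m: "m \<in> Sh" "dominant m" and ws: "ws \<in> lists SV"
    and i: "1 \<le> i" "i < k" "i' \<noteq> i" "i' \<le> k" and e: "e \<in> \<int>"
  shows "restr k lam (\<lambda>f. ev v (dd_word ws (sh m (shift_op lam e i' i f)))) \<in> M k lam v"
proof -
  obtain H where H: "H \<in> polys IX" "\<And>g. g \<in> W \<Longrightarrow> act g H = H" "ev v H \<noteq> 0"
    and div: "\<And>p. p \<in> {1..lam i} \<Longrightarrow> \<exists>h\<in>polys IX.
    H = h * (\<Prod>b\<in>{b\<in>{1..lam i}. (v + m) (i, b) \<noteq> (v + m) (i, p)}. (X (i, p) + cst (m (i, p))) - (X (i, b) + cst (m (i, b))))"
    using exists_denominator[OF m(1) i(1,2)] by blast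
  let ?Y = "(\<lambda>j. (v + m) (i, j)) ` {1..lam i}"
  let ?S = "\<lambda>f y. \<Sum>j\<in>{j\<in>{1..lam i}. (v + m) (i, j) = y}. term_at lam e i' i m f j"
  have sRA: "sh m (shift_op lam e i' i f) \<in> polys IX" if "f \<in> bRR" for f
    using shift_op_bR[OF i that] by (intro sh_polys bR_polys)
  have step: "ev v (dd_word ws (sh m (shift_op lam e i' i f))) = 1 / ev v H * ev v (dd_word ws (H * sh m (shift_op lam e i' i f)))" if f: "f \<in> bRR" for f
  proof -
    have "dd_word ws (H * sh m (shift_op lam e i' i f)) = H * dd_word ws (sh m (shift_op lam e i' i f))"
      by (rule dd_word_inv_mult) (use ws H(2) stab_simples_stab in auto)
    then show ?thesis using H ev_hom(2)[OF H(1) dd_word_IX[OF sRA[OF f] ws], of v] by simp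
  qed
  have sum: "H * sh m (shift_op lam e i' i f) = (\<Sum>y\<in>?Y. H * ?S f y)" for f
    unfolding sh_shift_op[OF i(1)] by (subst sum.image_gen[of "{1..lam i}" _ "\<lambda>j. (v + m) (i, j)"]) (simp_all add: sum_distrib_left)
  note block = block_functional[OF m i e H(1) H(2) div]
  have "restr k lam (\<lambda>f. ev v (dd_word ws (sh m (shift_op lam e i' i f))))
    = restr k lam (\<lambda>f. 1 / ev v H * (\<Sum>y\<in>?Y. ev v (dd_word ws (H * ?S f y))))"
  proof (rule restr_cong)
    fix f assume f: "f \<in> bRR"
    have "ev v (\<Sum>y\<in>?Y. dd_word ws (H * ?S f y)) = (\<Sum>y\<in>?Y. ev v (dd_word ws (H * ?S f y)))"
      by (rule ev_sum[where A = IX]) (rule dd_word_IX[OF block(2)[OF _ _ ws _ f] ws]; blast)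
    then show "ev v (dd_word ws (sh m (shift_op lam e i' i f))) = 1 / ev v H * (\<Sum>y\<in>?Y. ev v (dd_word ws (H * ?S f y)))"
      unfolding step[OF f] sum dd_word_sum by simp
  qed
  also have "\<dots> = fscale (1 / ev v H) (\<Sum>y\<in>?Y. restr k lam (\<lambda>f. ev v (dd_word ws (H * ?S f y))))"
    unfolding restr_scale restr_sum ..
  also have "\<dots> \<in> M k lam v"
    by (intro M_scale M_sum) (rule block(1)[OF _ _ ws]; blast)
  finally show ?thesis .
qed

lemma generator_stable:
  assumes op: "\<And>f. f \<in> bRR \<Longrightarrow> op f \<in> bRR"
    and B: "\<And>m ws. m \<in> Sh \<Longrightarrow> dominant m \<Longrightarrow> ws \<in> lists SV \<Longrightarrow> restr k lam (\<lambda>f. ev v (dd_word ws (sh m (op f)))) \<in> M k lam v"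
    and l: "l \<in> M k lam v"
  shows "right_act k lam l (restrict op (Omega k lam)) \<in> M k lam v"
proof -
  have eq: "right_act k lam l (restrict op (Omega k lam)) = restr k lam (\<lambda>f. l (op f))" for l
    unfolding right_act_def by (rule restr_cong) (use bR_Omega in auto)
  show ?thesis
    unfolding eq using l unfolding M_def
  proof (induction rule: functional.span_induct)
    case base
    have "restr k lam (\<lambda>f. (l + l') (op f)) = restr k lam (\<lambda>f. l (op f)) + restr k lam (\<lambda>f. l' (op f))" for l l'
      by (simp add: restr_add)
    moreover have "restr k lam (\<lambda>f. fscale c l (op f)) = fscale c (restr k lam (\<lambda>f. l (op f)))" for c l
      unfolding restr_scale[symmetric] by (simp add: fscale_def)
    ultimately show ?case using M_add M_scale M_zero
      by (simp add: functional.subspace_def M_def restr_zero)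
  next
    case (step l)
    then obtain ws m where *: "m \<in> Sh" "dominant m" "ws \<in> lists SV" "l = word_functional ws 1 m"
      unfolding B_under_eq by blast
    have "restr k lam (\<lambda>f. l (op f)) = restr k lam (\<lambda>f. ev v (dd_word ws (sh m (op f))))"
      by (rule restr_cong) (use op in \<open>simp add: * word_functional_def restr_def\<close>)
    then show ?case using B[OF *(1-3)] by (simp add: M_def)
  qed
qed

lemma bR_OmegaD: "f \<in> bRR \<Longrightarrow> f \<in> Omega k lam"
  using bR_Omega by blast

text \<open>The claim of \<open>M_right_closed\<close> for a generator, reduced to the functionals that span \<open>M\<close>.\<close>
lemma generatorI:
  assumes "\<And>f. f \<in> bRR \<Longrightarrow> op f \<in> bRR"
    and "\<And>m ws. m \<in> Sh \<Longrightarrow> dominant m \<Longrightarrow> ws \<in> lists SV \<Longrightarrow> restr k lam (\<lambda>f. ev v (dd_word ws (sh m (op f)))) \<in> M k lam v"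
  shows "(\<forall>f\<in>bRR. restrict op (Omega k lam) f \<in> bRR) \<and> (\<forall>l\<in>M k lam v. right_act k lam l (restrict op (Omega k lam)) \<in> M k lam v)"
proof (intro conjI ballI)
  fix f assume "f \<in> bRR"
  then show "restrict op (Omega k lam) f \<in> bRR" using assms(1) bR_OmegaD by simp
qed (rule generator_stable[OF assms])

lemma gamma_functional:
  assumes "a \<in> IX" "m \<in> Sh" "ws \<in> lists SV"
  shows "restr k lam (\<lambda>f. ev v (dd_word ws (sh m (op_gamma lam a f)))) \<in> M k lam v"
proof -
  have "fst a \<le> k" using assms by (auto simp: I_def)
  then have "sh m (elem_sym (row lam (fst a)) (snd a)) \<in> polys IX" by (intro sh_polys elem_sym_polys)
  from word_functional_mem[OF assms(2,3) this] show ?thesis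
    by (simp add: word_functional_def op_gamma_def endoD(2)[OF sh_hom])
qed

lemma M_linear:
  assumes "l \<in> M k lam v" "f \<in> bRR" "f' \<in> bRR"
  shows "l (f + f') = l f + l f'" "l (cst c * f) = c * l f"
proof -
  have bR: "f + f' \<in> bRR" "cst c * f \<in> bRR"
    using assms by (auto simp: bR_iff polys_closed endoD[OF act_hom[OF G_props(1)]])
  have "l (f + f') = l f + l f' \<and> l (cst c * f) = c * l f"
    using assms(1) unfolding M_def
  proof (induction rule: functional.span_induct)
    case base
    then show ?case by (auto simp: functional.subspace_def fscale_def algebra_simps)
  next
    case (step l)
    then obtain ws m where *: "ws \<in> lists SV" "l = word_functional ws 1 m"
      unfolding B_under_eq by blast
    have "dd_word ws (sh m f) \<in> polys IX" "dd_word ws (sh m f') \<in> polys IX"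
      using assms * by (intro dd_word_IX sh_polys bR_polys; blast)+
    then show ?case using assms(2,3) bR
      by (simp add: * word_functional_def restr_def endoD[OF sh_hom] dd_word_linear ev_hom(1)[where A = IX] ev_hom(2)[where A = IX] ev_hom(3) polys_closed)
  qed
  then show "l (f + f') = l f + l f'" "l (cst c * f) = c * l f" by auto
qed

text \<open>Stability of the invariants is carried along in the induction: for a product the right
  action can be applied twice only because the inner operator maps invariants to invariants.\<close>
lemma M_right_closed:
  assumes "u \<in> U k lam"
  shows "(\<forall>f\<in>bRR. u f \<in> bRR) \<and> (\<forall>l\<in>M k lam v. right_act k lam l u \<in> M k lam v)"
  using assms
proof (induction rule: U.induct)
  case (U_E i)
  have op: "opE lam i f \<in> bRR" if "f \<in> bRR" for f
    unfolding opE_shift_op[OF U_E(1)] by (rule shift_op_bR) (use U_E that in auto)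
  have "restr k lam (\<lambda>f. ev v (dd_word ws (sh m (opE lam i f)))) \<in> M k lam v" if "m \<in> Sh" "dominant m" "ws \<in> lists SV" for m ws
    unfolding opE_shift_op[OF U_E(1)] by (rule shift_op_functional) (use that U_E in auto)
  then show ?case using op by (intro generatorI)
next
  case (U_F i)
  have op: "opF lam i f \<in> bRR" if "f \<in> bRR" for f
    unfolding opF_shift_op[OF U_F(1)] by (rule shift_op_bR) (use U_F that in auto)
  have "restr k lam (\<lambda>f. ev v (dd_word ws (sh m (opF lam i f)))) \<in> M k lam v" if "m \<in> Sh" "dominant m" "ws \<in> lists SV" for m ws
    unfolding opF_shift_op[OF U_F(1)] by (rule shift_op_functional) (use that U_F in auto)
  then show ?case using op by (intro generatorI)
next
  case (U_gamma a)
  then show ?case by (intro generatorI op_gamma_bR gamma_functional)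
next
  case U_one
  have "right_act k lam l (restrict id (Omega k lam)) = l" if "l \<in> M k lam v" for l
  proof -
    have "l f = 0" if "f \<notin> bRR" for f
      using \<open>l \<in> M k lam v\<close> unfolding M_def
    proof (induction rule: functional.span_induct)
      case base
      then show ?case by (simp add: functional.subspace_def fscale_def)
    next
      case (step l)
      then show ?case using that unfolding B_under_eq by (auto simp: word_functional_def restr_def)
    qed
    then show ?thesis using bR_OmegaD by (auto simp: right_act_def restr_def fun_eq_iff)
  qed
  then have "\<forall>l\<in>M k lam v. right_act k lam l (restrict id (Omega k lam)) \<in> M k lam v" by metis
  moreover have "\<forall>f\<in>bRR. restrict id (Omega k lam) f \<in> bRR" by (simp add: bR_OmegaD)
  ultimately show ?case by blast
next
  case (U_add u u')
  have eq: "right_act k lam l (\<lambda>f\<in>Omega k lam. u f + u' f) = right_act k lam l u + right_act k lam l u'" if "l \<in> M k lam v" for l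
    unfolding right_act_def restr_add[symmetric]
    by (rule restr_cong) (use M_linear(1)[OF that] U_add.IH bR_OmegaD in auto)
  have mem: "(\<lambda>f\<in>Omega k lam. u f + u' f) f \<in> bRR" if "f \<in> bRR" for f
  proof -
    have "u f \<in> bRR" "u' f \<in> bRR" using U_add.IH that by auto
    then have "u f + u' f \<in> bRR" by (auto simp: bR_iff polys_closed endoD(1)[OF act_hom[OF G_props(1)]])
    then show ?thesis using that bR_OmegaD by auto
  qed
  show ?case
  proof (intro conjI ballI)
    fix l assume l: "l \<in> M k lam v"
    show "right_act k lam l (\<lambda>f\<in>Omega k lam. u f + u' f) \<in> M k lam v"
      unfolding eq[OF l] by (rule M_add) (use U_add.IH l in blast)+
  qed (rule mem)
next
  case (U_scale u c)
  have eq: "right_act k lam l (\<lambda>f\<in>Omega k lam. incl (Const c) * u f) = fscale c (right_act k lam l u)" if "l \<in> M k lam v" for l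
    unfolding right_act_def restr_scale[symmetric]
    by (rule restr_cong) (use M_linear(2)[OF that] U_scale.IH bR_OmegaD in \<open>auto simp flip: cst_def\<close>)
  have mem: "(\<lambda>f\<in>Omega k lam. incl (Const c) * u f) f \<in> bRR" if "f \<in> bRR" for f
  proof -
    have "u f \<in> bRR" using U_scale.IH that by auto
    then have "cst c * u f \<in> bRR" by (auto simp: bR_iff polys_closed endoD(2,3)[OF act_hom[OF G_props(1)]])
    then show ?thesis using that bR_OmegaD by (auto simp: cst_def)
  qed
  show ?case
  proof (intro conjI ballI)
    fix l assume l: "l \<in> M k lam v"
    show "right_act k lam l (\<lambda>f\<in>Omega k lam. incl (Const c) * u f) \<in> M k lam v"
      unfolding eq[OF l] by (rule M_scale) (use U_scale.IH l in blast)
  qed (rule mem)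
next
  case (U_mult u u')
  have eq: "right_act k lam l (compose (Omega k lam) u u') = right_act k lam (right_act k lam l u) u'" for l
    unfolding right_act_def[of k lam _ u'] right_act_def[of k lam _ "compose (Omega k lam) u u'"]
    by (rule restr_cong) (use U_mult.IH bR_OmegaD in \<open>auto simp: compose_def right_act_def restr_def\<close>)
  have mem: "compose (Omega k lam) u u' f \<in> bRR" if "f \<in> bRR" for f
    using U_mult.IH that bR_OmegaD by (auto simp: compose_def)
  show ?case
  proof (intro conjI ballI)
    fix l assume l: "l \<in> M k lam v"
    show "right_act k lam l (compose (Omega k lam) u u') \<in> M k lam v"
      unfolding eq using U_mult.IH l by blast
  qed (rule mem)
qed

text \<open>A descent \<open>s\<close> in the stabilizer of \<open>v + m\<close> makes \<open>\<partial>\<^sub>s\<close> the innermost divided difference, and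
  the shifted function is invariant under \<open>s\<close>.\<close>
lemma B_under_cases:
  assumes "l \<in> B_under k lam v"
  shows "l \<in> B k lam v \<or> l = 0"
proof -
  obtain ws m where *: "m \<in> Sh" "dominant m" "ws \<in> lists SV" "reduced k lam ws" "l = word_functional ws 1 m"
    using assms unfolding B_under_eq by blast
  let ?w = "word_prod ws"
  show ?thesis
  proof (cases "?w \<in> shortest_reps k lam W (stab k lam (v + m))")
    case True
    then show ?thesis using * unfolding B_eq by blast
  next
    case False
    have wW: "?w \<in> W" by (rule word_prod_stab) fact
    obtain s where s: "s \<in> stab_simples k lam (v + m)" "descent ?w s"
      using not_shortest_descent[OF interval_blocks_shift[OF *(1,2)] wW False] by blast
    have sS: "s \<in> simple k lam" using s by (simp add: stab_simples_def)
    note wG = stab_G[OF wW]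
    have rG: "simple_refl s \<in> G k lam" by (rule simple_refl_G[OF sS])
    obtain c where c: "reduced k lam c" "word_prod c = ?w \<circ> simple_refl s"
      using exists_red[OF G_comp[OF wG rG]] by blast
    have "reduced k lam (c @ [s])" using reduced_snoc[OF sS, of c] c s descent_comp[OF wG] by simp
    then have dd: "dd_word ws f = dd_word (c @ [s]) f" for f
      by (rule dd_word_unique[OF *(4)]) (simp add: word_prod_snoc c comp_assoc)
    have "(v + m) (next_idx s) = (v + m) s" "fst s < k" using s by (auto simp: stab_simples_def)
    then have ms: "m (next_idx s) = m s"
      using shift_eqD(2)[OF *(1), of "next_idx s" s] simple_in_I[OF sS] by simp
    then have mr: "m \<circ> simple_refl s = m"
      by (auto simp: fun_eq_iff simple_refl_def transpose_def)
    have "dd_word ws (sh m f) = 0" if "f \<in> bRR" for f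
    proof -
      have "act (simple_refl s) (sh m f) = sh m f"
        using act_sh_bR[OF that rG, of m] mr by simp
      then show ?thesis by (simp add: dd dd_word_append dd_simple_inv dd_word_linear)
    qed
    then have "l = restr k lam (\<lambda>f. 0)"
      unfolding *(5) word_functional_def by (intro restr_cong) (simp add: ev_hom_derived)
    then show ?thesis by (simp add: restr_zero)
  qed
qed

lemma span_B: "functional.span (B k lam v) = M k lam v"
proof
  have "B k lam v \<subseteq> B_under k lam v" unfolding B_eq B_under_eq by blast
  then show "functional.span (B k lam v) \<subseteq> M k lam v" unfolding M_def by (rule functional.span_mono)
  have "B_under k lam v \<subseteq> functional.span (B k lam v)"
    using B_under_cases functional.span_base functional.span_zero by blast
  then show "M k lam v \<subseteq> functional.span (B k lam v)"
    unfolding M_def by (intro functional.span_minimal functional.subspace_span)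
qed

end

section \<open>A linear form with positive divided differences\<close>

lemma word_prod_bij: "bij (word_prod ws)"
proof (induction ws)
  case (Cons s ws)
  then show ?case unfolding word_prod_simps by (intro bij_comp bij_simple_refl)
qed (simp only: word_prod_simps bij_id)

lemma word_prod_rev: "word_prod (rev ws) = inv (word_prod ws)"
proof (induction ws)
  case Nil
  then show ?case by (simp only: rev.simps word_prod_simps inv_id)
next
  case (Cons s ws)
  have "inv (simple_refl s \<circ> word_prod ws) = inv (word_prod ws) \<circ> inv (simple_refl s)"
    by (rule o_inv_distrib) (auto simp: word_prod_bij)
  moreover have "inv (simple_refl s) = simple_refl s" by (rule inv_unique_comp) (simp_all only: simple_refl_sq)
  ultimately show ?case using Cons by (simp only: rev.simps word_prod_snoc word_prod_simps)
qed

lemma cst_sum: "cst (\<Sum>a\<in>S. f a) = (\<Sum>a\<in>S. cst (f a))"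
  by (induction S rule: infinite_finite_induct) (simp_all add: cst_hom)

context
  fixes k :: nat and lam :: "nat \<Rightarrow> nat"
begin

text \<open>The variables that the shift group moves.\<close>
definition shifted_I :: "idx set" where "shifted_I = {a \<in> I k lam. fst a < k}"

lemma G_under_outside: "g \<in> G_under k lam \<Longrightarrow> a \<notin> shifted_I \<Longrightarrow> g a = a"
  using G_under_fix[of g k lam a] by (cases "a \<in> I k lam") (auto simp: shifted_I_def G_under_def G_def permutes_not_in)

definition shifted_simples :: "idx set" where "shifted_simples = {s \<in> simple k lam. fst s < k}"

lemma shifted_I_sub: "shifted_I \<subseteq> I k lam" and finite_shifted_I: "finite shifted_I"
  using finite_I by (auto simp: shifted_I_def)

lemma shifted_simples_shifted_I: "s \<in> shifted_simples \<Longrightarrow> s \<in> shifted_I \<and> next_idx s \<in> shifted_I"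
  using simple_in_I by (auto simp: shifted_simples_def shifted_I_def)

text \<open>A linear form that takes positive values on the positive coroots of the rows \<open>i < k\<close>.\<close>
definition weight :: ratfun where
  "weight = - (\<Sum>a\<in>shifted_I. cst (of_nat (snd a)) * X a)"

lemma weight_polys: "weight \<in> polys shifted_I"
  unfolding weight_def by (intro polys_closed_derived(3) polys_sum polys_closed)

text \<open>The value of \<open>weight\<close> on the coroot \<open>g\<^sup>-\<^sup>1 \<alpha>\<^sub>s\<close>; it is positive exactly if \<open>s g\<close> is longer
  than \<open>g\<close>.\<close>
definition weight_jump :: "idx \<Rightarrow> (idx \<Rightarrow> idx) \<Rightarrow> real" where
  "weight_jump s g = real (snd (inv g (next_idx s))) - real (snd (inv g s))"

lemma dd_simple_act_weight:
  assumes g: "g \<in> G k lam" and s: "s \<in> shifted_simples"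
  shows "dd_simple s (act g weight) = cst (of_real (weight_jump s g))"
proof -
  note b = G_props(1)[OF g]
  have gi: "g a = c \<longleftrightarrow> a = inv g c" for a c
    using b by (metis bij_inv_eq_iff)
  let ?f = "\<lambda>a. of_nat (snd a) * (if g a = s then 1 else if g a = next_idx s then -1 else 0) :: complex"
  have neg: "dd_simple s (- f) = - dd_simple s f" for f
    using dd_simple_linear(2)[of s "-1" f] by (simp add: cst_minus cst_hom)
  have "dd_simple s (act g weight) = - (\<Sum>a\<in>shifted_I. cst (of_nat (snd a)) * dd_simple s (X (g a)))"
    by (simp add: weight_def endoD[OF act_hom[OF b]] endo_sum[OF act_hom[OF b]] act_X[OF b] neg dd_simple_sum dd_simple_linear)
  also have "\<dots> = cst (- (\<Sum>a\<in>shifted_I. ?f a))"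
    unfolding dd_simple_X cst_minus cst_sum cst_hom ..
  also have "(\<Sum>a\<in>shifted_I. ?f a) = (\<Sum>a\<in>{inv g s, inv g (next_idx s)}. ?f a)"
  proof (rule sum.mono_neutral_right)
    have "inv g a \<in> shifted_I" if "a \<in> shifted_I" for a
      using that G_props(2,3)[OF G_inv[OF g], of a] by (auto simp: shifted_I_def)
    then show "{inv g s, inv g (next_idx s)} \<subseteq> shifted_I" using shifted_simples_shifted_I[OF s] by blast
  qed (auto simp: finite_shifted_I gi)
  also have "\<dots> = of_nat (snd (inv g s)) - of_nat (snd (inv g (next_idx s)))"
  proof -
    have ne: "inv g s \<noteq> inv g (next_idx s)"
      using bij_imp_bij_inv[OF b] next_idx_neq[of s] by (metis bij_is_inj injD)
    have e: "g (inv g s) = s" "g (inv g (next_idx s)) = next_idx s" using b by (simp_all add: bij_is_surj surj_f_inv_f)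
    show ?thesis using ne e next_idx_neq[of s] by (subst sum.insert) auto
  qed
  finally show ?thesis by (simp add: weight_jump_def)
qed

text \<open>A Chevalley type formula, in the raw form given by the Leibniz rule: either no letter of the
  word hits the linear form, or exactly one does, which turns it into a constant and disappears
  from the word.\<close>
lemma dd_word_weight_mult:
  assumes "ws \<in> lists shifted_simples"
  shows "dd_word ws (weight * q) = act (word_prod ws) weight * dd_word ws q
    + (\<Sum>i<length ws. cst (of_real (weight_jump (ws ! i) (word_prod (drop (Suc i) ws)))) * dd_word (take i ws @ drop (Suc i) ws) q)"
  using assms
proof (induction ws rule: list.induct)
  case Nil
  then show ?case unfolding word_prod_simps act_id by simp
next
  case (Cons s ws)
  have s: "s \<in> shifted_simples" and ws: "ws \<in> lists shifted_simples" using Cons.prems by (simp_all add: in_lists_conv_set)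
  have W: "word_prod ws \<in> G k lam" by (rule word_prod_G) (use ws in \<open>auto simp: shifted_simples_def\<close>)
  have "dd_word (s # ws) (weight * q) = dd_simple s (act (word_prod ws) weight * dd_word ws q)
    + (\<Sum>i<length ws. cst (of_real (weight_jump (ws ! i) (word_prod (drop (Suc i) ws)))) * dd_simple s (dd_word (take i ws @ drop (Suc i) ws) q))"
    using Cons.IH[OF ws] by (simp add: dd_simple_linear dd_simple_sum)
  also have "dd_simple s (act (word_prod ws) weight * dd_word ws q)
    = cst (of_real (weight_jump s (word_prod ws))) * dd_word ws q + act (word_prod (s # ws)) weight * dd_word (s # ws) q"
    unfolding dd_simple_mult dd_simple_act_weight[OF W s] by (simp add: act_comp word_prod_bij)
  finally show ?case
    by (simp only: length_Cons sum.lessThan_Suc_shift nth_Cons_0 nth_Cons_Suc drop_Suc_Cons drop_0 take_Suc_Cons take_0 append_Nil append_Cons dd_word_simps)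
      (simp only: add_ac)
qed

text \<open>Divided differences lower the degree.\<close>
lemma dd_word_weight_power_zero:
  "ws \<in> lists shifted_simples \<Longrightarrow> n < length ws \<Longrightarrow> dd_word ws (weight ^ n) = 0"
proof (induction n arbitrary: ws)
  case 0
  then obtain us s where ws: "ws = us @ [s]" by (cases ws rule: rev_cases) auto
  have "dd_simple s 1 = 0" using dd_simple_cst[of s 1] by (simp add: cst_hom)
  then show ?case by (simp add: ws dd_word_append dd_word_linear)
next
  case (Suc n)
  have "dd_word ws (weight ^ n) = 0" using Suc.IH[OF Suc.prems(1)] Suc.prems(2) by simp
  moreover have "dd_word (take i ws @ drop (Suc i) ws) (weight ^ n) = 0" if "i < length ws" for i
    by (rule Suc.IH) (use Suc.prems that in \<open>auto dest: in_set_takeD in_set_dropD\<close>)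
  ultimately show ?case unfolding power_Suc dd_word_weight_mult[OF Suc.prems(1)] by simp
qed

lemma reduced_Cons:
  assumes "reduced k lam (s # ws)"
  shows "reduced k lam ws" "weight_jump s (word_prod ws) > 0"
proof -
  have rev: "reduced k lam (rev ws) \<longleftrightarrow> reduced k lam ws" for ws
  proof (cases "ws \<in> lists (simple k lam)")
    case True
    then show ?thesis using inv_num_inv[OF word_prod_G[OF True]] by (simp add: reduced_def word_prod_rev in_lists_conv_set)
  qed (auto simp: reduced_def)
  have S: "s \<in> simple k lam" using assms by (simp add: reduced_def)
  have r: "reduced k lam (rev ws)" "\<not> descent (word_prod (rev ws)) s"
    using assms rev[of "s # ws"] reduced_snoc[OF S, of "rev ws"] by auto
  show ws: "reduced k lam ws" using r rev by blast
  have W: "word_prod ws \<in> G k lam" using ws by (auto simp: reduced_def intro!: word_prod_G)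
  have "snd (inv (word_prod ws) s) \<noteq> snd (inv (word_prod ws) (next_idx s))"
    using G_neq[OF G_inv[OF W], of s "next_idx s"] next_idx_neq[of s] by simp
  then show "weight_jump s (word_prod ws) > 0"
    using r(2) unfolding word_prod_rev descent_def weight_jump_def by simp
qed

lemma reduced_drop: "reduced k lam ws \<Longrightarrow> reduced k lam (drop i ws)"
proof (induction i arbitrary: ws)
  case (Suc i)
  then show ?case using reduced_Cons(1) by (cases ws) auto
qed simp

text \<open>Deleting a letter from a reduced word contributes a positive coefficient times an
  inductively nonnegative constant, and deleting the first letter leaves a reduced word, whose
  constant is positive.\<close>
lemma dd_word_weight_power:
  "ws \<in> lists shifted_simples \<Longrightarrow> length ws = n \<Longrightarrow> \<exists>c\<ge>0. dd_word ws (weight ^ n) = cst (of_real c) \<and> (reduced k lam ws \<longrightarrow> c > 0)"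
proof (induction n arbitrary: ws)
  case 0
  then show ?case by (intro exI[of _ 1]) (simp add: cst_hom)
next
  case (Suc n)
  have S: "ws \<in> lists (simple k lam)" using Suc.prems by (auto simp: shifted_simples_def)
  show ?case
  proof (cases "reduced k lam ws")
    case False
    then show ?thesis using dd_word_nonreduced[OF S] by (intro exI[of _ 0]) (simp add: cst_hom)
  next
    case True
    let ?d = "\<lambda>i. take i ws @ drop (Suc i) ws"
    have "\<exists>c\<ge>0. dd_word (?d i) (weight ^ n) = cst (of_real c) \<and> (reduced k lam (?d i) \<longrightarrow> c > 0)" if "i < length ws" for i
      by (rule Suc.IH) (use Suc.prems that in \<open>auto dest: in_set_takeD in_set_dropD\<close>)
    then obtain c where c: "\<And>i. i < length ws \<Longrightarrow> c i \<ge> 0 \<and> dd_word (?d i) (weight ^ n) = cst (of_real (c i)) \<and> (reduced k lam (?d i) \<longrightarrow> c i > 0)"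
      by metis
    let ?k = "\<lambda>i. weight_jump (ws ! i) (word_prod (drop (Suc i) ws))"
    have kp: "?k i > 0" if "i < length ws" for i
    proof -
      have "reduced k lam (ws ! i # drop (Suc i) ws)" using reduced_drop[OF True, of i] Cons_nth_drop_Suc[OF that] by simp
      then show ?thesis by (rule reduced_Cons)
    qed
    have "dd_word ws (weight ^ n) = 0" by (rule dd_word_weight_power_zero) (use Suc.prems in auto)
    then have "dd_word ws (weight ^ Suc n) = (\<Sum>i<length ws. cst (of_real (?k i)) * cst (of_real (c i)))"
      unfolding power_Suc dd_word_weight_mult[OF Suc.prems(1)] using c by simp
    also have "\<dots> = cst (of_real (\<Sum>i<length ws. ?k i * c i))"
      by (simp add: cst_sum cst_hom)
    finally have eq: "dd_word ws (weight ^ Suc n) = cst (of_real (\<Sum>i<length ws. ?k i * c i))" .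
    have "(\<Sum>i<length ws. ?k i * c i) > 0"
    proof (rule sum_pos2[of _ 0])
      have "reduced k lam (drop (Suc 0) ws)" by (rule reduced_drop[OF True])
      then show "0 < ?k 0 * c 0" using kp[of 0] c[of 0] Suc.prems by simp
      show "0 \<le> ?k i * c i" if "i \<in> {..<length ws}" for i
        using kp[of i] c[of i] that by simp
    qed (use Suc.prems in auto)
    then show ?thesis using eq by (intro exI[of _ "\<Sum>i<length ws. ?k i * c i"]) simp
  qed
qed

lemma longest_bound:
  assumes c: "interval_blocks k lam c" and w0: "w0 \<in> stab k lam c" "\<And>s. s \<in> stab_simples k lam c \<Longrightarrow> descent w0 s"
    and ws: "reduced k lam ws" "ws \<in> lists (stab_simples k lam c)" "inv_num k lam w0 \<le> length ws"
  shows "word_prod ws = w0" "length ws = inv_num k lam w0"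
proof -
  obtain e where e: "e \<in> lists (stab_simples k lam c)" "reduced k lam (ws @ e)" "\<And>s. s \<in> stab_simples k lam c \<Longrightarrow> descent (word_prod (ws @ e)) s"
    using reduced_extend[OF ws(1)] by blast
  have "word_prod (ws @ e) \<in> stab k lam c" by (rule word_prod_stab) (use e ws in auto)
  then have eq: "word_prod (ws @ e) = w0" using longest_unique[OF c _ w0(1) e(3) w0(2)] by blast
  then have "length (ws @ e) = inv_num k lam w0" using e(2) by (simp add: reduced_def)
  then show "length ws = inv_num k lam w0" using ws(3) by simp
  then have "e = []" using \<open>length (ws @ e) = inv_num k lam w0\<close> by simp
  then show "word_prod ws = w0" using eq by simp
qed

text \<open>Every simple reflection of the stabilizer makes the longest word nonreduced, so its divided
  difference vanishes, which is invariance.\<close>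
lemma longest_invariant:
  assumes c: "interval_blocks k lam c" and r: "r \<in> lists (stab_simples k lam c)" "reduced k lam r" "\<And>s. s \<in> stab_simples k lam c \<Longrightarrow> descent (word_prod r) s"
    and g: "g \<in> stab k lam c"
  shows "act g (dd_word r q) = dd_word r q"
proof -
  have inv: "act (simple_refl s) (dd_word r q) = dd_word r q" if s: "s \<in> stab_simples k lam c" for s
  proof -
    have len: "inv_num k lam (word_prod r) = length r" using r by (simp add: reduced_def)
    have nr: "\<not> reduced k lam (s # r)"
    proof
      assume "reduced k lam (s # r)"
      from longest_bound(2)[OF c word_prod_stab[OF r(1)] r(3) this] r(1) s len show False by simp
    qed
    have "s # r \<in> lists (simple k lam)" using r(1) s by (auto simp: stab_simples_def)
    from dd_word_nonreduced[OF this nr] have "dd_simple s (dd_word r q) = 0" by simp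
    then show ?thesis by (simp add: dd_simple_eq0_iff)
  qed
  obtain ws where ws: "reduced k lam ws" "word_prod ws = g" using exists_red[OF stab_G[OF g]] by blast
  have "ws \<in> lists (stab_simples k lam c)" using reduced_stab[OF c ws(1)] ws g by simp
  then have "act (word_prod ws) (dd_word r q) = dd_word r q"
  proof (induction ws)
    case Nil
    then show ?case unfolding word_prod_simps act_id by simp
  next
    case (Cons s ws)
    then show ?case
      unfolding word_prod_simps act_comp[OF bij_simple_refl word_prod_bij, symmetric] using inv by simp
  qed
  then show ?thesis by (simp add: ws)
qed

lemma G_restrict:
  assumes g: "g \<in> G k lam"
  shows "(\<lambda>a. if fst a < k then g a else a) \<in> G_under k lam" (is "?g \<in> _")
proof -
  note b = G_props(1)[OF g]
  have gi: "fst (inv g a) = fst a" for a using G_props(2)[OF G_inv[OF g]] .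
  have "bij ?g"
    by (rule o_bij[where g = "\<lambda>a. if fst a < k then inv g a else a"])
      (use b in \<open>auto simp: fun_eq_iff G_props(2)[OF g] gi bij_is_inj bij_is_surj surj_f_inv_f\<close>)
  moreover have "?g a = a" if "a \<notin> I k lam" for a
    using g that by (auto simp: G_def permutes_not_in)
  ultimately have "?g permutes I k lam" unfolding permutes_def bij_iff by blast
  then have "?g \<in> G k lam" using G_props(2)[OF g] by (auto simp: G_def)
  then show ?thesis by (rule G_underI) simp
qed

end

section \<open>Linear independence\<close>

lemma sum_fun_app: "(\<Sum>b\<in>t. F b) x = (\<Sum>b\<in>t. F b x)" for F :: "'c \<Rightarrow> 'd \<Rightarrow> complex"
  by (induction t rule: infinite_finite_induct) auto

context maximal_stabilizer
begin

abbreviation "ILX \<equiv> shifted_I k lam"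

lemma SV_shifted_simples: "lists SV \<subseteq> lists (shifted_simples k lam)"
  by (auto simp: stab_simples_def shifted_simples_def)

lemma polys_shifted_I: "f \<in> polys ILX \<Longrightarrow> f \<in> polys IX"
  using polys_mono[OF shifted_I_sub] by blast

text \<open>Elements of \<open>G\<close> permute the last row as well, but on functions of the other variables they
  act through \<open>G_under\<close>. Averaging over the smaller group keeps the stabilizers that matter equal
  to those in the theorem.\<close>
lemma symmetrize_bR:
  assumes F: "F \<in> polys ILX"
  shows "(\<Sum>g\<in>G_under k lam. act g F) \<in> bRR"
  unfolding bR_iff
proof (intro conjI ballI)
  have aRA: "act g F \<in> polys IX" if "g \<in> G_under k lam" for g
    by (rule act_polys[OF G_props(1)[OF G_under_G[OF that]] polys_shifted_I[OF F]]) (simp add: G_props(3)[OF G_under_G[OF that]])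
  then show "(\<Sum>g\<in>G_under k lam. act g F) \<in> polys IX" by (rule polys_sum)
  fix h assume h: "h \<in> G k lam"
  define h' where "h' = (\<lambda>a. if fst a < k then h a else a)"
  have h': "h' \<in> G_under k lam" unfolding h'_def by (rule G_restrict[OF h])
  note b = G_props(1)[OF h] and b' = G_props(1)[OF G_under_G[OF h']]
  have eq: "act h (act g F) = act (h' \<circ> g) F" if g: "g \<in> G_under k lam" for g
  proof -
    note bg = G_props(1)[OF G_under_G[OF g]]
    have "act (h \<circ> g) F = act (h' \<circ> g) F"
    proof (rule endo_polys_eq[OF act_hom act_hom F])
      fix a assume "a \<in> ILX"
      then have "fst (g a) < k" using G_props(2)[OF G_under_G[OF g]] by (simp add: shifted_I_def)
      then show "act (h \<circ> g) (X a) = act (h' \<circ> g) (X a)"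
        using b b' bg by (simp add: act_X bij_comp h'_def)
    qed (use b b' bg bij_comp in blast)+
    then show ?thesis using b bg by (simp add: act_comp)
  qed
  have "act h (\<Sum>g\<in>G_under k lam. act g F) = (\<Sum>g\<in>G_under k lam. act (h' \<circ> g) F)"
    unfolding endo_sum[OF act_hom[OF b]] by (rule sum.cong[OF refl eq])
  also have "\<dots> = (\<Sum>g\<in>G_under k lam. act g F)"
  proof (rule sum.reindex_bij_betw[where h = "(\<circ>) h'" and g = "\<lambda>g. act g F"])
    show "bij_betw ((\<circ>) h') (G_under k lam) (G_under k lam)"
      by (rule bij_betw_byWitness[where f' = "(\<circ>) (inv h')"])
        (use h' G_under_comp G_under_inv b' in \<open>auto simp: fun_eq_iff bij_is_inj bij_is_surj surj_f_inv_f\<close>)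
  qed
  finally show "act h (\<Sum>g\<in>G_under k lam. act g F) = (\<Sum>g\<in>G_under k lam. act g F)" .
qed

text \<open>A permutation that carries one point of the orbit of \<open>v\<close> to another moves each value of \<open>v\<close>
  by an integer, so it fixes \<open>v\<close>.\<close>
lemma shift_perm_eq:
  assumes m: "m \<in> Sh" "m' \<in> Sh" and g: "g \<in> G_under k lam" and eq: "(v + m) \<circ> g = v + m'"
  shows "g \<in> W" "m \<circ> g = m'"
proof -
  have vg: "v (g a) = v a" for a
  proof (cases "a \<in> ILX")
    case True
    have "v (g a) + m (g a) = v a + m' a" using eq by (simp add: fun_eq_iff)
    then have "v (g a) - v a = m' a - m (g a)" by (simp add: algebra_simps)
    also have "\<dots> \<in> \<int>" using m by (auto simp: shifts_def)
    finally show ?thesis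
      by (intro integral_eq) (use True G_props(2,3)[OF G_under_G[OF g]] in \<open>auto simp: shifted_I_def\<close>)
  next
    case False
    then have "g a = a" by (rule G_under_outside[OF g])
    then show ?thesis by simp
  qed
  then show "g \<in> W" using g by (simp add: stab_iff fun_eq_iff)
  show "m \<circ> g = m'" using eq vg by (auto simp: fun_eq_iff)
qed

text \<open>Let \<open>P\<close> be \<open>1\<close> at \<open>u\<close> and \<open>0\<close> on \<open>Y\<close>. Then \<open>1 - (1 - P\<^sup>N)\<^sup>N\<close> is \<open>1\<close> up to order \<open>N\<close> at \<open>u\<close>
  and a multiple of \<open>P\<^sup>N\<close>.\<close>
lemma separating_polynomial:
  assumes fin: "finite Y" and Y: "\<And>y. y \<in> Y \<Longrightarrow> \<exists>a\<in>A. y a \<noteq> u a"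
  shows "\<exists>Q\<in>polys A. vanishes A u N (Q - 1) \<and> (\<forall>y\<in>Y. vanishes A y N Q)"
proof -
  obtain a where a: "\<And>y. y \<in> Y \<Longrightarrow> a y \<in> A \<and> y (a y) \<noteq> u (a y)" using Y by metis
  define P where "P = (\<Prod>y\<in>Y. (X (a y) - cst (y (a y))) * cst (1 / (u (a y) - y (a y))))"
  have fRA: "(X (a y) - cst (y (a y))) * cst (1 / (u (a y) - y (a y))) \<in> polys A" if "y \<in> Y" for y
    using a[OF that] by (intro polys_closed polys_closed_derived) auto
  have P: "P \<in> polys A" unfolding P_def by (rule polys_prod[OF fRA])
  have fev: "ev w ((X b - cst c) * cst d) = (w b - c) * d" for w b c d
    by (simp add: ev_hom(2)[where A = UNIV] ev_hom_derived(3)[where A = UNIV] polys_closed polys_closed_derived ev_hom)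
  have evP: "ev w P = (\<Prod>y\<in>Y. (w (a y) - y (a y)) * (1 / (u (a y) - y (a y))))" for w
    unfolding P_def using ev_prod[where A = A, OF fRA, where S = Y and v = w] by (simp only: fev)
  have Pu: "ev u P = 1" unfolding evP
  proof (intro prod.neutral ballI)
    fix y assume "y \<in> Y"
    then have "u (a y) - y (a y) \<noteq> 0" using a[of y] by auto
    then show "(u (a y) - y (a y)) * (1 / (u (a y) - y (a y))) = 1" by simp
  qed
  have Py: "ev y P = 0" if "y \<in> Y" for y unfolding evP using that fin by auto
  define Q where "Q = 1 - (1 - P ^ N) ^ N"
  have PN: "1 - P ^ N \<in> polys A" using P by (intro polys_closed_derived)
  have Q: "Q \<in> polys A" unfolding Q_def by (intro polys_closed_derived(2,4,5) PN)
  have "ev u (1 - P ^ N) = 0"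
    using ev_hom_derived(3)[where A = A, OF polys_closed_derived(2) polys_closed_derived(5)[OF P]] ev_hom_derived(4)[OF P] Pu by (simp add: ev_hom_derived)
  then have "vanishes A u N ((1 - P ^ N) ^ N)" by (rule vanishes_power[OF PN])
  then have "vanishes A u N (Q - 1)" unfolding Q_def using vanishes_minus by fastforce
  moreover have "vanishes A y N Q" if "y \<in> Y" for y
  proof -
    \<comment> \<open>\<open>1 - (1 - P\<^sup>N)\<^sup>N\<close> is divisible by \<open>1 - (1 - P\<^sup>N)\<close>\<close>
    let ?S = "\<Sum>i<N. (1 - P ^ N) ^ (N - Suc i) * 1 ^ i"
    have "Q = 1 ^ N - (1 - P ^ N) ^ N" by (simp add: Q_def)
    also have "\<dots> = ?S * P ^ N"
      unfolding power_diff_sumr2 by (simp add: mult.commute)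
    finally have eq: "Q = ?S * P ^ N" .
    have "?S \<in> polys A" by (intro polys_sum polys_closed(4) polys_closed_derived(2,5) PN)
    then show ?thesis unfolding eq by (intro vanishes_mult vanishes_power P Py that)
  qed
  ultimately show ?thesis using Q by blast
qed

lemma vanishes_mono: "vanishes A w n f \<Longrightarrow> A \<subseteq> A' \<Longrightarrow> vanishes A' w n f"
  by (induction rule: vanishes.induct) (auto intro: vanishes.intros dest: subsetD[OF polys_mono])

lemma vanishes_sh_act:
  assumes "vanishes IX ((v + m) \<circ> g) N f" "g \<in> G_under k lam"
  shows "vanishes IX v N (sh m (act g f))"
proof -
  note gG = G_under_G[OF assms(2)]
  note b = G_props(1)[OF gG]
  have "vanishes IX v N ((sh m \<circ> act g) f)"
  proof (rule vanishes_endo[OF assms(1) endo_comp[OF sh_hom act_hom[OF b]]])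
    fix f assume f: "f \<in> polys IX"
    have a: "act g f \<in> polys IX" by (rule act_polys[OF b f]) (simp add: G_props(3)[OF gG])
    have "ev v (sh m (act g f)) = ev (v + m) (act g f)" unfolding plus_fun_def by (rule ev_sh[OF a])
    also have "\<dots> = ev ((v + m) \<circ> g) f" by (rule ev_act[OF b f])
    finally show "(sh m \<circ> act g) f \<in> polys IX \<and> ev v ((sh m \<circ> act g) f) = ev ((v + m) \<circ> g) f"
      using sh_polys[OF a] by simp
  qed
  then show ?thesis by simp
qed

text \<open>Take a polynomial with the jet of \<open>p\<close> at \<open>u = v + m\<^sub>0\<close> and zero jets at all other points of
  the permutation orbits involved, and average it. Near \<open>v + m\<close> the summand of \<open>g\<close> looks like the
  polynomial near \<open>(v + m) \<circ> g\<close>, which differs from \<open>u\<close> unless \<open>m = m\<^sub>0\<close> and \<open>g\<close> fixes \<open>u\<close>; those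
  \<open>g\<close> fix \<open>p\<close>.\<close>
lemma separate:
  assumes m0: "m0 \<in> Sh" "dominant m0" and T: "finite T" "\<And>m. m \<in> T \<Longrightarrow> m \<in> Sh \<and> dominant m \<and> m \<noteq> m0"
    and p: "p \<in> polys ILX" "\<And>g. g \<in> stab k lam (v + m0) \<Longrightarrow> act g p = p"
  shows "\<exists>f\<in>bRR. vanishes IX v N (sh m0 f - p) \<and> (\<forall>m\<in>T. vanishes IX v N (sh m f))"
proof -
  define u where "u = v + m0"
  let ?GU = "G_under k lam"
  define Y where "Y = (\<lambda>(m, g). (v + m) \<circ> g) ` (insert m0 T \<times> ?GU) - {u}"
  have finY: "finite Y" unfolding Y_def using T finite_G_under by auto
  have "\<exists>a\<in>ILX. y a \<noteq> u a" if "y \<in> Y" for y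
  proof (rule ccontr)
    assume n: "\<not> ?thesis"
    obtain m g where y: "y = (v + m) \<circ> g" "m \<in> Sh" "g \<in> ?GU" "y \<noteq> u" using \<open>y \<in> Y\<close> m0 T by (auto simp: Y_def)
    have "y a = u a" for a
    proof (cases "a \<in> ILX")
      case False
      have "g a = a" by (rule G_under_outside[OF y(3) False])
      moreover have "m a = 0" "m0 a = 0" using False y(2) m0(1) by (auto simp: shifts_def shifted_I_def)
      ultimately show ?thesis by (simp add: y(1) u_def)
    qed (use n in blast)
    then show False using y(4) by blast
  qed
  from separating_polynomial[OF finY this]
  obtain Q where Q: "Q \<in> polys ILX" "vanishes ILX u N (Q - 1)" "\<And>y. y \<in> Y \<Longrightarrow> vanishes ILX y N Q" by blast
  define F where "F = Q * sh (- m0) p"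
  have F: "F \<in> polys ILX" unfolding F_def using Q p by (intro polys_closed(4) sh_polys)
  \<comment> \<open>the number of summands with the jet of \<open>p\<close>\<close>
  define c where "c = (of_nat (card (stab k lam u)) :: complex)"
  have finS: "finite (stab k lam u)" using finite_G_under by (rule rev_finite_subset) (auto simp: stab_def)
  have c: "c \<noteq> 0" using finS stab_id by (auto simp: c_def)
  define f where "f = cst (1 / c) * (\<Sum>g\<in>?GU. act g F)"
  have fb: "f \<in> bRR"
    using symmetrize_bR[OF F] unfolding f_def by (auto simp: bR_iff polys_closed endoD(2,3)[OF act_hom[OF G_props(1)]])
  have shf: "sh m f = cst (1 / c) * (\<Sum>g\<in>?GU. sh m (act g F))" for m
    unfolding f_def endoD(2,3)[OF sh_hom] endo_sum[OF sh_hom] ..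
  have vanish: "vanishes IX v N (sh m (act g F))" if m: "m \<in> insert m0 T" and g: "g \<in> ?GU" and ne: "(v + m) \<circ> g \<noteq> u" for m g
  proof (rule vanishes_sh_act[OF _ g])
    have "(v + m) \<circ> g \<in> Y" unfolding Y_def using m g ne by auto
    from vanishes_mono[OF Q(3)[OF this] shifted_I_sub] have "vanishes IX ((v + m) \<circ> g) N (sh (- m0) p * Q)"
      by (rule vanishes_mult) (intro sh_polys polys_shifted_I p)
    then show "vanishes IX ((v + m) \<circ> g) N F" by (simp add: F_def mult.commute)
  qed
  have vT: "vanishes IX v N (sh m f)" if m: "m \<in> T" for m
    unfolding shf
  proof (intro vanishes_mult vanishes_sum polys_closed(1) vanish)
    fix g assume g: "g \<in> ?GU"
    show "(v + m) \<circ> g \<noteq> u"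
    proof
      assume "(v + m) \<circ> g = u"
      then have "(v + m) \<circ> g = v + m0" by (simp add: u_def)
      from shift_perm_eq[OF _ m0(1) g this] have "g \<in> W" "m \<circ> g = m0" using T(2)[OF m] by auto
      then show False using dominant_unique[of m g] T(2)[OF m] m0(2) by simp
    qed
  qed (use m in auto)
  \<comment> \<open>the permutations fixing \<open>u\<close> contribute the jet of \<open>p\<close>, all others nothing\<close>
  have v0: "vanishes IX v N (sh m0 (act g F) - (if g \<in> stab k lam u then p else 0))" if g: "g \<in> ?GU" for g
  proof (cases "g \<in> stab k lam u")
    case False
    then have "(v + m0) \<circ> g \<noteq> u" using g by (simp add: stab_iff u_def)
    then show ?thesis using vanish[OF _ g] False by simp
  next
    case True
    then have eq: "(v + m0) \<circ> g = v + m0" by (simp add: stab_iff u_def)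
    have b: "bij g" by (rule stab_bij[OF True])
    have "m0 \<circ> g = m0" by (rule shift_perm_eq[OF m0(1) m0(1) g eq])
    then have "sh m0 (act g (Q - 1)) = act g (sh m0 (Q - 1))" by (simp only: sh_act[OF b])
    have pg: "sh m0 (act g (sh (- m0) p)) = p"
    proof -
      have "sh m0 (act g (sh (- m0) p)) = act g (sh m0 (sh (- m0) p))" using \<open>m0 \<circ> g = m0\<close> by (simp only: sh_act[OF b])
      also have "sh m0 (sh (- m0) p) = p" by (simp add: sh_sh sh_0)
      also have "act g p = p" by (rule p(2)) (use True in \<open>simp add: u_def\<close>)
      finally show ?thesis .
    qed
    have "sh m0 (act g F) - p = p * sh m0 (act g (Q - 1))"
      unfolding F_def endoD[OF act_hom[OF b]] endoD[OF sh_hom] pg by (simp add: algebra_simps)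
    moreover have "vanishes IX v N (sh m0 (act g (Q - 1)))"
      by (rule vanishes_sh_act[OF _ g]) (use vanishes_mono[OF Q(2) shifted_I_sub] eq in \<open>simp add: u_def\<close>)
    ultimately show ?thesis using vanishes_mult[OF _ polys_shifted_I[OF p(1)]] True by simp
  qed
  have "(\<Sum>g\<in>?GU. sh m0 (act g F) - (if g \<in> stab k lam u then p else 0)) = (\<Sum>g\<in>?GU. sh m0 (act g F)) - cst c * p"
  proof -
    have "(\<Sum>g\<in>?GU. if g \<in> stab k lam u then p else 0) = (\<Sum>g\<in>stab k lam u. p)"
      using finite_G_under by (intro sum.mono_neutral_cong_right) (auto simp: stab_iff)
    also have "\<dots> = cst c * p"
    proof -
      have "of_nat n = cst (of_nat n)" for n by (induction n) (simp_all add: cst_hom)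
      then show ?thesis by (simp add: c_def)
    qed
    finally show ?thesis by (simp add: sum_subtractf)
  qed
  moreover have "vanishes IX v N (cst (1 / c) * (\<Sum>g\<in>?GU. sh m0 (act g F) - (if g \<in> stab k lam u then p else 0)))"
    by (intro vanishes_mult vanishes_sum v0 polys_closed(1))
  moreover have "cst (1 / c) * cst c = 1" using c by (simp add: cst_hom flip: cst_hom(4))
  then have "cst (1 / c) * (S - cst c * p) = cst (1 / c) * S - p" for S
    by (simp add: right_diff_distrib flip: mult.assoc)
  ultimately have "vanishes IX v N (sh m0 f - p)" unfolding shf by simp
  then show ?thesis using fb vT by blast
qed

text \<open>In a linear relation, fix a dominant \<open>m\<^sub>0\<close> that occurs and, among its functionals, one with
  the shortest word, \<open>b\<^sub>0\<close>. The polynomial \<open>f\<close> is built so that only \<open>b\<^sub>0\<close> survives on it.\<close>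
lemma B_independent: "functional.independent (B k lam v)"
proof
  assume "functional.dependent (B k lam v)"
  then obtain t c b1 where t: "finite t" "t \<subseteq> B k lam v" and sum0: "(\<Sum>b\<in>t. fscale (c b) b) = 0" and b1: "b1 \<in> t" "c b1 \<noteq> 0"
    unfolding functional.dependent_explicit by blast
  have "\<exists>ws m. m \<in> Sh \<and> dominant m \<and> ws \<in> lists SV \<and> reduced k lam ws
    \<and> word_prod ws \<in> shortest_reps k lam W (stab k lam (v + m)) \<and> b = word_functional ws 1 m" if "b \<in> t" for b
  proof -
    have "b \<in> B k lam v" using t that by blast
    then show ?thesis unfolding B_eq by blast
  qed
  then obtain wd mm where wm: "\<And>b. b \<in> t \<Longrightarrow> mm b \<in> Sh \<and> dominant (mm b) \<and> wd b \<in> lists SV \<and> reduced k lam (wd b)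
    \<and> word_prod (wd b) \<in> shortest_reps k lam W (stab k lam (v + mm b)) \<and> b = word_functional (wd b) 1 (mm b)"
    by metis
  define m0 where "m0 = mm b1"
  let ?P = "\<lambda>b. b \<in> t \<and> c b \<noteq> 0 \<and> mm b = m0"
  obtain b0 where b0: "?P b0" and least: "\<And>b. ?P b \<Longrightarrow> length (wd b0) \<le> length (wd b)"
    using ex_has_least_nat[of ?P b1 "\<lambda>b. length (wd b)"] b1 by (auto simp: m0_def)
  have m0: "m0 \<in> Sh" "dominant m0" using wm[of b1] b1 by (auto simp: m0_def)
  let ?u = "v + m0"
  have bu: "interval_blocks k lam ?u" by (rule interval_blocks_shift[OF m0])
  have SWu: "stab_simples k lam ?u \<subseteq> SV"
  proof
    fix s assume s: "s \<in> stab_simples k lam ?u"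
    have "v (next_idx s) = v s"
      using shift_eqD(1)[OF m0(1), of "next_idx s" s] s simple_in_I[of s] by (auto simp: stab_simples_def)
    then show "s \<in> SV" using s by (simp add: stab_simples_def)
  qed
  have "reduced k lam []" unfolding reduced_def using inv_num_id by (simp add: word_prod_def)
  then obtain r where r: "r \<in> lists (stab_simples k lam ?u)" "reduced k lam r" "\<And>s. s \<in> stab_simples k lam ?u \<Longrightarrow> descent (word_prod r) s"
    using reduced_extend[of k lam "[]" ?u] by auto
  have rSV: "r \<in> lists SV" using r(1) SWu by blast
  note w0 = wm[of b0]
  have red0: "reduced k lam (wd b0 @ r)"
  proof (rule reduced_append_min[OF bu _ _ r(1,2)])
    show "reduced k lam (wd b0)" using w0 b0 by blast
    show "\<not> descent (word_prod (wd b0)) s" if "s \<in> stab_simples k lam ?u" for s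
      using shortest_asc[OF _ that] w0 b0 by blast
  qed
  \<comment> \<open>completion to a reduced word of the longest element of \<open>W\<close>\<close>
  obtain e where e: "e \<in> lists SV" "reduced k lam ((wd b0 @ r) @ e)" "\<And>s. s \<in> SV \<Longrightarrow> descent (word_prod ((wd b0 @ r) @ e)) s"
    using reduced_extend[OF red0, of v] by blast
  define n where "n = length (wd b0 @ r @ e)"
  let ?full = "\<lambda>b. wd b @ r @ e"
  let ?h = "weight k lam"
  define p where "p = dd_word r (dd_word e (?h ^ n))"
  have pRA: "p \<in> polys ILX"
  proof -
    have "dd_word ws f \<in> polys ILX" if "f \<in> polys ILX" "ws \<in> lists SV" for f ws
    proof (rule dd_word_polys[OF that(1)])
      fix s assume "s \<in> set ws"
      then have "s \<in> shifted_simples k lam" using that(2) SV_shifted_simples by blast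
      then show "s \<in> ILX \<and> next_idx s \<in> ILX" by (rule shifted_simples_shifted_I)
    qed
    then show ?thesis unfolding p_def using rSV e(1) weight_polys polys_closed_derived(5) by blast
  qed
  have pinv: "act g p = p" if "g \<in> stab k lam ?u" for g
    unfolding p_def by (rule longest_invariant[OF bu r that])
  define T where "T = mm ` t - {m0}"
  \<comment> \<open>more than any of the words involved can lower the order of vanishing\<close>
  define N where "N = Suc (\<Sum>b\<in>t. length (wd b))"
  have lenN: "length (wd b) < N" if "b \<in> t" for b
    unfolding N_def using member_le_sum[OF that, of "\<lambda>b. length (wd b)"] t(1) by simp
  have finT: "finite T" and T: "\<And>m. m \<in> T \<Longrightarrow> m \<in> Sh \<and> dominant m \<and> m \<noteq> m0"
    using t(1) wm by (auto simp: T_def)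
  obtain f where f: "f \<in> bRR" "vanishes IX v N (sh m0 f - p)" "\<And>m. m \<in> T \<Longrightarrow> vanishes IX v N (sh m f)"
    using separate[OF m0 finT T pRA pinv, of N] by blast
  have evz: "ev v (dd_word ws F) = 0" if "vanishes IX v N F" "ws \<in> lists SV" "length ws < N" for ws F
  proof (rule ev_dd_word_vanishes[OF _ that(1,3)])
    fix s assume "s \<in> set ws"
    then have "s \<in> SV" using that(2) by blast
    then show "s \<in> IX \<and> next_idx s \<in> IX \<and> v (next_idx s) = v s" using SV_IX by (simp add: stab_simples_def)
  qed
  have val: "b f = ev v (dd_word (wd b) (sh (mm b) f))" if "b \<in> t" for b
  proof -
    have "b f = word_functional (wd b) 1 (mm b) f" using wm[OF that] by simp
    then show ?thesis using f(1) by (simp add: word_functional_def restr_def)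
  qed
  have other: "b f = 0" if "b \<in> t" "mm b \<noteq> m0" for b
    unfolding val[OF that(1)] by (rule evz[OF f(3)]) (use that wm[OF that(1)] lenN[OF that(1)] in \<open>auto simp: T_def\<close>)
  have same: "b f = ev v (dd_word (?full b) (?h ^ n))" if "b \<in> t" "mm b = m0" for b
  proof -
    have ws: "wd b \<in> lists SV" using wm[OF that(1)] by blast
    have polys: "dd_word (wd b) (sh m0 f - p) \<in> polys IX" "dd_word (wd b) p \<in> polys IX"
      using ws f(1) pRA by (intro dd_word_IX polys_closed_derived(4) sh_polys bR_polys polys_shifted_I; blast)+
    have "dd_word (wd b) (sh m0 f) = dd_word (wd b) (sh m0 f - p) + dd_word (wd b) p"
      by (simp flip: dd_word_linear(1))
    then have "b f = ev v (dd_word (wd b) (sh m0 f - p)) + ev v (dd_word (wd b) p)"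
      unfolding val[OF that(1)] that(2) by (simp only: ev_hom(1)[OF polys])
    also have "ev v (dd_word (wd b) (sh m0 f - p)) = 0" by (rule evz[OF f(2) ws lenN[OF that(1)]])
    finally show ?thesis by (simp add: p_def dd_word_append)
  qed
  have fullSV: "?full b \<in> lists SV" if "b \<in> t" for b using wm[OF that] rSV e(1) by simp
  have fullSL: "?full b \<in> lists (shifted_simples k lam)" if "b \<in> t" for b using fullSV[OF that] SV_shifted_simples by blast
  \<comment> \<open>the word of \<open>b\<close> is at least as long as that of \<open>b\<^sub>0\<close>; if its completion is reduced of length
    \<open>n\<close>, it is a word of the longest element, which determines \<open>b\<close>\<close>
  have zero: "b f = 0" if b: "?P b" "b \<noteq> b0" for b
  proof -
    have bt: "b \<in> t" and mb: "mm b = m0" using b by auto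
    have len: "n \<le> length (?full b)" using least[OF b(1)] by (simp add: n_def)
    show ?thesis
    proof (cases "reduced k lam (?full b) \<and> length (?full b) = n")
      case True
      have "word_prod (?full b) = word_prod ((wd b0 @ r) @ e)"
      proof (rule longest_bound(1)[OF interval_blocks_v])
        show "word_prod ((wd b0 @ r) @ e) \<in> W" using fullSV[of b0] b0 by (intro word_prod_stab) simp
        show "inv_num k lam (word_prod ((wd b0 @ r) @ e)) \<le> length (?full b)" using e(2) True by (simp add: reduced_def n_def)
      qed (use e(3) True fullSV[OF bt] in auto)
      then have "word_prod (wd b) \<circ> word_prod (r @ e) = word_prod (wd b0) \<circ> word_prod (r @ e)"
        by (simp only: word_prod_append append_assoc comp_assoc)
      then have "word_prod (wd b) \<circ> word_prod (r @ e) \<circ> inv (word_prod (r @ e)) = word_prod (wd b0) \<circ> word_prod (r @ e) \<circ> inv (word_prod (r @ e))"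
        by (simp only:)
      then have wp: "word_prod (wd b) = word_prod (wd b0)"
        using word_prod_bij[of "r @ e"] by (simp only: comp_assoc surj_iff[THEN iffD1, OF bij_is_surj] comp_id)
      have "dd_word (wd b) F = dd_word (wd b0) F" for F
        by (rule dd_word_unique[OF _ _ wp]) (use wm bt b0 in auto)
      then have "word_functional (wd b) 1 m0 = word_functional (wd b0) 1 m0" unfolding word_functional_def by simp
      moreover have "b = word_functional (wd b) 1 m0" using wm[OF bt] mb by simp
      moreover have "b0 = word_functional (wd b0) 1 m0" using w0 b0 by simp
      ultimately have "b = b0" by simp
      then show ?thesis using b by simp
    next
      case False
      then consider "\<not> reduced k lam (?full b)" | "n < length (?full b)" using len by linarith
      then have "dd_word (?full b) (?h ^ n) = 0"
      proof cases
        case 1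
        have "?full b \<in> lists (simple k lam)" using fullSV[OF bt] stab_simples_simple by blast
        then show ?thesis by (rule dd_word_nonreduced) (rule 1)
      next
        case 2
        show ?thesis by (rule dd_word_weight_power_zero[OF fullSL[OF bt] 2])
      qed
      then show ?thesis unfolding same[OF bt mb] by (simp add: ev_hom_derived)
    qed
  qed
  have nz: "b0 f \<noteq> 0"
  proof -
    have "\<exists>x\<ge>0. dd_word (?full b0) (?h ^ n) = cst (of_real x) \<and> (reduced k lam (?full b0) \<longrightarrow> x > 0)"
      by (rule dd_word_weight_power[OF fullSL]) (use b0 in \<open>auto simp: n_def\<close>)
    then obtain x where "dd_word (?full b0) (?h ^ n) = cst (of_real x)" "x > 0" using e(2) by auto
    then show ?thesis using same[of b0] b0 by (simp add: ev_hom)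
  qed
  have "0 = (\<Sum>b\<in>t. fscale (c b) b) f" by (simp add: sum0)
  also have "\<dots> = (\<Sum>b\<in>t. c b * b f)" by (simp add: sum_fun_app fscale_def)
  also have "\<dots> = (\<Sum>b\<in>{b0}. c b * b f)"
    by (rule sum.mono_neutral_right) (use t b0 zero other in auto)
  finally show False using nz b0 by simp
qed

end

theorem theorem10:
  fixes k :: nat and lam :: "nat \<Rightarrow> nat" and v :: "idx \<Rightarrow> complex"
  assumes "k \<ge> 1"
    and "\<And>i. 1 \<le> i \<Longrightarrow> i \<le> k \<Longrightarrow> lam i \<ge> 1"
    and "v \<in> Vdual k lam"
    and "\<And>w. w \<in> gimel_orbit k lam v \<Longrightarrow> stab k lam w \<subseteq> stab k lam v"
    and "\<And>i a. 1 \<le> i \<Longrightarrow> i \<le> k \<Longrightarrow> a \<in> row lam i \<Longrightarrow>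
           \<exists>p q. stab_orbit k lam v a = {(i, r) | r. p \<le> r \<and> r \<le> p + q}"
  shows "(\<forall>l\<in>M k lam v. \<forall>u\<in>U k lam. right_act k lam l u \<in> M k lam v)
    \<and> functional.independent (B k lam v) \<and> functional.span (B k lam v) = M k lam v"
proof -
  interpret maximal_stabilizer k lam v
    by unfold_locales (use assms(3-5) in blast)+
  show ?thesis using M_right_closed B_independent span_B by blast
qed

end
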